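(* Let $k\ge 2$ be an even integer and let $c_1\le c_2\le\cdots\le c_k$ be positive integers. Put ${\bf h}=c_1+c_2+\cdots+c_k$, $N=2\cdot\mathrm{lcm}(c_1,\dots,c_k)$ and ${\bf c}=c_1c_2\cdots c_k$. Define $$\Psi_{\mathcal C}(\tau)=\prod_{i=1}^k\Psi(c_i\tau),\qquad \Psi(\tau)=\sum_{n=0}^\infty q^{n(n+1)/2},\quad q=e^{2\pi i\tau},\ \tau\in\mathbb H.$$ Then $q^{{\bf h}/8}\Psi_{\mathcal C}(\tau)$ is a modular form of weight $k/2$ on $\Gamma_0(N)$ with character $\chi=\left(\frac{(-1)^{k/2}4{\bf c}}{\cdot}\right)$ if, and only if, ${\bf h}\equiv 0\pmod 8$.
   Context: $\mathbb H$ is the complex upper half-plane. $\Psi_{\mathcal C}$ is the generating function $\sum_{n\ge0}\delta_k(\mathcal C;n)q^n$ of the number of representations of $n$ as $\sum_{i=1}^k c_i z_i(z_i+1)/2$ with $z_i\in\mathbb Z_{\ge0}$. $\left(\frac{m}{\cdot}\right)$ denotes the Kronecker symbol. A modular form of weight $k/2$ on $\Gamma_0(N)$ with character $\chi$ means an element of the space $M_{k/2}(\Gamma_0(N),\chi)$ of holomorphic modular forms. *)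

theory Defs
  imports "HOL-Complex_Analysis.Complex_Analysis" "HOL-Number_Theory.Number_Theory"
begin

abbreviation upper_half_plane :: "complex set" where
  "upper_half_plane \<equiv> {\<tau>. Im \<tau> > 0}"

text \<open>
  The power \<open>q\<^sup>x = e\<^bsup>2\<pi>ix\<tau>\<^esup>\<close> of \<open>q = e\<^bsup>2\<pi>i\<tau>\<^esup>\<close>, as a function of \<open>\<tau>\<close>; for non-integral \<open>x\<close>
  this fixes the branch.
\<close>
definition q_pow :: "real \<Rightarrow> complex \<Rightarrow> complex" where
  "q_pow x \<tau> = exp (2 * of_real pi * \<i> * of_real x * \<tau>)"

definition Psi :: "complex \<Rightarrow> complex" where
  "Psi \<tau> = (\<Sum>n. q_pow (real n * (real n + 1) / 2) \<tau>)"

definition Psi_C :: "nat \<Rightarrow> (nat \<Rightarrow> nat) \<Rightarrow> complex \<Rightarrow> complex" where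
  "Psi_C k c \<tau> = (\<Prod>i=1..k. Psi (of_nat (c i) * \<tau>))"

definition kronecker_prime :: "int \<Rightarrow> int \<Rightarrow> int" where
  "kronecker_prime a p =
     (if p = 2 then (if even a then 0 else if a mod 8 \<in> {1, 7} then 1 else -1)
      else Legendre a p)"

definition kronecker :: "int \<Rightarrow> int \<Rightarrow> int" where
  "kronecker a n =
     (if n = 0 then (if \<bar>a\<bar> = 1 then 1 else 0)
      else (if n < 0 \<and> a < 0 then -1 else 1) *
           (\<Prod>p\<in>#prime_factorization n. kronecker_prime a p))"

definition dirichlet_character :: "nat \<Rightarrow> (int \<Rightarrow> complex) \<Rightarrow> bool" where
  "dirichlet_character N chi \<longleftrightarrow>
     chi 1 = 1 \<and>
     (\<forall>m n. chi (m * n) = chi m * chi n) \<and>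
     (\<forall>m n. [m = n] (mod int N) \<longrightarrow> chi m = chi n) \<and>
     (\<forall>n. chi n = 0 \<longleftrightarrow> \<not> coprime n (int N))"

definition SL2Z :: "(int^2^2) set" where
  "SL2Z = {A. det A = 1}"

definition Gamma0 :: "nat \<Rightarrow> (int^2^2) set" where
  "Gamma0 N = {A \<in> SL2Z. int N dvd A$2$1}"

definition automorphy_factor :: "int^2^2 \<Rightarrow> complex \<Rightarrow> complex" where
  "automorphy_factor A \<tau> = of_int (A$2$1) * \<tau> + of_int (A$2$2)"

definition moebius :: "int^2^2 \<Rightarrow> complex \<Rightarrow> complex" where
  "moebius A \<tau> = (of_int (A$1$1) * \<tau> + of_int (A$1$2)) / automorphy_factor A \<tau>"

definition slash :: "int \<Rightarrow> (complex \<Rightarrow> complex) \<Rightarrow> int^2^2 \<Rightarrow> complex \<Rightarrow> complex" where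
  "slash l f A \<tau> = automorphy_factor A \<tau> powi (- l) * f (moebius A \<tau>)"

text \<open>
  A Fourier expansion in nonnegative powers of \<open>q\<^bsup>1/w\<^esup>\<close>, for some width \<open>w\<close>.
\<close>
definition holomorphic_at_i_infinity :: "(complex \<Rightarrow> complex) \<Rightarrow> bool" where
  "holomorphic_at_i_infinity g \<longleftrightarrow>
     (\<exists>w::nat. w > 0 \<and> (\<exists>a :: nat \<Rightarrow> complex. \<forall>\<tau>\<in>upper_half_plane.
        (\<lambda>n. a n * q_pow (real n / real w) \<tau>) sums g \<tau>))"

text \<open>
  The space \<open>M\<^sub>l(\<Gamma>\<^sub>0(N), \<chi>)\<close> of holomorphic modular forms. Holomorphy at the cusps of \<open>\<Gamma>\<^sub>0(N)\<close> is
  holomorphy at infinity of all \<open>SL\<^sub>2(\<int>)\<close>-translates. The values of \<open>f\<close> outside the upper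
  half-plane are irrelevant. The space only makes sense for a Dirichlet character modulo \<open>N\<close>
  and is taken to be empty otherwise.
\<close>
definition modular_forms :: "int \<Rightarrow> nat \<Rightarrow> (int \<Rightarrow> complex) \<Rightarrow> (complex \<Rightarrow> complex) set" where
  "modular_forms l N chi = {f.
     dirichlet_character N chi \<and>
     f holomorphic_on upper_half_plane \<and>
     (\<forall>A\<in>Gamma0 N. \<forall>\<tau>\<in>upper_half_plane. slash l f A \<tau> = chi (A$2$2) * f \<tau>) \<and>
     (\<forall>A\<in>SL2Z. holomorphic_at_i_infinity (slash l f A))}"

end

theory Submission
  imports Defs "HOL-Probability.Probability"
begin

text \<open>
  Up to the factor \<open>2\<^sup>k\<close>, the function \<open>q\<^bsup>h/8\<^esup> \<Psi>\<^sub>C\<close> is the product of the theta series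
  \<open>\<theta>\<^sub>2(c\<^sub>i \<tau>)\<close>. Translation by 1 multiplies it by \<open>e\<^bsup>2\<pi>ih/8\<^esup>\<close>, which gives the necessity of
  \<open>8 | h\<close>. Conversely, for \<open>d > 0\<close> write \<open>(a\<tau> + b)/(c\<tau> + d) = b/d + \<tau>/(d(c\<tau> + d))\<close>, split the
  series for \<open>\<theta>\<^sub>2\<close> into residue classes modulo \<open>2d\<close> and apply the theta inversion formula to each
  class, complete the square, and invert back. The multiplier that comes out is a quadratic Gauss sum
  modulo \<open>d\<close>. All \<open>k\<close> factors carry the same square root, so that only its even power \<open>k\<close> matters, and
  the product of the Gauss sums is the value of the Kronecker symbol once \<open>8 | h\<close>. Since the function
  is invariant under \<open>\<tau> \<mapsto> \<tau> + 1\<close>, replacing \<open>d\<close> by \<open>d + N\<close> does not change the multiplier: the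
  periodicity of the Kronecker symbol modulo \<open>N\<close> follows from modularity, without quadratic
  reciprocity. At the other cusps the inversion formula gives the required expansions.

  The inversion formula itself is Poisson summation for the Gaussian, extended from the imaginary
  axis by analytic continuation.
\<close>

section \<open>Poisson summation for the Gaussian\<close>

text \<open>Write e(x) for exp(2 pi i x). Expanding (a\<tau> + b)/(c\<tau> + d) around a/c, as is
  done at the cusps, would give Gauss sums whose modulus involves c and is even. Around b/d the
  modulus is d, which is odd because N is even; the 2-power phases separate as e(b c_i d/8) and
  multiply to e(b d h/8). This is how h modulo 8 enters the converse.

  An even number k of Gauss sums modulo d contains the sum G(1) only through its square, which is
  (-1/d) d. Hence the factor (-1)^(k/2) in the character; the factor 4 makes the symbol vanish at
  even d and is invisible at odd d.

  Two restrictions are removed afterwards. The computation takes d > 0; the other matrices are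
  covered by -A, since the sign (-1)^(k/2) coming from the weight agrees with the sign rule of the
  Kronecker symbol. And membership in \<open>modular_forms\<close> presupposes a Dirichlet character
  modulo N, while N can be a proper divisor of 4 c_1 ... c_k, so that the period N is a genuine
  claim.\<close>

definition ecis :: "real \<Rightarrow> complex" where
  "ecis x = cis (2 * pi * x)"

lemma ecis_0 [simp]: "ecis 0 = 1"
  by (simp add: ecis_def )

lemma ecis_add: "ecis (x + y) = ecis x * ecis y"
  by (simp add: ecis_def cis_mult algebra_simps)

lemma norm_ecis [simp]: "norm (ecis x) = 1"
  by (simp add: ecis_def )

lemma ecis_of_int [simp]: "ecis (of_int n) = 1"
  by (simp add: ecis_def cis_multiple_2pi)

lemma ecis_of_nat [simp]: "ecis (of_nat n) = 1"
  using ecis_of_int[of "int n"] by simp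

lemma ecis_eq_if_diff_Ints: "x - y \<in> \<int> \<Longrightarrow> ecis x = ecis y"
proof -
  assume "x - y \<in> \<int>"
  then obtain n where "x = y + of_int n"
    by (metis Ints_cases add.commute diff_add_cancel)
  thus ?thesis by (simp add: ecis_add)
qed

lemma ecis_conv_exp: "ecis x = exp (2 * of_real pi * \<i> * of_real x)"
  by (simp add: ecis_def cis_conv_exp mult_ac)

lemma continuous_on_ecis [continuous_intros]:
  "continuous_on A f \<Longrightarrow> continuous_on A (\<lambda>x. ecis (f x))"
  unfolding ecis_def by (intro continuous_intros)

text \<open>Multiplication by cos^2(pi x) mixes a frequency with its two neighbours, so the powers
  of cos^2 used as kernels below are orthogonal to any function with vanishing Fourier
  coefficients.\<close>

lemma cos_power2_eq_ecis: "complex_of_real ((cos (pi * x))\<^sup>2) = (2 + ecis x + ecis (- x)) / 4"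
proof -
  have "2 * (cos (pi * x))\<^sup>2 = 1 + cos (2 * pi * x)"
    using cos_double_cos[of "pi * x"] by (simp add: mult_ac)
  thus ?thesis
    by (simp add: ecis_def complex_eq_iff field_simps)
qed

text \<open>Convolution with the trigonometric polynomials \<open>cos\<^bsup>2n\<^esup>(\<pi>x)\<close>, which concentrate at 0.\<close>
lemma continuous_zero_fourier_coeffs_imp_zero:
  fixes D :: "real \<Rightarrow> complex"
  assumes cont: "continuous_on {-1/2..1/2} D"
    and zero: "\<And>m::int. integral {-1/2..1/2} (\<lambda>x. D x * ecis (of_int m * x)) = 0"
  shows "D 0 = 0"
proof (rule ccontr)
  assume nz: "D 0 \<noteq> 0"
  define I where "I = {-1/2..1/2::real}"
  define K where "K = (\<lambda>n x. ((cos (pi * x))\<^sup>2) ^ n :: real)"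
  define \<epsilon> where "\<epsilon> = norm (D 0) / 2"
  have \<epsilon>: "\<epsilon> > 0" using nz by (simp add: \<epsilon>_def)
  have contK: "continuous_on I (K n)" for n
    unfolding K_def by (intro continuous_intros)
  have contD: "continuous_on I D" using cont by (simp add: I_def)
  \<comment> \<open>\<open>m\<close> stays arbitrary, since each further factor cos^2 moves the
    frequency by -1, 0 and 1.\<close>
  have int0: "integral I (\<lambda>x. D x * of_real (K n x) * ecis (of_int m * x)) = 0" for n and m :: int
  proof (induction n arbitrary: m)
    case 0
    show ?case using zero[of m] by (simp add: K_def I_def)
  next
    case (Suc n)
    let ?f = "\<lambda>j x. D x * of_real (K n x) * ecis (of_int j * x)"
    have ii: "?f j integrable_on I" for j :: int
      unfolding I_def using contK[of n] contD
      by (intro integrable_continuous_real continuous_intros) (auto simp: I_def)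
    have hi: "(?f j has_integral 0) I" for j :: int
      using integrable_integral[OF ii[of j]] Suc.IH[of j] by simp
    have "(\<lambda>x. D x * of_real (K (Suc n) x) * ecis (of_int m * x))
        = (\<lambda>x. (1/2) * ?f m x + (1/4) * ?f (m + 1) x + (1/4) * ?f (m - 1) x)"
    proof
      fix x
      have e1: "ecis (of_int (m + 1) * x) = ecis (of_int m * x) * ecis x"
       and e2: "ecis (of_int (m - 1) * x) = ecis (of_int m * x) * ecis (-x)"
        by (simp_all add: ecis_add[symmetric] algebra_simps)
      have "of_real (K (Suc n) x) = complex_of_real ((cos (pi * x))\<^sup>2) * of_real (K n x)"
        by (simp add: K_def)
      hence "of_real (K (Suc n) x) = (2 + ecis x + ecis (- x)) / 4 * of_real (K n x)"
        by (simp only: cos_power2_eq_ecis)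
      thus "D x * of_real (K (Suc n) x) * ecis (of_int m * x)
        = (1/2) * ?f m x + (1/4) * ?f (m + 1) x + (1/4) * ?f (m - 1) x"
        unfolding e1 e2 by (simp only:) (simp add: algebra_simps add_divide_distrib)
    qed
    moreover have "(\<dots> has_integral (1/2) * 0 + (1/4) * 0 + (1/4) * 0) I"
      by (intro has_integral_add has_integral_mult_right hi)
    ultimately show ?case
      by (simp only: integral_unique) simp
  qed
  obtain \<delta> where \<delta>: "\<delta> > 0" "\<delta> \<le> 1/2" "\<And>x. \<bar>x\<bar> < \<delta> \<Longrightarrow> norm (D 0 - D x) \<le> \<epsilon>"
  proof -
    have "0 \<in> I" by (simp add: I_def)
    then obtain d where d: "d > 0" "\<And>x. x \<in> I \<Longrightarrow> dist x 0 < d \<Longrightarrow> dist (D x) (D 0) < \<epsilon>"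
      using contD \<epsilon> unfolding continuous_on_iff by metis
    show ?thesis
    proof (rule that[of "min d (1/2)"])
      fix x :: real assume "\<bar>x\<bar> < min d (1/2)"
      hence "x \<in> I" "\<bar>x\<bar> < d" by (auto simp: I_def)
      thus "norm (D 0 - D x) \<le> \<epsilon>"
        using d(2)[of x] by (simp add: dist_norm norm_minus_commute)
    qed (use d in auto)
  qed
  have "compact (D ` I)"
    using contD by (intro compact_continuous_image) (auto simp: I_def)
  then obtain C where C: "\<And>x. x \<in> I \<Longrightarrow> norm (D x) \<le> C"
    by (meson bounded_iff compact_imp_bounded imageI)
  have C0: "C \<ge> 0" using C[of 0] norm_ge_zero[of "D 0"] by (simp add: I_def del: norm_ge_zero)
  \<comment> \<open>Off (-\<delta>, \<delta>) the base cos^2 of the kernel is at most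
    \<open>r\<close>; on [-\<delta>/2, \<delta>/2] it is at least \<open>s\<close>. As r < s, the
    mass near 0 beats the contribution from outside by a factor growing like (s/r)^n.\<close>
  define r where "r = (cos (pi * \<delta>))\<^sup>2"
  define s where "s = (cos (pi * (\<delta> / 2)))\<^sup>2"
  have cosmono: "(cos (pi * y))\<^sup>2 \<le> (cos (pi * x))\<^sup>2" if "\<bar>x\<bar> \<le> \<bar>y\<bar>" "\<bar>y\<bar> \<le> 1/2" for x y
  proof -
    have a: "cos (pi * z) = cos (pi * \<bar>z\<bar>)" for z
      by (cases "z \<ge> 0") auto
    have "cos (pi * \<bar>y\<bar>) \<le> cos (pi * \<bar>x\<bar>)"
      using that by (intro cos_monotone_0_pi_le) (auto intro: mult_left_mono)
    moreover have "0 \<le> cos (pi * \<bar>y\<bar>)"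
      using that by (intro cos_ge_zero) (auto simp: field_simps intro: order.trans[of _ 0])
    ultimately show ?thesis
      unfolding a[of x] a[of y] by (intro power_mono) auto
  qed
  have rs: "r < s"
  proof -
    have "cos (pi * \<delta>) < cos (pi * (\<delta> / 2))"
      using \<delta> by (intro cos_monotone_0_pi) auto
    moreover have "0 \<le> cos (pi * \<delta>)"
      using \<delta> by (intro cos_ge_zero) (auto simp: field_simps intro: order.trans[of _ 0])
    ultimately show ?thesis unfolding r_def s_def by (intro power_strict_mono) auto
  qed
  have s0: "s > 0" using rs by (simp add: r_def) (smt (verit) zero_le_power2)
  \<comment> \<open>Since D is orthogonal to \<open>K n\<close>, D(0) times the mass of
    \<open>K n\<close> is the integral of (D(0) - D(x)) \<open>K n x\<close>. Near 0 this costs at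
    most \<epsilon> = |D(0)|/2 times the mass, which is absorbed on the left; the rest is at most 2
    C r^n.\<close>
  have key: "\<epsilon> * \<delta> * s ^ n \<le> 2 * C * r ^ n" for n
  proof -
    have iK: "K n integrable_on I"
      unfolding I_def using contK[of n] by (intro integrable_continuous_real) (auto simp: I_def)
    have Kpos: "K n x \<ge> 0" for x by (simp add: K_def)
    have "\<delta> * s ^ n = integral {-\<delta>/2..\<delta>/2} (\<lambda>x. s ^ n)"
      using \<delta> by simp
    also have "\<dots> \<le> integral {-\<delta>/2..\<delta>/2} (K n)"
    proof (rule integral_le)
      show "K n integrable_on {-\<delta>/2..\<delta>/2}"
        using iK unfolding I_def by (rule integrable_on_subinterval) (use \<delta> in auto)
      show "s ^ n \<le> K n x" if "x \<in> {-\<delta>/2..\<delta>/2}" for x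
        unfolding s_def K_def using that \<delta> by (intro power_mono cosmono) auto
    qed auto
    also have "\<dots> \<le> integral I (K n)"
      using iK Kpos \<delta> by (intro integral_subset_le integrable_on_subinterval[OF iK[unfolded I_def]]) (auto simp: I_def)
    finally have lower: "\<delta> * s ^ n \<le> integral I (K n)" .
    have "of_real (integral I (K n)) = integral I (\<lambda>x. complex_of_real (K n x))"
      by (metis iK has_integral_of_real integrable_integral integral_unique)
    hence "D 0 * of_real (integral I (K n)) = integral I (\<lambda>x. D 0 * of_real (K n x))"
      by simp
    also have "\<dots> = integral I (\<lambda>x. D 0 * of_real (K n x)) - integral I (\<lambda>x. D x * of_real (K n x))"
      using int0[of n 0] by simp
    also have "\<dots> = integral I (\<lambda>x. (D 0 - D x) * of_real (K n x))"
      unfolding ring_distribs I_def using contK[of n] contD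
      by (intro integral_diff[symmetric] integrable_continuous_real continuous_intros) (auto simp: I_def)
    finally have eq: "D 0 * of_real (integral I (K n)) = \<dots>" .
    have "norm (D 0) * integral I (K n) = norm (D 0 * of_real (integral I (K n)))"
      using integral_nonneg[OF iK] Kpos by (simp add: norm_mult)
    also have "\<dots> \<le> integral I (\<lambda>x. \<epsilon> * K n x + 2 * C * r ^ n)"
      unfolding eq
    proof (rule integral_norm_bound_integral)
      show "(\<lambda>x. (D 0 - D x) * of_real (K n x)) integrable_on I"
        unfolding I_def using contK[of n] contD
        by (intro integrable_continuous_real continuous_intros) (auto simp: I_def)
      show "(\<lambda>x. \<epsilon> * K n x + 2 * C * r ^ n) integrable_on I"
        unfolding I_def using contK[of n]
        by (intro integrable_continuous_real continuous_intros) (auto simp: I_def)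
      fix x assume x: "x \<in> I"
      show "norm ((D 0 - D x) * of_real (K n x)) \<le> \<epsilon> * K n x + 2 * C * r ^ n"
      proof (cases "\<bar>x\<bar> < \<delta>")
        case True
        have "norm (D 0 - D x) * K n x \<le> \<epsilon> * K n x"
          using \<delta>(3)[OF True] Kpos by (intro mult_right_mono)
        moreover have "0 \<le> 2 * C * r ^ n" using C0 by (simp add: r_def)
        ultimately show ?thesis using Kpos[of x] by (simp add: norm_mult)
      next
        case False
        have "norm (D 0 - D x) \<le> 2 * C"
          using norm_triangle_ineq4[of "D 0" "D x"] C[of 0] C[OF x] by (simp add: I_def)
        moreover have "K n x \<le> r ^ n"
          unfolding K_def r_def using False x \<delta> by (intro power_mono cosmono) (auto simp: I_def)
        ultimately have "norm (D 0 - D x) * K n x \<le> 2 * C * r ^ n"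
          using Kpos C0 by (intro mult_mono) auto
        moreover have "0 \<le> \<epsilon> * K n x" using \<epsilon> Kpos by simp
        ultimately show ?thesis using Kpos[of x] by (simp add: norm_mult)
      qed
    qed
    also have "\<dots> = \<epsilon> * integral I (K n) + 2 * C * r ^ n"
      using iK by (subst integral_add) (auto simp: I_def intro!: integrable_on_mult_right)
    finally have "\<epsilon> * integral I (K n) \<le> 2 * C * r ^ n"
      by (simp add: \<epsilon>_def field_simps)
    moreover have "\<epsilon> * (\<delta> * s ^ n) \<le> \<epsilon> * integral I (K n)"
      using lower \<epsilon> by (intro mult_left_mono) auto
    ultimately show ?thesis by (simp add: mult_ac)
  qed
  have "(\<lambda>n. 2 * C * (r / s) ^ n) \<longlonglongrightarrow> 2 * C * 0"
    using rs s0 by (intro tendsto_intros LIMSEQ_power_zero) (auto simp: r_def)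
  moreover have "\<epsilon> * \<delta> \<le> 2 * C * (r / s) ^ n" for n
    using key[of n] s0 by (simp add: field_simps)
  ultimately have "\<epsilon> * \<delta> \<le> 0"
    by (simp add: LIMSEQ_le_const)
  thus False using \<epsilon> \<delta> by (simp add: mult_le_0_iff)
qed

section \<open>Periodization and the Poisson formula\<close>

lemma filterlim_int_intervals_finite_subsets:
  "filterlim (\<lambda>N. {- int N..int N}) (finite_subsets_at_top UNIV) sequentially"
  unfolding filterlim_finite_subsets_at_top
proof (intro allI impI, elim conjE)
  fix X :: "int set" assume X: "finite X"
  show "eventually (\<lambda>N. finite {- int N..int N} \<and> X \<subseteq> {- int N..int N} \<and> {- int N..int N} \<subseteq> UNIV) sequentially"
    using eventually_ge_at_top[of "nat (Max (insert 0 (abs ` X)))"]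
  proof eventually_elim
    case (elim N)
    have "x \<in> {- int N..int N}" if "x \<in> X" for x
    proof -
      have "\<bar>x\<bar> \<le> Max (insert 0 (abs ` X))" using X that by (intro Max_ge) auto
      thus ?thesis using elim by auto
    qed
    thus ?case by auto
  qed
qed

lemma summable_on_int_power_abs:
  fixes r :: real
  assumes "0 \<le> r" "r < 1"
  shows "(\<lambda>n::int. r ^ nat \<bar>n\<bar>) summable_on UNIV"
proof -
  have s: "(\<lambda>n. r ^ n) summable_on UNIV"
    using assms by (intro summable_nonneg_imp_summable_on summable_geometric) auto
  have "(\<lambda>n::int. r ^ nat \<bar>n\<bar>) summable_on range int"
    using s by (subst summable_on_reindex) (auto simp: o_def)
  moreover have "(\<lambda>n::int. r ^ nat \<bar>n\<bar>) summable_on range (\<lambda>n. - int n)"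
    using s by (subst summable_on_reindex) (auto simp: o_def inj_on_def)
  ultimately have "(\<lambda>n::int. r ^ nat \<bar>n\<bar>) summable_on (range int \<union> range (\<lambda>n. - int n))"
    by (rule summable_on_union)
  also have "range int \<union> range (\<lambda>n. - int n) = UNIV"
  proof -
    have "x \<in> range int \<or> x \<in> range (\<lambda>n. - int n)" for x :: int
    proof (cases "x \<ge> 0")
      case True
      hence "x = int (nat x)" by simp
      thus ?thesis by blast
    next
      case False
      hence "x = - int (nat (- x))" by simp
      thus ?thesis by blast
    qed
    thus ?thesis by auto
  qed
  finally show ?thesis .
qed

text \<open>The integer translates of [-1/2, 1/2] tile the line, and the majorant \<open>M\<close>
  allows termwise integration. Applied to a Gaussian times e(-m x), a character that integer shifts
  do not change, it yields every Fourier coefficient of the periodized Gaussian.\<close>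

lemma integral_periodization:
  fixes G :: "real \<Rightarrow> complex" and M :: "int \<Rightarrow> real"
  assumes cont: "continuous_on UNIV G" and int: "integrable lborel G"
    and bound: "\<And>n x. x \<in> {-1/2..1/2} \<Longrightarrow> norm (G (x + of_int n)) \<le> M n"
    and M: "M summable_on UNIV"
  shows "continuous_on {-1/2..1/2} (\<lambda>x. \<Sum>\<^sub>\<infinity>n::int. G (x + of_int n))"
    and "integral {-1/2..1/2} (\<lambda>x. \<Sum>\<^sub>\<infinity>n::int. G (x + of_int n)) = integral\<^sup>L lborel G"
proof -
  have unif: "uniform_limit {-1/2..1/2} (\<lambda>X x. \<Sum>n\<in>X. G (x + of_int n))
      (\<lambda>x. \<Sum>\<^sub>\<infinity>n::int. G (x + of_int n)) (finite_subsets_at_top UNIV)"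
    by (rule Weierstrass_m_test_general[OF _ M]) (use bound in auto)
  have contG: "continuous_on A (\<lambda>x. G (x + of_int n))" for n :: int and A
    by (intro continuous_on_compose2[OF cont] continuous_intros) auto
  have contS: "continuous_on {-1/2..1/2} (\<lambda>x. \<Sum>n\<in>X. G (x + of_int n))" for X :: "int set"
    by (intro continuous_intros contG)
  show "continuous_on {-1/2..1/2} (\<lambda>x. \<Sum>\<^sub>\<infinity>n::int. G (x + of_int n))"
    by (rule uniform_limit_theorem[OF _ unif]) (use contS in auto)
  obtain I J where IJ: "\<And>X. ((\<lambda>x. \<Sum>n\<in>X. G (x + of_int n)) has_integral I X) {-1/2..1/2}"
      "((\<lambda>x. \<Sum>\<^sub>\<infinity>n::int. G (x + of_int n)) has_integral J) {-1/2..1/2}"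
      "(I \<longlongrightarrow> J) (finite_subsets_at_top UNIV)"
    using uniform_limit_integral[OF unif contS finite_subsets_at_top_neq_bot] by blast
  have lim1: "(\<lambda>N. I {-int N..int N}) \<longlonglongrightarrow> J"
    by (rule filterlim_compose[OF IJ(3) filterlim_int_intervals_finite_subsets])
  have iG: "G integrable_on {a..b}" for a b
    by (intro integrable_continuous_real continuous_on_subset[OF cont]) auto
  have shift: "integral {-1/2..1/2} (\<lambda>x. G (x + of_int n)) = integral {of_int n - 1/2..of_int n + 1/2} G" for n :: int
    using integral_shift[of "-1/2" "of_int n" "1/2" G] cont
    by (simp add: o_def add_ac continuous_on_subset)
  have I_eq: "I {-int N..int N} = integral {- real N - 1/2..real N + 1/2} G" for N
  proof -
    have "I {-int N..int N} = integral {-1/2..1/2} (\<lambda>x. \<Sum>n\<in>{-int N..int N}. G (x + of_int n))"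
      by (rule integral_unique[OF IJ(1), symmetric])
    also have "\<dots> = (\<Sum>n\<in>{-int N..int N}. integral {-1/2..1/2} (\<lambda>x. G (x + of_int n)))"
      by (intro integral_sum integrable_continuous_real contG) auto
    also have "\<dots> = (\<Sum>n\<in>{-int N..int N}. integral {of_int n - 1/2..of_int n + 1/2} G)"
      by (simp only: shift)
    also have "\<dots> = integral {- real N - 1/2..real N + 1/2} G"
    proof (induction N)
      case (Suc N)
      have "{-int (Suc N)..int (Suc N)} = insert (int (Suc N)) (insert (-int (Suc N)) {-int N..int N})"
        by auto
      hence "(\<Sum>n\<in>{-int (Suc N)..int (Suc N)}. integral {of_int n - 1/2..of_int n + 1/2} G)
         = integral {-real (Suc N) - 1/2..- real N - 1/2} G + integral {- real N - 1/2..real N + 1/2} G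
             + integral {real N + 1/2..real (Suc N) + 1/2} G"
        using Suc.IH by (simp add: add_ac)
      also have "\<dots> = integral {- real (Suc N) - 1/2..real (Suc N) + 1/2} G"
        by (simp add: Henstock_Kurzweil_Integration.integral_combine iG)
      finally show ?case .
    qed auto
    finally show ?thesis .
  qed
  \<comment> \<open>The integral over [-N - 1/2, N + 1/2] is the partial sum over |n| \<le> N, which
    tends to \<open>J\<close>; dominated convergence gives the second value of the same
    limit.\<close>
  have lim2: "(\<lambda>N. integral {- real N - 1/2..real N + 1/2} G) \<longlonglongrightarrow> integral\<^sup>L lborel G"
  proof -
    have "(\<lambda>N. integral\<^sup>L lborel (\<lambda>x. indicator {- real N - 1/2..real N + 1/2} x *\<^sub>R G x)) \<longlonglongrightarrow> integral\<^sup>L lborel G"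
    proof (rule integral_dominated_convergence[where w = "\<lambda>x. norm (G x)"])
      show "AE x in lborel. (\<lambda>N. indicator {- real N - 1/2..real N + 1/2} x *\<^sub>R G x) \<longlonglongrightarrow> G x"
      proof (rule AE_I2)
        fix x :: real
        have "eventually (\<lambda>N. indicator {- real N - 1/2..real N + 1/2} x *\<^sub>R G x = G x) sequentially"
          using eventually_ge_at_top[of "nat \<lceil>\<bar>x\<bar>\<rceil>"]
        proof eventually_elim
          case (elim N)
          hence "\<bar>x\<bar> \<le> real N" by linarith
          hence "x \<in> {- real N - 1/2..real N + 1/2}" by auto
          thus ?case by simp
        qed
        thus "(\<lambda>N. indicator {- real N - 1/2..real N + 1/2} x *\<^sub>R G x) \<longlonglongrightarrow> G x"
          by (rule tendsto_eventually)
      qed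
    qed (use int in \<open>auto simp: indicator_def\<close>)
    also have "(\<lambda>N. integral\<^sup>L lborel (\<lambda>x. indicator {- real N - 1/2..real N + 1/2} x *\<^sub>R G x))
      = (\<lambda>N. integral {- real N - 1/2..real N + 1/2} G)"
    proof
      fix N
      have "set_integrable lborel {- real N - 1/2..real N + 1/2} G"
        using int by (auto simp: set_integrable_def intro!: integrable_mult_indicator)
      from set_borel_integral_eq_integral(2)[OF this]
      show "integral\<^sup>L lborel (\<lambda>x. indicator {- real N - 1/2..real N + 1/2} x *\<^sub>R G x)
          = integral {- real N - 1/2..real N + 1/2} G"
        by (simp add: set_lebesgue_integral_def)
    qed
    finally show ?thesis .
  qed
  have "J = integral\<^sup>L lborel G"
    using LIMSEQ_unique[OF lim1[unfolded I_eq] lim2] .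
  thus "integral {-1/2..1/2} (\<lambda>x. \<Sum>\<^sub>\<infinity>n::int. G (x + of_int n)) = integral\<^sup>L lborel G"
    using IJ(2) by (simp add: integral_unique)
qed

text \<open>The Gaussian is a rescaled standard normal density, whose Fourier transform is its
  characteristic function exp(-s^2/2). An affine substitution carries over both integrability and
  value.\<close>

lemma gaussian_fourier_transform:
  fixes t m x0 :: real
  assumes t: "t > 0"
  shows "integrable lborel (\<lambda>x. of_real (exp (- pi * t * (x0 + x)\<^sup>2)) * ecis (- m * x))"
    and "integral\<^sup>L lborel (\<lambda>x. of_real (exp (- pi * t * (x0 + x)\<^sup>2)) * ecis (- m * x))
           = ecis (m * x0) * of_real (exp (- pi * m\<^sup>2 / t) / sqrt t)"
proof -
  \<comment> \<open>\<open>c\<close> is chosen so that (c(x0 + x))^2/2 = pi t (x0 + x)^2, and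
    \<open>s\<close> so that s c = -2 pi m.\<close>
  define c where "c = sqrt (2 * pi * t)"
  have c: "c > 0" "c\<^sup>2 = 2 * pi * t" using t by (auto simp: c_def)
  define s where "s = - 2 * pi * m / c"
  let ?f = "\<lambda>x. std_normal_density x *\<^sub>R iexp (s * x)"
  have int_f: "integrable lborel ?f"
  proof (rule Bochner_Integration.integrable_bound)
    show "integrable lborel std_normal_density" by simp
  qed auto
  have val: "integral\<^sup>L lborel ?f = of_real (exp (- s\<^sup>2 / 2))"
  proof -
    have "integral\<^sup>L lborel ?f = char std_normal_distribution s"
      unfolding char_def by (subst integral_density) auto
    thus ?thesis by (simp add: char_std_normal_distribution)
  qed
  have eq: "?f (c * x0 + c * x) = of_real (sqrt t / c) * (ecis (- m * x0) *
             (of_real (exp (- pi * t * (x0 + x)\<^sup>2)) * ecis (- m * x)))" for x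
  proof -
    have "c * x0 + c * x = c * (x0 + x)" by (simp add: algebra_simps)
    moreover have "sqrt t / c = 1 / sqrt (2 * pi)"
      using t by (simp add: c_def real_sqrt_mult)
    moreover have "iexp (s * (c * (x0 + x))) = ecis (- m * x0) * ecis (- m * x)"
    proof -
      have "s * (c * (x0 + x)) = 2 * pi * (- m * x0) + 2 * pi * (- m * x)"
        using c by (simp add: s_def field_simps)
      thus ?thesis by (simp only: ecis_def cis_mult cis_conv_exp[symmetric])
    qed
    moreover have "(c * (x0 + x))\<^sup>2 / 2 = pi * t * (x0 + x)\<^sup>2"
      using c(2) by (simp add: power_mult_distrib)
    ultimately show ?thesis
      by (simp add: std_normal_density_def scaleR_conv_of_real mult_ac)
  qed
  have "integrable lborel (\<lambda>x. ?f (c * x0 + c * x))"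
    using c by (intro lborel_integrable_real_affine int_f) auto
  hence ii: "integrable lborel (\<lambda>x. of_real (sqrt t / c) * (ecis (- m * x0) *
             (of_real (exp (- pi * t * (x0 + x)\<^sup>2)) * ecis (- m * x))))"
    by (simp only: eq)
  have nz: "of_real (sqrt t / c) \<noteq> (0::complex)" "ecis (- m * x0) \<noteq> 0"
    using c t norm_ecis[of "-m * x0"] by (auto simp del: norm_ecis simp: ecis_def)
  have "integrable lborel (\<lambda>x. 1 / (of_real (sqrt t / c) * ecis (- m * x0)) * (of_real (sqrt t / c) * (ecis (- m * x0) *
             (of_real (exp (- pi * t * (x0 + x)\<^sup>2)) * ecis (- m * x)))))"
    by (rule integrable_mult_right) (rule ii)
  moreover have "1 / (of_real (sqrt t / c) * ecis (- m * x0)) * (of_real (sqrt t / c) * (ecis (- m * x0) * z)) = z" for z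
    using nz by simp
  ultimately show "integrable lborel (\<lambda>x. of_real (exp (- pi * t * (x0 + x)\<^sup>2)) * ecis (- m * x))"
    by (simp only:)
  have "of_real (exp (- s\<^sup>2 / 2)) = c *\<^sub>R integral\<^sup>L lborel (\<lambda>x. ?f (c * x0 + c * x))"
    unfolding val[symmetric] using c by (subst lborel_integral_real_affine[of c _ "c * x0"]) auto
  also have "\<dots> = of_real (sqrt t) * (ecis (- m * x0) *
      integral\<^sup>L lborel (\<lambda>x. of_real (exp (- pi * t * (x0 + x)\<^sup>2)) * ecis (- m * x)))"
    unfolding eq using c by (simp add: scaleR_conv_of_real)
  finally have *: "of_real (exp (- s\<^sup>2 / 2)) = \<dots>" .
  have "s\<^sup>2 / 2 = pi * m\<^sup>2 / t"
    using c t by (simp add: s_def power_divide power_mult_distrib) (simp add: power2_eq_square)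
  hence "ecis (m * x0) * of_real (exp (- pi * m\<^sup>2 / t) / sqrt t) = (ecis (m * x0) * ecis (- m * x0)) *
       integral\<^sup>L lborel (\<lambda>x. of_real (exp (- pi * t * (x0 + x)\<^sup>2)) * ecis (- m * x))"
    using * t unfolding minus_mult_left[symmetric] minus_divide_left[symmetric] by simp
  also have "ecis (m * x0) * ecis (- m * x0) = 1"
    by (simp add: ecis_add[symmetric])
  finally show "integral\<^sup>L lborel (\<lambda>x. of_real (exp (- pi * t * (x0 + x)\<^sup>2)) * ecis (- m * x))
           = ecis (m * x0) * of_real (exp (- pi * m\<^sup>2 / t) / sqrt t)" by simp
qed

text \<open>A quadratic exponent dominates a linear one: (y - 1/2)^2 \<ge> 0 gives y^2 \<ge> y - 1
  for y = |n| - |x|. The Gaussian sums thus have a geometric majorant, uniform in |x| \<le>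
  R.\<close>

lemma gaussian_int_bound:
  fixes t R x :: real and n :: int
  assumes "t > 0" "\<bar>x\<bar> \<le> R"
  shows "exp (- pi * t * (x + of_int n)\<^sup>2) \<le> exp (pi * t * (R + 1)) * exp (- pi * t) ^ nat \<bar>n\<bar>"
proof -
  have "(of_int \<bar>n\<bar> - \<bar>x\<bar>)\<^sup>2 \<le> (x + of_int n)\<^sup>2"
    by (rule abs_le_square_iff[THEN iffD1]) linarith
  moreover have "of_int \<bar>n\<bar> - R - 1 \<le> (of_int \<bar>n\<bar> - \<bar>x\<bar>)\<^sup>2"
  proof -
    have "0 \<le> (of_int \<bar>n\<bar> - \<bar>x\<bar> - 1/2)\<^sup>2" by simp
    thus ?thesis using assms(2) by (simp add: power2_eq_square algebra_simps)
  qed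
  ultimately have "of_int \<bar>n\<bar> - (R + 1) \<le> (x + of_int n)\<^sup>2" by linarith
  hence "(pi * t) * (of_int \<bar>n\<bar> - (R + 1)) \<le> (pi * t) * (x + of_int n)\<^sup>2"
    using assms(1) by (intro mult_left_mono) auto
  moreover have "exp (- pi * t) ^ nat \<bar>n\<bar> = exp (- pi * t * of_int \<bar>n\<bar>)"
    by (simp add: exp_of_nat_mult[symmetric] mult_ac)
  ultimately show ?thesis
    by (simp add: exp_add[symmetric] algebra_simps)
qed

text \<open>As functions of an additional shift x, both sides are continuous on [-1/2, 1/2] and have
  the same Fourier coefficients e(m x0) \<open>b m\<close>, so they agree at x = 0.\<close>

lemma gaussian_poisson_summation:
  fixes t x0 :: real
  assumes t: "t > 0"
  shows "(\<Sum>\<^sub>\<infinity>n::int. complex_of_real (exp (- pi * t * (x0 + of_int n)\<^sup>2))) =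
    of_real (1 / sqrt t) * (\<Sum>\<^sub>\<infinity>m::int. of_real (exp (- pi * (of_int m)\<^sup>2 / t)) * ecis (of_int m * x0))"
proof -
  define I where "I = {-1/2..1/2::real}"
  define F where "F = (\<lambda>x. \<Sum>\<^sub>\<infinity>n::int. complex_of_real (exp (- pi * t * (x0 + x + of_int n)\<^sup>2)))"
  define b where "b = (\<lambda>m::int. exp (- pi * (of_int m)\<^sup>2 / t) / sqrt t)"
  define B where "B = (\<lambda>x. \<Sum>\<^sub>\<infinity>m::int. of_real (b m) * ecis (of_int m * (x0 + x)))"
  define M where "M = (\<lambda>n::int. exp (pi * t * (\<bar>x0\<bar> + 1/2 + 1)) * exp (- pi * t) ^ nat \<bar>n\<bar>)"
  have Msum: "M summable_on UNIV"
    unfolding M_def using t by (intro summable_on_cmult_right summable_on_int_power_abs) auto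
  have bsum: "b summable_on UNIV"
  proof (rule summable_on_comparison_test)
    show "(\<lambda>m::int. exp (pi * (1/t) * (0 + 1)) * exp (- pi * (1/t)) ^ nat \<bar>m\<bar> * (1 / sqrt t)) summable_on UNIV"
      using t by (intro summable_on_cmult_left summable_on_cmult_right summable_on_int_power_abs) auto
    show "b m \<le> exp (pi * (1/t) * (0 + 1)) * exp (- pi * (1/t)) ^ nat \<bar>m\<bar> * (1 / sqrt t)" for m
      unfolding b_def using gaussian_int_bound[of "1/t" 0 0 m] t
      by (simp add: divide_right_mono)
  qed (use t in \<open>auto simp: b_def\<close>)
  have F: "continuous_on I (\<lambda>x. F x * ecis (- of_int m * x)) \<and>
      integral I (\<lambda>x. F x * ecis (- of_int m * x)) = ecis (of_int m * x0) * of_real (b m)" for m :: int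
  proof -
    define G where "G = (\<lambda>x. complex_of_real (exp (- pi * t * (x0 + x)\<^sup>2)) * ecis (- of_int m * x))"
    have Geq: "G (x + of_int n) = complex_of_real (exp (- pi * t * (x0 + x + of_int n)\<^sup>2)) * ecis (- of_int m * x)" for x and n :: int
    proof -
      have "ecis (- of_int m * (x + of_int n)) = ecis (- of_int m * x)"
        by (rule ecis_eq_if_diff_Ints) (simp add: algebra_simps)
      thus ?thesis by (simp add: G_def add_ac)
    qed
    have 1: "continuous_on UNIV G" unfolding G_def by (intro continuous_intros)
    have 2: "integrable lborel G" and 3: "integral\<^sup>L lborel G = ecis (of_int m * x0) * of_real (b m)"
      unfolding G_def b_def using gaussian_fourier_transform[OF t, of x0 "of_int m"] by simp_all
    have 4: "norm (G (x + of_int n)) \<le> M n" if "x \<in> {-1/2..1/2}" for n x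
    proof -
      have "\<bar>x0 + x\<bar> \<le> \<bar>x0\<bar> + 1/2" using that by auto
      from gaussian_int_bound[OF t this, of n] show ?thesis
        unfolding Geq M_def norm_mult norm_ecis norm_of_real by simp
    qed
    have 5: "(\<Sum>\<^sub>\<infinity>n::int. G (x + of_int n)) = F x * ecis (- of_int m * x)" for x
      unfolding Geq F_def by (simp add: infsum_cmult_left')
    show ?thesis
      using integral_periodization[OF 1 2 4 Msum] by (simp add: 5 3 I_def)
  qed
  \<comment> \<open>Here orthogonality of the characters gives the coefficients: only the term n = m
    survives, so the integral of a finite partial sum is constant once its index set contains
    m.\<close>
  have B: "continuous_on I (\<lambda>x. B x * ecis (- of_int m * x)) \<and>
      integral I (\<lambda>x. B x * ecis (- of_int m * x)) = ecis (of_int m * x0) * of_real (b m)" for m :: int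
  proof -
    let ?f = "\<lambda>n x. of_real (b n) * ecis (of_int n * (x0 + x)) * ecis (- of_int m * x)"
    have bpos: "b n \<ge> 0" for n using t by (simp add: b_def)
    have unif: "uniform_limit {-1/2..1/2} (\<lambda>X x. \<Sum>n\<in>X. ?f n x) (\<lambda>x. \<Sum>\<^sub>\<infinity>n. ?f n x) (finite_subsets_at_top UNIV)"
      by (rule Weierstrass_m_test_general[OF _ bsum]) (use bpos in \<open>auto simp: norm_mult\<close>)
    have contf: "continuous_on A (?f n)" for n A
      by (intro continuous_intros)
    have conts: "continuous_on {-1/2..1/2} (\<lambda>x. \<Sum>n\<in>X. ?f n x)" for X :: "int set"
      by (intro continuous_intros)
    have eq: "(\<Sum>\<^sub>\<infinity>n. ?f n x) = B x * ecis (- of_int m * x)" for x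
      by (simp add: B_def infsum_cmult_left')
    have 1: "continuous_on I (\<lambda>x. B x * ecis (- of_int m * x))"
      unfolding I_def eq[symmetric] by (rule uniform_limit_theorem[OF _ unif]) (use conts in auto)
    obtain J K where JK: "\<And>X. ((\<lambda>x. \<Sum>n\<in>X. ?f n x) has_integral J X) {-1/2..1/2}"
      "((\<lambda>x. \<Sum>\<^sub>\<infinity>n. ?f n x) has_integral K) {-1/2..1/2}"
      "(J \<longlongrightarrow> K) (finite_subsets_at_top UNIV)"
      using uniform_limit_integral[OF unif conts finite_subsets_at_top_neq_bot] by blast
    have int_ecis: "((\<lambda>x. ecis (of_int j * x)) has_integral (if j = 0 then 1 else 0)) {-1/2..1/2}" for j :: int
    proof (cases "j = 0")
      case True
      thus ?thesis using has_integral_const_real[of "1::complex" "-1/2" "1/2"] by simp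
    next
      case False
      define a where "a = 2 * pi * of_int j"
      have a: "a \<noteq> 0" using False by (simp add: a_def)
      have "((\<lambda>x. cis (a * x)) has_integral cis (a * (1/2)) / (\<i> * a) - cis (a * (- 1/2)) / (\<i> * a)) {-1/2..1/2}"
      proof (rule fundamental_theorem_of_calculus)
        fix x :: real
        have "((\<lambda>x. exp (\<i> * of_real a * x) / (\<i> * a)) has_field_derivative exp (\<i> * of_real a * x)) (at (of_real x))"
          using a by (auto intro!: derivative_eq_intros)
        hence "((\<lambda>x. exp (\<i> * of_real a * of_real x) / (\<i> * a)) has_vector_derivative exp (\<i> * of_real a * x)) (at x within {-1/2..1/2})"
          by (rule has_vector_derivative_real_field)
        thus "((\<lambda>x. cis (a * x) / (\<i> * a)) has_vector_derivative cis (a * x)) (at x within {-1/2..1/2})"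
          by (simp add: cis_conv_exp mult_ac)
      qed auto
      moreover have "cis (a * (1/2)) = cis (a * (- 1/2))"
      proof -
        have "cis (a * (1/2)) = cis (a * (- 1/2)) * cis a" by (simp add: cis_mult field_simps)
        moreover have "cis a = 1" by (simp add: a_def cis_multiple_2pi)
        ultimately show ?thesis by simp
      qed
      ultimately show ?thesis using False by (simp add: ecis_def a_def mult_ac)
    qed
    have Jeq: "J X = ecis (of_int m * x0) * of_real (b m)" if X: "finite X" "m \<in> X" for X
    proof -
      have fn: "?f n = (\<lambda>x. of_real (b n) * ecis (of_int n * x0) * ecis (of_int (n - m) * x))" for n
        by (rule ext) (simp add: ecis_add[symmetric] algebra_simps)
      have "((\<lambda>x. \<Sum>n\<in>X. ?f n x) has_integral (\<Sum>n\<in>X. of_real (b n) * ecis (of_int n * x0) * (if n - m = 0 then 1 else 0))) {-1/2..1/2}"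
      proof (intro has_integral_sum X)
        show "(?f n has_integral of_real (b n) * ecis (of_int n * x0) * (if n - m = 0 then 1 else 0)) {-1/2..1/2}" for n
          unfolding fn by (intro has_integral_mult_right int_ecis)
      qed
      moreover have "(\<Sum>n\<in>X. of_real (b n) * ecis (of_int n * x0) * (if n - m = 0 then 1 else 0))
           = (\<Sum>n\<in>X. if n = m then of_real (b m) * ecis (of_int m * x0) else 0)"
        by (intro sum.cong) auto
      ultimately show ?thesis
        using has_integral_unique[OF JK(1)[of X]] X by (simp add: mult_ac)
    qed
    have "eventually (\<lambda>X. J X = ecis (of_int m * x0) * of_real (b m)) (finite_subsets_at_top UNIV)"
      unfolding eventually_finite_subsets_at_top
      by (rule exI[of _ "{m}"]) (use Jeq in auto)
    hence "(J \<longlongrightarrow> ecis (of_int m * x0) * of_real (b m)) (finite_subsets_at_top UNIV)"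
      by (rule tendsto_eventually)
    hence "K = ecis (of_int m * x0) * of_real (b m)"
      using JK(3) tendsto_unique[OF finite_subsets_at_top_neq_bot] by blast
    thus ?thesis using 1 JK(2) unfolding eq I_def by (simp only: integral_unique)
  qed
  have "F 0 - B 0 = 0"
  proof (rule continuous_zero_fourier_coeffs_imp_zero[of "\<lambda>x. F x - B x"])
    show "continuous_on {-1/2..1/2} (\<lambda>x. F x - B x)"
      using F[of 0] B[of 0] by (intro continuous_intros) (auto simp: I_def)
    fix m :: int
    have "integral I (\<lambda>x. F x * ecis (of_int m * x) - B x * ecis (of_int m * x)) =
        integral I (\<lambda>x. F x * ecis (of_int m * x)) - integral I (\<lambda>x. B x * ecis (of_int m * x))"
      using F[of "-m"] B[of "-m"] unfolding I_def
      by (intro integral_diff integrable_continuous_real) auto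
    also have "\<dots> = 0" using F[of "-m"] B[of "-m"] by simp
    finally show "integral {-1/2..1/2} (\<lambda>x. (F x - B x) * ecis (of_int m * x)) = 0"
      by (simp add: I_def ring_distribs)
  qed
  moreover have "B 0 = of_real (1 / sqrt t) * (\<Sum>\<^sub>\<infinity>m::int. of_real (exp (- pi * (of_int m)\<^sup>2 / t)) * ecis (of_int m * x0))"
  proof -
    have "of_real (b m) * ecis (of_int m * (x0 + 0)) =
        of_real (1 / sqrt t) * (of_real (exp (- pi * (of_int m)\<^sup>2 / t)) * ecis (of_int m * x0))" for m
      by (simp add: b_def)
    thus ?thesis unfolding B_def by (simp only: infsum_cmult_right')
  qed
  ultimately show ?thesis unfolding F_def by (simp only: add_0_right right_minus_eq)
qed

section \<open>Theta series with bounded coefficients\<close>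

text \<open>The coefficients are arbitrary so that real translations of \<open>w\<close> and finite
  Fourier transforms stay within one family. The nome is e^(pi i w).\<close>

definition Theta :: "(int \<Rightarrow> complex) \<Rightarrow> complex \<Rightarrow> complex" where
  "Theta \<phi> w = (\<Sum>\<^sub>\<infinity>n. \<phi> n * exp (of_real pi * \<i> * of_int (n\<^sup>2) * w))"

lemma int_abs_le_square: "\<bar>n::int\<bar> \<le> n\<^sup>2"
proof (cases "n = 0")
  case False
  hence "\<bar>n\<bar> * 1 \<le> \<bar>n\<bar> * \<bar>n\<bar>" by (intro mult_left_mono) auto
  thus ?thesis by (simp add: power2_eq_square)
qed auto

lemma Theta_summable:
  assumes \<phi>: "bounded (range \<phi>)" and w: "Im w > 0"
  shows "(\<lambda>n. norm (\<phi> n * exp (of_real pi * \<i> * of_int (n\<^sup>2) * w))) summable_on UNIV"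
    and "(\<lambda>n. \<phi> n * exp (of_real pi * \<i> * of_int (n\<^sup>2) * w)) summable_on UNIV"
proof -
  obtain C where C: "\<And>n. norm (\<phi> n) \<le> C"
    using \<phi> by (auto simp: bounded_iff)
  define r where "r = exp (- pi * Im w)"
  have r: "0 \<le> r" "r < 1" using w by (auto simp: r_def)
  show *: "(\<lambda>n. norm (\<phi> n * exp (of_real pi * \<i> * of_int (n\<^sup>2) * w))) summable_on UNIV"
  proof (rule summable_on_comparison_test)
    show "(\<lambda>n::int. C * r ^ nat \<bar>n\<bar>) summable_on UNIV"
      by (intro summable_on_cmult_right summable_on_int_power_abs r)
    fix n :: int
    have "norm (exp (of_real pi * \<i> * of_int (n\<^sup>2) * w)) = exp (- pi * of_int (n\<^sup>2) * Im w)"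
      by (simp add: Re_power2 Im_power2 norm_exp_eq_Re)
    also have "\<dots> = r ^ nat (n\<^sup>2)"
      by (simp add: r_def exp_of_nat_mult[symmetric] mult_ac)
    also have "\<dots> \<le> r ^ nat \<bar>n\<bar>"
    proof (rule power_decreasing)
      show "nat \<bar>n\<bar> \<le> nat (n\<^sup>2)" using int_abs_le_square[of n] by (rule nat_mono)
    qed (use r in auto)
    finally have "norm (exp (of_real pi * \<i> * of_int (n\<^sup>2) * w)) \<le> r ^ nat \<bar>n\<bar>" .
    thus "norm (\<phi> n * exp (of_real pi * \<i> * of_int (n\<^sup>2) * w)) \<le> C * r ^ nat \<bar>n\<bar>"
      unfolding norm_mult using C[of n] norm_ge_zero[of "\<phi> n"]
      by (intro mult_mono) (linarith | simp)+
  qed auto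
  show "(\<lambda>n. \<phi> n * exp (of_real pi * \<i> * of_int (n\<^sup>2) * w)) summable_on UNIV"
    using * by (rule abs_summable_summable)
qed

text \<open>Collecting the terms by N = n^2 gives a power series in e^(pi i w), the form needed for
  holomorphy and for the Fourier expansions at the cusps.\<close>

lemma Theta_sums:
  assumes \<phi>: "bounded (range \<phi>)" and w: "Im w > 0"
  shows "(\<lambda>N. (\<Sum>n | n\<^sup>2 = int N. \<phi> n) * exp (of_real pi * \<i> * w) ^ N) sums Theta \<phi> w"
proof -
  let ?f = "\<lambda>n. \<phi> n * exp (of_real pi * \<i> * of_int (n\<^sup>2) * w)"
  have fin: "finite {n::int. n\<^sup>2 = int N}" for N
  proof (rule finite_subset)
    show "{n::int. n\<^sup>2 = int N} \<subseteq> {- int N..int N}"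
    proof (intro subsetI)
      fix n :: int assume "n \<in> {n. n\<^sup>2 = int N}"
      thus "n \<in> {- int N..int N}" using int_abs_le_square[of n] by auto
    qed
  qed auto
  have "(?f has_sum Theta \<phi> w) UNIV"
    unfolding Theta_def using Theta_summable(2)[OF assms] by (rule has_sum_infsum)
  also have "?this \<longleftrightarrow> ((\<lambda>(N, n). ?f n) has_sum Theta \<phi> w) (Sigma UNIV (\<lambda>N::nat. {n. n\<^sup>2 = int N}))"
    by (rule has_sum_reindex_bij_witness[of _ snd "\<lambda>n. (nat (n\<^sup>2), n)"]) auto
  finally have "((\<lambda>N. \<Sum>n | n\<^sup>2 = int N. ?f n) has_sum Theta \<phi> w) UNIV"
    by (rule has_sum_SigmaD) (simp only: case_prod_conv, intro has_sum_finite fin)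
  hence "(\<lambda>N. \<Sum>n | n\<^sup>2 = int N. ?f n) sums Theta \<phi> w"
    by (rule has_sum_imp_sums)
  moreover have "(\<Sum>n | n\<^sup>2 = int N. ?f n) = (\<Sum>n | n\<^sup>2 = int N. \<phi> n) * exp (of_real pi * \<i> * w) ^ N" for N
    unfolding sum_distrib_right
    by (intro sum.cong) (auto simp: exp_of_nat_mult[symmetric] mult_ac)
  ultimately show ?thesis by simp
qed

lemma Theta_holomorphic:
  assumes \<phi>: "bounded (range \<phi>)"
  shows "Theta \<phi> holomorphic_on {w. Im w > 0}"
proof -
  define a where "a = (\<lambda>N. \<Sum>n | n\<^sup>2 = int N. \<phi> n)"
  define P where "P = (\<lambda>z. \<Sum>N. a N * z ^ N)"
  have sums: "(\<lambda>N. a N * (z - 0) ^ N) sums P z" if z: "z \<in> ball 0 1" for z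
  proof (cases "z = 0")
    case True
    thus ?thesis using powser_sums_zero[of a] by (simp add: P_def sums_iff)
  next
    case False
    \<comment> \<open>Each z with 0 < |z| < 1 is e^(pi i w) for some w in the upper half-plane, so
      \<open>Theta_sums\<close> yields convergence of the power series on the whole disc.\<close>
    define w where "w = Ln z / (of_real pi * \<i>)"
    have "exp (of_real pi * \<i> * w) = z" using False by (simp add: w_def)
    moreover have "Im w > 0"
      using False z by (simp add: w_def Im_divide field_simps power2_eq_square)
    ultimately show ?thesis
      using Theta_sums[OF \<phi>, of w] by (simp add: a_def P_def sums_iff)
  qed
  have "P holomorphic_on ball 0 1"
    using sums by (rule power_series_holomorphic)
  moreover have norm_lt: "norm (exp (of_real pi * \<i> * w)) < 1" if "Im w > 0" for w
    using that by (simp add: norm_exp_eq_Re)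
  ultimately have "(P \<circ> (\<lambda>w. exp (of_real pi * \<i> * w))) holomorphic_on {w. Im w > 0}"
    by (intro holomorphic_on_compose_gen[of _ _ _ "ball 0 1"] holomorphic_intros) auto
  moreover have "(P \<circ> (\<lambda>w. exp (of_real pi * \<i> * w))) w = Theta \<phi> w" if "w \<in> {w. Im w > 0}" for w
    using Theta_sums[OF \<phi>, of w] that by (simp add: P_def a_def sums_iff)
  ultimately show ?thesis
    by (subst holomorphic_cong[OF refl, of _ _ "P \<circ> (\<lambda>w. exp (of_real pi * \<i> * w))"]) auto
qed

text \<open>Used on both sides of the inversion: first to split off b/d, then to absorb the shift by
  -c/d that the inversion creates.\<close>

lemma Theta_add_real:
  "Theta \<phi> (w + of_real x) = Theta (\<lambda>n. \<phi> n * ecis (of_int (n\<^sup>2) * x / 2)) w"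
  unfolding Theta_def ecis_conv_exp
  by (intro infsum_cong) (simp add: ring_distribs exp_add mult_ac)

lemma Theta_cmult: "Theta (\<lambda>n. c * \<phi> n) w = c * Theta \<phi> w"
  unfolding Theta_def mult.assoc by (rule infsum_cmult_right')

section \<open>Theta inversion for periodic coefficients\<close>

lemma sum_infsum_commute:
  fixes f :: "'a \<Rightarrow> 'b \<Rightarrow> complex"
  assumes "finite A" "\<And>r. r \<in> A \<Longrightarrow> f r summable_on B"
  shows "(\<Sum>r\<in>A. infsum (f r) B) = (\<Sum>\<^sub>\<infinity>m\<in>B. \<Sum>r\<in>A. f r m)"
proof -
  have "((\<lambda>m. \<Sum>r\<in>A. f r m) has_sum (\<Sum>r\<in>A. infsum (f r) B)) B"
    using assms
  proof (induction A rule: finite_induct)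
    case (insert a A)
    have "((\<lambda>m. f a m + (\<Sum>r\<in>A. f r m)) has_sum (infsum (f a) B + (\<Sum>r\<in>A. infsum (f r) B))) B"
      by (rule has_sum_add[OF has_sum_infsum insert.IH]) (use insert.prems in auto)
    thus ?case using insert.hyps by simp
  qed auto
  thus ?thesis by (rule infsumI[symmetric])
qed

lemma infsum_int_residues:
  fixes f :: "int \<Rightarrow> complex"
  assumes M: "M > 0" and f: "f summable_on UNIV"
  shows "infsum f UNIV = (\<Sum>r<M. \<Sum>\<^sub>\<infinity>k. f (int r + int M * k))"
proof -
  let ?g = "\<lambda>(r, k). f (int r + int M * k)"
  have bij: "bij_betw (\<lambda>(r, k). int r + int M * k) ({..<M} \<times> UNIV) UNIV"
  proof (rule bij_betw_byWitness[of _ "\<lambda>n. (nat (n mod int M), n div int M)"])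
    have "nat ((int r + int M * k) mod int M) = r \<and> (int r + int M * k) div int M = k" if "r < M" for r k
      using that by simp
    thus "\<forall>a\<in>{..<M} \<times> UNIV. (nat ((case a of (r, k) \<Rightarrow> int r + int M * k) mod int M),
            (case a of (r, k) \<Rightarrow> int r + int M * k) div int M) = a"
      by auto
    show "(\<lambda>n. (nat (n mod int M), n div int M)) ` UNIV \<subseteq> {..<M} \<times> UNIV"
      using M by (auto simp: nat_less_iff)
  qed (use M in auto)
  have 1: "f summable_on UNIV \<longleftrightarrow> ?g summable_on ({..<M} \<times> UNIV)"
    and 2: "infsum f UNIV = infsum ?g ({..<M} \<times> UNIV)"
    using summable_on_reindex_bij_betw[OF bij, of f] infsum_reindex_bij_betw[OF bij, of f]
    by (simp_all only: case_prod_unfold)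
  have "infsum ?g ({..<M} \<times> UNIV) = infsum (\<lambda>r. \<Sum>\<^sub>\<infinity>k. f (int r + int M * k)) {..<M}"
    using infsum_Sigma'_banach[of "\<lambda>r k. f (int r + int M * k)" "{..<M}" "\<lambda>_. UNIV"] 1 f by (simp only: infsum_finite finite_lessThan simp_thms)
  thus ?thesis by (simp only: 2 infsum_finite finite_lessThan)
qed

text \<open>The finite Fourier transform, unnormalized and with positive sign: this is how it comes
  out of Poisson summation over the classes modulo \<open>M\<close>.\<close>

definition dft :: "nat \<Rightarrow> (int \<Rightarrow> complex) \<Rightarrow> int \<Rightarrow> complex" where
  "dft M \<phi> m = (\<Sum>r<M. \<phi> (int r) * ecis (of_int m * of_nat r / of_nat M))"

lemma bounded_dft: "bounded (range (dft M \<phi>))"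
proof (rule boundedI)
  fix x assume "x \<in> range (dft M \<phi>)"
  then obtain m where m: "x = dft M \<phi> m" by auto
  show "norm x \<le> (\<Sum>r<M. norm (\<phi> (int r)))"
    unfolding m dft_def by (rule order.trans[OF norm_sum]) (simp add: norm_mult)
qed

lemma periodic_add_mult:
  fixes \<phi> :: "int \<Rightarrow> 'a"
  assumes "\<And>n. \<phi> (n + int M) = \<phi> n"
  shows "\<phi> (n + int M * k) = \<phi> n"
proof -
  have *: "\<phi> (n + int M * int j) = \<phi> n" for j n
  proof (induction j)
    case (Suc j)
    have "\<phi> (n + int M * int (Suc j)) = \<phi> ((n + int M * int j) + int M)" by (simp add: algebra_simps)
    also have "\<dots> = \<phi> n" by (simp only: assms Suc)
    finally show ?case .
  qed auto
  show ?thesis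
  proof (cases "k \<ge> 0")
    case True
    thus ?thesis using *[of n "nat k"] by (simp only: int_nat_eq if_True)
  next
    case False
    hence "n + int M * k + int M * int (nat (- k)) = n" by simp
    thus ?thesis using *[of "n + int M * k" "nat (- k)"] by (simp only:)
  qed
qed

lemma bounded_periodic:
  fixes \<phi> :: "int \<Rightarrow> complex"
  assumes M: "M > 0" and per: "\<And>n. \<phi> (n + int M) = \<phi> n"
  shows "bounded (range \<phi>)"
proof -
  have "\<phi> n \<in> \<phi> ` {0..<int M}" for n
  proof -
    have "\<phi> n = \<phi> (n mod int M)"
      using periodic_add_mult[of \<phi> M "n mod int M" "n div int M", OF per] by (simp only: mod_mult_div_eq)
    moreover have "n mod int M \<in> {0..<int M}" using M by simp
    ultimately show ?thesis by (rule image_eqI)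
  qed
  hence "range \<phi> \<subseteq> \<phi> ` {0..<int M}" by auto
  moreover have "bounded (\<phi> ` {0..<int M})" by (intro finite_imp_bounded) auto
  ultimately show ?thesis by (rule bounded_subset[rotated])
qed

text \<open>For n = r + M k the exponent is -pi y M^2 (r/M + k)^2, so Poisson summation applies to
  each class with t = y M^2 and shift r/M. Its phases e(m r/M), weighted by \<open>\<phi> r\<close>
  and summed over r, form the finite Fourier transform.\<close>

lemma Theta_inversion_imaginary:
  fixes y :: real
  assumes M: "M > 0" and per: "\<And>n. \<phi> (n + int M) = \<phi> n" and y: "y > 0"
  shows "Theta \<phi> (\<i> * y) = of_real (1 / (of_nat M * sqrt y)) * Theta (dft M \<phi>) (\<i> / (of_nat M ^ 2 * y))"
proof -
  define t where "t = y * real M ^ 2"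
  have t: "t > 0" using M y by (simp add: t_def)
  have sqrt_t: "sqrt t = of_nat M * sqrt y" by (simp add: t_def real_sqrt_mult)
  let ?e = "\<lambda>m::int. complex_of_real (exp (- pi * (of_int m)\<^sup>2 / t))"
  have exp1: "exp (of_real pi * \<i> * of_int (n\<^sup>2) * (\<i> * y)) = of_real (exp (- pi * y * (of_int n)\<^sup>2))" for n
  proof -
    have "of_real pi * \<i> * of_int (n\<^sup>2) * (\<i> * y) = of_real (- pi * y * (of_int n)\<^sup>2)"
      by (simp add: mult_ac)
    thus ?thesis by (simp only: exp_of_real)
  qed
  have exp2: "exp (of_real pi * \<i> * of_int (m\<^sup>2) * (\<i> / (of_nat M ^ 2 * y))) = ?e m" for m
  proof -
    have "of_real pi * \<i> * of_int (m\<^sup>2) * (\<i> / (of_nat M ^ 2 * y)) = of_real (- pi * (of_int m)\<^sup>2 / t)"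
      by (simp add: mult_ac t_def)
    thus ?thesis by (simp only: exp_of_real)
  qed
  have Im_w: "Im (\<i> * y) > 0" using y by simp
  have Im_w': "Im (\<i> / (of_nat M ^ 2 * y)) > 0"
  proof -
    have "\<i> / (of_nat M ^ 2 * y) = \<i> * of_real (1 / t)" by (simp add: t_def mult_ac)
    hence "Im (\<i> / (of_nat M ^ 2 * y)) = 1 / t" by (simp only: Im_i_times Re_complex_of_real)
    thus ?thesis using t by simp
  qed
  have sum_e: "(\<lambda>m. c * (?e m * ecis (of_int m * x))) summable_on UNIV" for c x
  proof (rule summable_on_cmult_right, rule abs_summable_summable)
    have "bounded (range (\<lambda>_::int. 1::complex))" by simp
    from Theta_summable(1)[OF this Im_w'] show "(\<lambda>m. norm (?e m * ecis (of_int m * x))) summable_on UNIV"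
      unfolding exp2 by (simp add: norm_mult)
  qed
  have "Theta \<phi> (\<i> * y) = (\<Sum>r<M. \<Sum>\<^sub>\<infinity>k. \<phi> (int r + int M * k) * exp (of_real pi * \<i> * of_int ((int r + int M * k)\<^sup>2) * (\<i> * y)))"
    unfolding Theta_def by (rule infsum_int_residues[OF M Theta_summable(2)[OF bounded_periodic[of M \<phi>, OF M per] Im_w]])
  also have "\<dots> = (\<Sum>r<M. \<phi> (int r) * (\<Sum>\<^sub>\<infinity>k::int. of_real (exp (- pi * t * (of_nat r / of_nat M + of_int k)\<^sup>2))))"
  proof (intro sum.cong refl)
    fix r
    have "\<phi> (int r + int M * k) * exp (of_real pi * \<i> * of_int ((int r + int M * k)\<^sup>2) * (\<i> * y))
       = \<phi> (int r) * of_real (exp (- pi * t * (of_nat r / of_nat M + of_int k)\<^sup>2))" for k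
    proof -
      have "of_nat r / of_nat M + of_int k = (real_of_int (int r + int M * k)) / of_nat M"
        using M by (simp add: field_simps)
      hence "t * (of_nat r / of_nat M + of_int k)\<^sup>2 = y * (of_int (int r + int M * k))\<^sup>2"
        using M by (simp only: power_divide t_def) simp
      hence "- pi * t * (of_nat r / of_nat M + of_int k)\<^sup>2 = - pi * y * (of_int (int r + int M * k))\<^sup>2"
        by (simp only: mult.assoc)
      thus ?thesis
        unfolding exp1 periodic_add_mult[of \<phi>, OF per] by (simp only:)
    qed
    thus "(\<Sum>\<^sub>\<infinity>k. \<phi> (int r + int M * k) * exp (of_real pi * \<i> * of_int ((int r + int M * k)\<^sup>2) * (\<i> * y)))
       = \<phi> (int r) * (\<Sum>\<^sub>\<infinity>k::int. of_real (exp (- pi * t * (of_nat r / of_nat M + of_int k)\<^sup>2)))"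
      by (simp only: infsum_cmult_right')
  qed
  also have "\<dots> = (\<Sum>r<M. \<phi> (int r) * (of_real (1 / sqrt t) * (\<Sum>\<^sub>\<infinity>m. ?e m * ecis (of_int m * (of_nat r / of_nat M)))))"
    by (simp only: gaussian_poisson_summation[OF t])
  also have "\<dots> = of_real (1 / sqrt t) * (\<Sum>r<M. \<Sum>\<^sub>\<infinity>m. \<phi> (int r) * (?e m * ecis (of_int m * (of_nat r / of_nat M))))"
    unfolding sum_distrib_left by (simp only: infsum_cmult_right' mult.left_commute)
  also have "(\<Sum>r<M. \<Sum>\<^sub>\<infinity>m. \<phi> (int r) * (?e m * ecis (of_int m * (of_nat r / of_nat M))))
       = (\<Sum>\<^sub>\<infinity>m. \<Sum>r<M. \<phi> (int r) * (?e m * ecis (of_int m * (of_nat r / of_nat M))))"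
    by (rule sum_infsum_commute[OF finite_lessThan sum_e])
  also have "\<dots> = Theta (dft M \<phi>) (\<i> / (of_nat M ^ 2 * y))"
    unfolding Theta_def exp2 dft_def sum_distrib_right
    by (intro infsum_cong sum.cong) (simp_all add: mult_ac)
  finally show ?thesis by (simp only: sqrt_t)
qed

text \<open>Both sides are holomorphic: -i w lies in the right half-plane, away from the branch cut
  of \<open>csqrt\<close>, and at w = i y the root is sqrt y. The identity on the imaginary axis
  therefore extends.\<close>

lemma Theta_inversion:
  assumes M: "M > 0" and per: "\<And>n. \<phi> (n + int M) = \<phi> n" and w: "Im w > 0"
  shows "of_nat M * csqrt (- \<i> * w) * Theta \<phi> w = Theta (dft M \<phi>) (- 1 / (of_nat M ^ 2 * w))"
proof -
  define f where "f = (\<lambda>w. of_nat M * csqrt (- \<i> * w) * Theta \<phi> w - Theta (dft M \<phi>) (- 1 / (of_nat M ^ 2 * w)))"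
  let ?H = "{w. Im w > 0}"
  have Im_inv: "Im (- 1 / (of_nat M ^ 2 * w)) > 0" if "Im w > 0" for w
  proof -
    have "- 1 / (of_nat M ^ 2 * w) = of_real (1 / real M ^ 2) * (- inverse w)"
      by (simp add: field_simps)
    hence "Im (- 1 / (of_nat M ^ 2 * w)) = 1 / real M ^ 2 * Im (- inverse w)"
      by (simp only: times_complex.sel Re_complex_of_real Im_complex_of_real mult_zero_left add_0_right)
    also have "Im (- inverse w) = Im w / (cmod w)\<^sup>2"
      by (simp add: cmod_power2)
    finally have "Im (- 1 / (of_nat M ^ 2 * w)) = 1 / real M ^ 2 * (Im w / (cmod w)\<^sup>2)" .
    moreover have "w \<noteq> 0" using that by auto
    ultimately show ?thesis using that M by simp
  qed
  have hol: "f holomorphic_on ?H"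
  proof -
    have "(\<lambda>w. Theta (dft M \<phi>) (- 1 / (of_nat M ^ 2 * w))) = Theta (dft M \<phi>) \<circ> (\<lambda>w. - 1 / (of_nat M ^ 2 * w))"
      by auto
    moreover have "(Theta (dft M \<phi>) \<circ> (\<lambda>w. - 1 / (of_nat M ^ 2 * w))) holomorphic_on ?H"
    proof (rule holomorphic_on_compose_gen[OF _ Theta_holomorphic[OF bounded_dft]])
      show "(\<lambda>w. - 1 / (of_nat M ^ 2 * w)) holomorphic_on ?H"
        using M by (intro holomorphic_intros) auto
      show "(\<lambda>w. - 1 / (of_nat M ^ 2 * w)) ` ?H \<subseteq> ?H" using Im_inv by auto
    qed
    ultimately have "(\<lambda>w. Theta (dft M \<phi>) (- 1 / (of_nat M ^ 2 * w))) holomorphic_on ?H" by simp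
    moreover have "(\<lambda>w. csqrt (- \<i> * w)) holomorphic_on ?H"
    proof (rule holomorphic_on_csqrt')
      show "- \<i> * w \<notin> \<real>\<^sub>\<le>\<^sub>0" if "w \<in> ?H" for w
        using that complex_nonpos_Reals_iff[of "- \<i> * w"] by (simp del: complex_nonpos_Reals_iff)
    qed (intro holomorphic_intros)
    ultimately show ?thesis
      unfolding f_def using Theta_holomorphic[OF bounded_periodic[of M \<phi>, OF M per]]
      by (intro holomorphic_on_diff holomorphic_on_mult holomorphic_on_const)
  qed
  have "f w = 0"
  proof (rule analytic_continuation[OF hol])
    show "open ?H" by (rule open_halfspace_Im_gt)
    show "connected ?H" by (intro convex_connected convex_halfspace_Im_gt)
    show "(\<lambda>y::real. \<i> * y) ` {0<..} \<subseteq> ?H" by auto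
    show "\<i> \<in> ?H" by simp
    show "\<i> islimpt (\<lambda>y::real. \<i> * y) ` {0<..}"
      unfolding islimpt_approachable
    proof (intro allI impI)
      fix e :: real assume e: "e > 0"
      have "\<i> * of_real (1 + e / 2) \<in> (\<lambda>y::real. \<i> * y) ` {0<..}" using e by (intro imageI) auto
      moreover have "\<i> * of_real (1 + e / 2) \<noteq> \<i>" using e by (auto simp: complex_eq_iff)
      moreover have "dist (\<i> * of_real (1 + e / 2)) \<i> < e"
      proof -
        have "\<i> * of_real (1 + e / 2) - \<i> = \<i> * of_real (e / 2)" by (simp add: ring_distribs)
        thus ?thesis using e by (simp only: dist_norm norm_mult norm_of_real) simp
      qed
      ultimately show "\<exists>x'\<in>(\<lambda>y::real. \<i> * y) ` {0<..}. x' \<noteq> \<i> \<and> dist x' \<i> < e" by blast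
    qed
    show "f z = 0" if z: "z \<in> (\<lambda>y::real. \<i> * y) ` {0<..}" for z
    proof -
      obtain y :: real where y: "y > 0" "z = \<i> * y" using z by auto
      have "csqrt (- \<i> * z) = of_real (sqrt y)" using y by (simp add: csqrt_of_real)
      moreover have "- 1 / (of_nat M ^ 2 * z) = \<i> / (of_nat M ^ 2 * y)"
        using y M by (simp add: field_simps)
      moreover have "of_real (sqrt y) \<noteq> (0::complex)" using y by simp
      ultimately show ?thesis
        unfolding f_def using Theta_inversion_imaginary[of M \<phi> y, OF M per y(1)] M
        by (simp only: y(2)) simp
    qed
  qed (use w in auto)
  thus ?thesis by (simp add: f_def)
qed

section \<open>Quadratic Gauss sums\<close>

lemma ecis_eq_1_iff: "ecis x = 1 \<longleftrightarrow> x \<in> \<int>"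
proof
  assume "ecis x = 1"
  hence "exp (2 * of_real pi * \<i> * of_real x) = 1" by (simp only: ecis_conv_exp)
  then obtain n :: int where "2 * pi * x = of_int (2 * n) * pi"
    by (auto simp: exp_eq_1)
  hence "x = of_int n" by simp
  thus "x \<in> \<int>" by simp
qed (auto elim!: Ints_cases)

lemma ecis_cong:
  assumes "[a = b] (mod int d)"
  shows "ecis (of_int a / of_nat d) = ecis (of_int b / of_nat d)"
proof (cases "d = 0")
  case False
  from assms obtain k where "a - b = int d * k"
    by (auto simp: cong_iff_dvd_diff dvd_def)
  hence "real_of_int a / of_nat d - of_int b / of_nat d = of_int k"
    using False by (simp add: diff_divide_distrib[symmetric] flip: of_int_diff)
  thus ?thesis by (intro ecis_eq_if_diff_Ints) simp
qed auto

text \<open>d values that are pairwise incongruent modulo d exhaust the classes. The changes of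
  variables in the Gauss sums rest on this form.\<close>

lemma sum_complete_residues:
  fixes f :: "int \<Rightarrow> complex" and g :: "'a \<Rightarrow> int"
  assumes d: "d > 0" and f: "\<And>x y. [x = y] (mod int d) \<Longrightarrow> f x = f y"
    and A: "finite A" "card A = d"
    and inj: "\<And>x y. x \<in> A \<Longrightarrow> y \<in> A \<Longrightarrow> [g x = g y] (mod int d) \<Longrightarrow> x = y"
  shows "(\<Sum>x\<in>A. f (g x)) = (\<Sum>x\<in>{0..<int d}. f x)"
proof -
  let ?h = "\<lambda>x. g x mod int d"
  have inj': "inj_on ?h A"
    using inj by (auto simp: inj_on_def cong_def)
  have "?h ` A = {0..<int d}"
  proof (rule card_subset_eq)
    show "?h ` A \<subseteq> {0..<int d}" using d by auto
    show "card (?h ` A) = card {0..<int d}" using A inj' by (simp add: card_image)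
  qed auto
  hence "(\<Sum>x\<in>{0..<int d}. f x) = (\<Sum>x\<in>A. f (?h x))"
    using sum.reindex[OF inj', of f] by simp
  also have "\<dots> = (\<Sum>x\<in>A. f (g x))"
    by (intro sum.cong f refl) (simp add: cong_def)
  finally show ?thesis ..
qed

text \<open>If d does not divide a, the shift y -> y + 1 multiplies the sum by e(a/d), which is not
  1.\<close>

lemma sum_ecis_residues:
  assumes d: "d > 0"
  shows "(\<Sum>y\<in>{0..<int d}. ecis (of_int (a * y) / of_nat d)) = (if int d dvd a then of_nat d else 0)"
proof (cases "int d dvd a")
  case True
  then obtain k where k: "a = int d * k" by blast
  have "ecis (of_int (a * y) / of_nat d) = 1" for y
    using ecis_cong[of "a * y" 0 d] by (simp add: k cong_iff_dvd_diff)
  thus ?thesis using True by simp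
next
  case False
  let ?S = "\<Sum>y\<in>{0..<int d}. ecis (of_int (a * y) / of_nat d)"
  have "?S = (\<Sum>y\<in>{0..<int d}. ecis (of_int (a * (y + 1)) / of_nat d))"
  proof (rule sum_complete_residues[symmetric, OF d])
    show "ecis (of_int (a * x) / of_nat d) = ecis (of_int (a * y) / of_nat d)" if "[x = y] (mod int d)" for x y
      by (intro ecis_cong cong_mult that) auto
    show "x = y" if "x \<in> {0..<int d}" "y \<in> {0..<int d}" "[x + 1 = y + 1] (mod int d)" for x y
    proof -
      have "[x = y] (mod int d)" using that(3) by (simp add: cong_add_rcancel)
      thus ?thesis using that by (simp add: cong_def)
    qed
  qed auto
  also have "\<dots> = ?S * ecis (of_int a / of_nat d)"
    unfolding sum_distrib_right
    by (intro sum.cong refl) (simp add: ecis_add[symmetric] add_divide_distrib[symmetric] algebra_simps)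
  finally have "?S * (1 - ecis (of_int a / of_nat d)) = 0"
    by (simp add: algebra_simps)
  moreover have "ecis (of_int a / of_nat d) \<noteq> 1"
  proof
    assume "ecis (of_int a / of_nat d) = 1"
    then obtain k where "real_of_int a / of_nat d = of_int k"
      by (auto simp: ecis_eq_1_iff elim: Ints_cases)
    hence "real_of_int a = of_int (int d * k)" using d by (simp add: field_simps)
    hence "a = int d * k" by (simp only: of_int_eq_iff)
    thus False using False by simp
  qed
  ultimately show ?thesis using False by auto
qed

definition gauss_sum :: "int \<Rightarrow> nat \<Rightarrow> complex" where
  "gauss_sum u d = (\<Sum>x\<in>{0..<int d}. ecis (of_int (u * x\<^sup>2) / of_nat d))"

lemma gauss_sum_term_cong:
  "[x = y] (mod int d) \<Longrightarrow> ecis (of_int (u * x\<^sup>2) / of_nat d) = ecis (of_int (u * y\<^sup>2) / of_nat d)"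
  by (intro ecis_cong cong_mult cong_pow) auto

lemma gauss_sum_reindex:
  assumes "d > 0" "finite A" "card A = d"
    and "\<And>x y. x \<in> A \<Longrightarrow> y \<in> A \<Longrightarrow> [g x = g y] (mod int d) \<Longrightarrow> x = y"
  shows "gauss_sum u d = (\<Sum>x\<in>A. ecis (of_int (u * (g x)\<^sup>2) / of_nat d))"
  unfolding gauss_sum_def by (rule sum_complete_residues[symmetric, OF _ gauss_sum_term_cong]) (use assms in auto)

lemma gauss_sum_cong:
  assumes "[u = v] (mod int d)"
  shows "gauss_sum u d = gauss_sum v d"
  unfolding gauss_sum_def using assms by (intro sum.cong refl ecis_cong cong_mult) auto

lemma residue_cong_imp_eq:
  "x \<in> {0..<int d} \<Longrightarrow> y \<in> {0..<int d} \<Longrightarrow> [x = y] (mod int d) \<Longrightarrow> x = y"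
  by (simp add: cong_def)

lemma gauss_sum_mult_square:
  assumes d: "d > 0" and v: "coprime v (int d)"
  shows "gauss_sum (u * v\<^sup>2) d = gauss_sum u d"
proof -
  have "gauss_sum u d = (\<Sum>x\<in>{0..<int d}. ecis (of_int (u * (v * x)\<^sup>2) / of_nat d))"
  proof (rule gauss_sum_reindex[OF d])
    fix x y assume xy: "x \<in> {0..<int d}" "y \<in> {0..<int d}" "[v * x = v * y] (mod int d)"
    from xy(3) have "[x = y] (mod int d)" using v by (simp add: cong_mult_lcancel)
    thus "x = y" using xy residue_cong_imp_eq by blast
  qed auto
  also have "\<dots> = gauss_sum (u * v\<^sup>2) d"
    unfolding gauss_sum_def by (simp add: power_mult_distrib mult_ac)
  finally show ?thesis ..
qed

text \<open>Shifting x by y in the first sum replaces x^2 - y^2 by x^2 + 2 x y; the sum over y then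
  vanishes unless d divides 2 x, which for odd d leaves x = 0.\<close>

lemma gauss_sum_times_neg:
  assumes d: "odd d"
  shows "gauss_sum 1 d * gauss_sum (-1) d = of_nat d"
proof -
  have d0: "d > 0" using d by (cases d) auto
  let ?R = "{0..<int d}"
  have "gauss_sum 1 d * gauss_sum (-1) d = (\<Sum>y\<in>?R. gauss_sum 1 d * ecis (of_int (- y\<^sup>2) / of_nat d))"
    by (simp add: gauss_sum_def[of "-1"] sum_distrib_left)
  also have "\<dots> = (\<Sum>y\<in>?R. \<Sum>x\<in>?R. ecis (of_int (x\<^sup>2) / of_nat d) * ecis (of_int ((2 * x) * y) / of_nat d))"
  proof (intro sum.cong refl)
    fix y
    have "gauss_sum 1 d = (\<Sum>x\<in>?R. ecis (of_int (1 * (x + y)\<^sup>2) / of_nat d))"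
    proof (rule gauss_sum_reindex[OF d0])
      fix x z assume "x \<in> ?R" "z \<in> ?R" "[x + y = z + y] (mod int d)"
      thus "x = z" using residue_cong_imp_eq by (simp only: cong_add_rcancel)
    qed auto
    hence "gauss_sum 1 d * ecis (of_int (- y\<^sup>2) / of_nat d) =
        (\<Sum>x\<in>?R. ecis (of_int (1 * (x + y)\<^sup>2) / of_nat d) * ecis (of_int (- y\<^sup>2) / of_nat d))"
      by (simp only: sum_distrib_right)
    also have "\<dots> = (\<Sum>x\<in>?R. ecis (of_int (x\<^sup>2) / of_nat d) * ecis (of_int ((2 * x) * y) / of_nat d))"
      by (intro sum.cong refl)
         (simp add: ecis_add[symmetric] add_divide_distrib[symmetric] power2_sum diff_divide_distrib[symmetric])
    finally show "gauss_sum 1 d * ecis (of_int (- y\<^sup>2) / of_nat d) = \<dots>" .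
  qed
  also have "\<dots> = (\<Sum>x\<in>?R. ecis (of_int (x\<^sup>2) / of_nat d) * (\<Sum>y\<in>?R. ecis (of_int ((2 * x) * y) / of_nat d)))"
    by (subst sum.swap) (simp only: sum_distrib_left)
  also have "\<dots> = (\<Sum>x\<in>?R. if x = 0 then of_nat d else 0)"
  proof (intro sum.cong refl)
    fix x assume x: "x \<in> ?R"
    have "int d dvd 2 * x \<longleftrightarrow> int d dvd x"
      using d by (simp add: coprime_dvd_mult_right_iff)
    also have "\<dots> \<longleftrightarrow> x = 0" using x by (auto dest: zdvd_imp_le)
    finally show "ecis (of_int (x\<^sup>2) / of_nat d) * (\<Sum>y\<in>?R. ecis (of_int ((2 * x) * y) / of_nat d))
      = (if x = 0 then of_nat d else 0)"
      unfolding sum_ecis_residues[OF d0] by simp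
  qed
  also have "\<dots> = of_nat d" using d0 by simp
  finally show ?thesis .
qed

text \<open>With x = y + p m z the term in z^2 is integral, and the sum over z is a full character
  sum modulo p, nonzero only if p divides y. Substituting y = p t cancels p^2.\<close>

lemma gauss_sum_square_modulus:
  assumes p: "prime p" "odd p" and u: "\<not> int p dvd u" and m: "m > 0"
  shows "gauss_sum u (p * (p * m)) = of_nat p * gauss_sum u m"
proof -
  have p0: "p > 0" using p by (simp add: prime_gt_0_nat)
  let ?d = "p * (p * m)"
  have d0: "?d > 0" using p0 m by simp
  let ?A = "{0..<int (p * m)} \<times> {0..<int p}"
  have "gauss_sum u ?d = (\<Sum>x\<in>?A. ecis (of_int (u * (fst x + int (p * m) * snd x)\<^sup>2) / of_nat ?d))"
  proof (rule gauss_sum_reindex[OF d0])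
    fix x y assume x: "x \<in> ?A" and y: "y \<in> ?A"
      and c: "[fst x + int (p * m) * snd x = fst y + int (p * m) * snd y] (mod int ?d)"
    have lt: "fst z + int (p * m) * snd z \<in> {0..<int ?d}" if "z \<in> ?A" for z
    proof -
      have "int (p * m) * snd z \<le> int (p * m) * (int p - 1)" using that by (intro mult_left_mono) auto
      thus ?thesis using that by (auto simp: algebra_simps)
    qed
    have eq: "fst x + int (p * m) * snd x = fst y + int (p * m) * snd y"
      using residue_cong_imp_eq[OF lt[OF x] lt[OF y] c] .
    have "(fst z + int (p * m) * snd z) mod int (p * m) = fst z" if "z \<in> ?A" for z
      using that by (auto simp del: of_nat_mult)
    from this[OF x] this[OF y] have fst_eq: "fst x = fst y" using eq by (simp only:)
    hence "int (p * m) * snd x = int (p * m) * snd y" using eq by simp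
    hence "snd x = snd y" using p0 m by simp
    with fst_eq show "x = y" by (simp add: prod_eq_iff)
  qed (auto simp: card_cartesian_product nat_mult_distrib)
  also have "\<dots> = (\<Sum>y\<in>{0..<int (p * m)}. \<Sum>z\<in>{0..<int p}. ecis (of_int (u * y\<^sup>2) / of_nat ?d) * ecis (of_int ((2 * u * y) * z) / of_nat p))"
    unfolding sum.cartesian_product
  proof (intro sum.cong refl, clarify)
    fix y z :: int
    have "real_of_int (u * (y + int (p * m) * z)\<^sup>2) / of_nat ?d
       = of_int (u * y\<^sup>2) / of_nat ?d + of_int ((2 * u * y) * z) / of_nat p + of_int (u * int m * z\<^sup>2)"
      using p0 m by (simp add: field_simps power2_eq_square)
    thus "ecis (of_int (u * (fst (y, z) + int (p * m) * snd (y, z))\<^sup>2) / of_nat ?d)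
       = ecis (of_int (u * y\<^sup>2) / of_nat ?d) * ecis (of_int ((2 * u * y) * z) / of_nat p)"
      by (simp only: fst_conv snd_conv ecis_add ecis_of_int mult_1_right)
  qed
  also have "\<dots> = (\<Sum>y\<in>{0..<int (p * m)}. if int p dvd y then ecis (of_int (u * y\<^sup>2) / of_nat ?d) * of_nat p else 0)"
  proof (intro sum.cong refl)
    fix y
    have pp: "prime (int p)" using p by simp
    have "\<not> int p dvd 2"
    proof
      assume "int p dvd 2"
      hence "p dvd 2" by presburger
      hence "p = 2" using p(1) two_is_prime_nat by (simp add: primes_dvd_imp_eq)
      thus False using p(2) by simp
    qed
    hence "int p dvd 2 * u * y \<longleftrightarrow> int p dvd y"
      using u pp by (simp add: prime_dvd_mult_iff)
    thus "(\<Sum>z\<in>{0..<int p}. ecis (of_int (u * y\<^sup>2) / of_nat ?d) * ecis (of_int ((2 * u * y) * z) / of_nat p))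
      = (if int p dvd y then ecis (of_int (u * y\<^sup>2) / of_nat ?d) * of_nat p else 0)"
      unfolding sum_distrib_left[symmetric] sum_ecis_residues[OF p0] by simp
  qed
  also have "\<dots> = (\<Sum>y | y \<in> {0..<int (p * m)} \<and> int p dvd y. ecis (of_int (u * y\<^sup>2) / of_nat ?d) * of_nat p)"
    by (rule sum.inter_filter[symmetric]) auto
  also have "{y. y \<in> {0..<int (p * m)} \<and> int p dvd y} = (\<lambda>t. int p * t) ` {0..<int m}"
    using p0 by (auto elim!: dvdE simp: zero_le_mult_iff)
  also have "(\<Sum>y\<in>(\<lambda>t. int p * t) ` {0..<int m}. ecis (of_int (u * y\<^sup>2) / of_nat ?d) * of_nat p)
      = (\<Sum>t\<in>{0..<int m}. ecis (of_int (u * (int p * t)\<^sup>2) / of_nat ?d) * of_nat p)"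
    using p0 by (subst sum.reindex) (auto simp: inj_on_def)
  also have "\<dots> = of_nat p * gauss_sum u m"
    unfolding gauss_sum_def sum_distrib_left
    using p0 by (intro sum.cong refl) (simp add: power2_eq_square mult_ac)
  finally show ?thesis .
qed

text \<open>Chinese remaindering by x = m y + p z: the cross term 2 u y z is an integer, so the
  phase splits.\<close>

lemma gauss_sum_coprime_mult:
  assumes pm: "coprime p m" and pos: "p > 0" "m > 0"
  shows "gauss_sum u (p * m) = gauss_sum (u * int m) p * gauss_sum (u * int p) m"
proof -
  let ?A = "{0..<int p} \<times> {0..<int m}"
  have "gauss_sum u (p * m) = (\<Sum>x\<in>?A. ecis (of_int (u * (int m * fst x + int p * snd x)\<^sup>2) / of_nat (p * m)))"
  proof (rule gauss_sum_reindex)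
    fix x y assume x: "x \<in> ?A" and y: "y \<in> ?A"
      and c: "[int m * fst x + int p * snd x = int m * fst y + int p * snd y] (mod int (p * m))"
    have "[int m * fst x + int p * snd x = int m * fst y + int p * snd y] (mod int p)"
      using c by (rule cong_dvd_modulus) auto
    hence "int p dvd (int m * fst x + int p * snd x - (int m * fst y + int p * snd y)) - int p * (snd x - snd y)"
      unfolding cong_iff_dvd_diff by (rule dvd_diff[OF _ dvd_triv_left])
    hence "[int m * fst x = int m * fst y] (mod int p)"
      by (simp add: cong_iff_dvd_diff algebra_simps)
    hence "[fst x = fst y] (mod int p)"
      using pm by (simp add: cong_mult_lcancel coprime_commute)
    hence 1: "fst x = fst y" using x y by (auto simp: cong_def)
    hence "[int p * snd x = int p * snd y] (mod int p * int m)"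
      using c by (simp add: cong_add_lcancel)
    hence "[snd x = snd y] (mod int m)"
      using pos by (simp add: cong_iff_dvd_diff flip: right_diff_distrib)
    hence "snd x = snd y" using x y by (auto simp: cong_def)
    with 1 show "x = y" by (simp add: prod_eq_iff)
  qed (use pos in \<open>auto simp: card_cartesian_product\<close>)
  also have "\<dots> = (\<Sum>(y, z)\<in>?A. ecis (of_int (u * int m * y\<^sup>2) / of_nat p) * ecis (of_int (u * int p * z\<^sup>2) / of_nat m))"
  proof (intro sum.cong refl, clarify)
    fix y z :: int
    have "real_of_int (u * (int m * y + int p * z)\<^sup>2) / of_nat (p * m)
       = of_int (u * int m * y\<^sup>2) / of_nat p + of_int (u * int p * z\<^sup>2) / of_nat m + of_int (2 * u * y * z)"
      using pos by (simp add: field_simps power2_eq_square)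
    thus "ecis (of_int (u * (int m * fst (y, z) + int p * snd (y, z))\<^sup>2) / of_nat (p * m))
       = ecis (of_int (u * int m * y\<^sup>2) / of_nat p) * ecis (of_int (u * int p * z\<^sup>2) / of_nat m)"
      by (simp only: fst_conv snd_conv ecis_add ecis_of_int mult_1_right)
  qed
  also have "\<dots> = gauss_sum (u * int m) p * gauss_sum (u * int p) m"
    unfolding gauss_sum_def sum_product sum.cartesian_product ..
  finally show ?thesis .
qed

text \<open>If u is a square modulo p, substitute its root. If not, squares and u times squares
  together hit every class twice, so G(1) + G(u) is twice a full character sum, that is 0.\<close>

lemma gauss_sum_prime:
  assumes p: "prime p" "odd p" and u: "\<not> int p dvd u"
  shows "gauss_sum u p = of_int (Legendre u (int p)) * gauss_sum 1 p"
proof -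
  have p0: "p > 0" using p by (simp add: prime_gt_0_nat)
  have pp: "prime (int p)" using p by simp
  have nc: "\<not> [u = 0] (mod int p)" using u by (simp add: cong_iff_dvd_diff)
  show ?thesis
  proof (cases "QuadRes (int p) u")
    case True
    then obtain v where v: "[v\<^sup>2 = u] (mod int p)" by (auto simp: QuadRes_def)
    have "\<not> int p dvd v"
    proof
      assume "int p dvd v"
      hence "int p dvd v\<^sup>2" by (simp add: power2_eq_square)
      thus False using v u cong_dvd_iff by blast
    qed
    hence "coprime v (int p)" using pp by (metis coprime_commute prime_imp_coprime)
    from gauss_sum_mult_square[OF p0 this, of 1] have "gauss_sum (v\<^sup>2) p = gauss_sum 1 p" by simp
    moreover have "gauss_sum (v\<^sup>2) p = gauss_sum u p" by (rule gauss_sum_cong[OF v])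
    ultimately show ?thesis using True nc by (simp add: Legendre_def)
  next
    case False
    \<comment> \<open>h = (p - 1)/2; on the symmetric system -h..h the only solutions of x^2 = y^2
      modulo p are x = y and x = -y.\<close>
    define h where "h = int p div 2"
    have ph: "int p = 2 * h + 1" using p(2) by (simp add: h_def)
    have h0: "h \<ge> 0" by (simp add: h_def)
    let ?A = "{-h..h}"
    have cardA: "card ?A = p" using ph by simp
    have split: "(\<Sum>x\<in>?A. F x) = F 0 + (\<Sum>x\<in>{1..h}. F x) + (\<Sum>x\<in>{1..h}. F (- x))" for F :: "int \<Rightarrow> complex"
    proof -
      have "?A = {0} \<union> ({1..h} \<union> uminus ` {1..h})" using h0 by (auto simp: image_iff intro: bexI[of _ "- x" for x])
      hence "(\<Sum>x\<in>?A. F x) = sum F {0} + sum F ({1..h} \<union> uminus ` {1..h})"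
        by (simp only:) (rule sum.union_disjoint, auto)
      also have "sum F ({1..h} \<union> uminus ` {1..h}) = sum F {1..h} + sum F (uminus ` {1..h})"
        by (rule sum.union_disjoint) auto
      also have "sum F (uminus ` {1..h}) = (\<Sum>x\<in>{1..h}. F (- x))"
        by (subst sum.reindex) auto
      finally show ?thesis by (simp add: add_ac)
    qed
    have eqs: "x = y \<or> x = - y" if "[x\<^sup>2 = y\<^sup>2] (mod int p)" "x \<in> ?A" "y \<in> ?A" for x y
    proof -
      have "int p dvd (x - y) * (x + y)"
        using that(1) by (simp add: cong_iff_dvd_diff power2_eq_square algebra_simps)
      hence "int p dvd x - y \<or> int p dvd x + y" using pp by (simp add: prime_dvd_mult_iff)
      moreover have "\<bar>x - y\<bar> < int p" "\<bar>x + y\<bar> < int p" using that ph by auto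
      ultimately have "x - y = 0 \<or> x + y = 0"
        by (metis abs_of_nat dvd_imp_le_int linorder_not_less)
      thus ?thesis by linarith
    qed
    have gs: "gauss_sum v p = 1 + 2 * (\<Sum>x\<in>{1..h}. ecis (of_int (v * x\<^sup>2) / of_nat p))" for v
    proof -
      have "gauss_sum v p = (\<Sum>x\<in>?A. ecis (of_int (v * x\<^sup>2) / of_nat p))"
      proof (rule gauss_sum_reindex[OF p0])
        fix x y assume xy: "x \<in> ?A" "y \<in> ?A" "[x = y] (mod int p)"
        hence "int p dvd x - y" "\<bar>x - y\<bar> < int p" using ph by (auto simp: cong_iff_dvd_diff)
        thus "x = y" by (metis abs_of_nat dvd_imp_le_int linorder_not_less right_minus_eq)
      qed (use cardA in auto)
      thus ?thesis unfolding split by simp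
    qed
    txt \<open>The squares and the multiples by \<open>u\<close> of squares together form a complete residue system.\<close>
    define g where "g = (\<lambda>x::int. if x \<ge> 0 then x\<^sup>2 else u * x\<^sup>2)"
    \<comment> \<open>With i the inverse of y modulo p, u would be the square of x i.\<close>
    have no_mix: False if "[x\<^sup>2 = u * y\<^sup>2] (mod int p)" "y \<in> ?A" "y \<noteq> 0" for x y
    proof -
      have "\<bar>y\<bar> < int p" using that ph by auto
      hence "\<not> int p dvd y" using that(3) by (metis abs_of_nat dvd_imp_le_int linorder_not_less)
      hence cop: "coprime y (int p)" using pp by (metis coprime_commute prime_imp_coprime)
      then obtain i where i: "[y * i = 1] (mod int p)" using cong_solve_coprime_int by blast
      have "[(x * i)\<^sup>2 = x\<^sup>2 * i\<^sup>2] (mod int p)" by (simp add: power_mult_distrib)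
      also have "[x\<^sup>2 * i\<^sup>2 = u * y\<^sup>2 * i\<^sup>2] (mod int p)" by (intro cong_mult that) auto
      also have "[u * y\<^sup>2 * i\<^sup>2 = u * (y * i)\<^sup>2] (mod int p)" by (simp add: power_mult_distrib mult_ac)
      also have "[u * (y * i)\<^sup>2 = u * 1\<^sup>2] (mod int p)" by (intro cong_mult cong_pow i) auto
      finally have "[(x * i)\<^sup>2 = u] (mod int p)" by simp
      thus False using False by (auto simp: QuadRes_def)
    qed
    have "(\<Sum>x\<in>?A. ecis (of_int (1 * g x) / of_nat p)) = (\<Sum>x\<in>{0..<int p}. ecis (of_int (1 * x) / of_nat p))"
    proof (rule sum_complete_residues[OF p0])
      show "ecis (of_int (1 * x) / of_nat p) = ecis (of_int (1 * y) / of_nat p)" if "[x = y] (mod int p)" for x y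
        using that by (intro ecis_cong) simp
      show "x = y" if xy: "x \<in> ?A" "y \<in> ?A" "[g x = g y] (mod int p)" for x y
      proof -
        consider "x \<ge> 0" "y \<ge> 0" | "x < 0" "y < 0" | "x \<ge> 0" "y < 0" | "x < 0" "y \<ge> 0" by linarith
        thus ?thesis
        proof cases
          case 1
          hence "[x\<^sup>2 = y\<^sup>2] (mod int p)" using xy(3) by (simp add: g_def)
          from eqs[OF this xy(1,2)] 1 show ?thesis by linarith
        next
          case 2
          hence "[u * x\<^sup>2 = u * y\<^sup>2] (mod int p)" using xy by (simp add: g_def)
          moreover have "coprime u (int p)" using u pp by (metis coprime_commute prime_imp_coprime)
          ultimately have "[x\<^sup>2 = y\<^sup>2] (mod int p)" by (simp add: cong_mult_lcancel)
          from eqs[OF this xy(1,2)] 2 show ?thesis by linarith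
        next
          case 3
          hence "[x\<^sup>2 = u * y\<^sup>2] (mod int p)" "y \<noteq> 0" using xy(3) by (simp_all add: g_def)
          from no_mix[OF this(1) xy(2) this(2)] show ?thesis ..
        next
          case 4
          hence "[y\<^sup>2 = u * x\<^sup>2] (mod int p)" "x \<noteq> 0" using cong_sym[OF xy(3)] by (simp_all add: g_def)
          from no_mix[OF this(1) xy(1) this(2)] show ?thesis ..
        qed
      qed
    qed (use cardA in auto)
    also have "\<dots> = 0"
      unfolding sum_ecis_residues[OF p0] using prime_gt_1_nat[OF p(1)] by simp
    also have "(\<Sum>x\<in>?A. ecis (of_int (1 * g x) / of_nat p)) =
        1 + (\<Sum>x\<in>{1..h}. ecis (of_int (1 * x\<^sup>2) / of_nat p)) + (\<Sum>x\<in>{1..h}. ecis (of_int (u * x\<^sup>2) / of_nat p))"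
      unfolding split by (simp add: g_def)
    finally have *: "1 + (\<Sum>x\<in>{1..h}. ecis (of_int (1 * x\<^sup>2) / of_nat p)) + (\<Sum>x\<in>{1..h}. ecis (of_int (u * x\<^sup>2) / of_nat p)) = 0" .
    have "gauss_sum 1 p + gauss_sum u p = 2 * (1 + (\<Sum>x\<in>{1..h}. ecis (of_int (1 * x\<^sup>2) / of_nat p)) + (\<Sum>x\<in>{1..h}. ecis (of_int (u * x\<^sup>2) / of_nat p)))"
      unfolding gs by (simp add: algebra_simps)
    hence "gauss_sum 1 p + gauss_sum u p = 0" by (simp only: * mult_zero_right)
    thus ?thesis using False nc by (simp add: Legendre_def add_eq_0_iff)
  qed
qed

section \<open>The Kronecker symbol\<close>

text \<open>By Euler's criterion both sides agree modulo p; being at most 1 in absolute value, they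
  differ by at most 2 < p.\<close>

lemma Legendre_mult:
  assumes p: "prime p" "odd p"
  shows "Legendre (a * b) (int p) = Legendre a (int p) * Legendre b (int p)"
proof -
  have p2: "p > 2" using p prime_ge_2_nat[of p] by (cases "p = 2") auto
  let ?L = "\<lambda>a. Legendre a (int p)" and ?k = "(p - 1) div 2"
  have "[?L (a * b) = (a * b) ^ ?k] (mod int p)" by (rule euler_criterion[OF p(1) p2])
  also have "(a * b) ^ ?k = a ^ ?k * b ^ ?k" by (rule power_mult_distrib)
  also have "[a ^ ?k * b ^ ?k = ?L a * ?L b] (mod int p)"
    by (intro cong_mult cong_sym[OF euler_criterion[OF p(1) p2]])
  finally have "int p dvd ?L (a * b) - ?L a * ?L b" by (simp add: cong_iff_dvd_diff)
  moreover have "\<bar>?L (a * b) - ?L a * ?L b\<bar> < int p"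
  proof -
    have "\<bar>?L x\<bar> \<le> 1" for x by (simp add: Legendre_def)
    hence "\<bar>?L (a * b)\<bar> \<le> 1" "\<bar>?L a * ?L b\<bar> \<le> 1"
      by (simp_all add: abs_mult mult_le_one)
    thus ?thesis using p2 by linarith
  qed
  ultimately show ?thesis using dvd_imp_le_int[of "?L (a * b) - ?L a * ?L b" "int p"] by fastforce
qed

lemma kronecker_pos: "n > 0 \<Longrightarrow> kronecker a n = (\<Prod>p\<in>#prime_factorization n. kronecker_prime a p)"
  by (simp add: kronecker_def)

lemma kronecker_1_right [simp]: "kronecker a 1 = 1"
  by (simp add: kronecker_def)

lemma kronecker_mult_right_pos:
  "m > 0 \<Longrightarrow> n > 0 \<Longrightarrow> kronecker a (m * n) = kronecker a m * kronecker a n"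
  by (simp add: kronecker_pos prime_factorization_mult)

lemma kronecker_minus_right:
  assumes "n \<noteq> 0"
  shows "kronecker a (- n) = (if a < 0 then -1 else 1) * kronecker a n"
proof -
  have "prime_factorization (- n) = prime_factorization n"
    using prime_factorization_normalize[of "- n"] prime_factorization_normalize[of n] by simp
  thus ?thesis using assms by (auto simp: kronecker_def)
qed

lemma kronecker_0_right: "\<bar>a\<bar> \<noteq> 1 \<Longrightarrow> kronecker a 0 = 0"
  by (simp add: kronecker_def)

text \<open>The case |a| = 1 is excluded because of the value 1 at n = 0: for a = -1 it contradicts
  multiplicativity, as (-1/3) = -1. Negative arguments are reduced to positive ones by the sign
  rule.\<close>

lemma kronecker_mult_right:
  assumes "\<bar>a\<bar> \<noteq> 1"
  shows "kronecker a (m * n) = kronecker a m * kronecker a n"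
proof -
  have *: "kronecker a (x * n) = kronecker a x * kronecker a n" if "x > 0" "n \<noteq> 0" for x n
  proof (cases "n > 0")
    case False
    hence "kronecker a (x * (- (- n))) = (if a < 0 then -1 else 1) * kronecker a (x * (- n))"
      using kronecker_minus_right[of "x * (- n)" a] that by simp
    also have "kronecker a (x * (- n)) = kronecker a x * kronecker a (- n)"
      using False that by (intro kronecker_mult_right_pos) auto
    finally show ?thesis using kronecker_minus_right[of n a] that by auto
  qed (use that kronecker_mult_right_pos in auto)
  consider "m = 0 \<or> n = 0" | "m > 0" "n \<noteq> 0" | "m < 0" "n \<noteq> 0" by linarith
  thus ?thesis
  proof cases
    case 1
    thus ?thesis using kronecker_0_right[OF assms] by auto
  next
    case 2
    thus ?thesis by (rule *)
  next
    case 3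
    have "kronecker a (m * n) = (if a < 0 then -1 else 1) * kronecker a ((- m) * n)"
      using kronecker_minus_right[of "(- m) * n" a] 3 by simp
    also have "kronecker a ((- m) * n) = kronecker a (- m) * kronecker a n"
      using 3 by (intro *) auto
    finally show ?thesis using kronecker_minus_right[of m a] 3 by auto
  qed
qed

lemma kronecker_prime_eq_0_iff: "prime p \<Longrightarrow> kronecker_prime a p = 0 \<longleftrightarrow> p dvd a"
  by (auto simp: kronecker_prime_def Legendre_def cong_iff_dvd_diff)

lemma kronecker_eq_0_iff:
  assumes "\<bar>a\<bar> \<noteq> 1"
  shows "kronecker a n = 0 \<longleftrightarrow> \<not> coprime n a"
proof (cases "n = 0")
  case True
  thus ?thesis using assms by (simp add: kronecker_0_right)
next
  case False
  hence "kronecker a n = 0 \<longleftrightarrow> (\<exists>p\<in>#prime_factorization n. kronecker_prime a p = 0)"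
    by (auto simp: kronecker_def prod_mset_zero_iff)
  also have "\<dots> \<longleftrightarrow> (\<exists>p. prime p \<and> p dvd n \<and> p dvd a)"
    using False by (auto simp: in_prime_factors_iff kronecker_prime_eq_0_iff)
  also have "\<dots> \<longleftrightarrow> \<not> coprime n a"
  proof
    assume "\<exists>p. prime p \<and> p dvd n \<and> p dvd a"
    then obtain p where p: "prime p" "p dvd n" "p dvd a" by blast
    show "\<not> coprime n a"
    proof
      assume "coprime n a"
      from coprime_common_divisor[OF this p(2,3)] not_prime_unit[of p] p(1) show False by blast
    qed
  next
    assume "\<not> coprime n a"
    hence "\<not> is_unit (gcd n a)" by (simp add: coprime_iff_gcd_eq_1)
    moreover have "gcd n a \<noteq> 0" using False by simp
    ultimately obtain p where "prime p" "p dvd gcd n a" using prime_divisor_exists by blast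
    thus "\<exists>p. prime p \<and> p dvd n \<and> p dvd a" by auto
  qed
  finally show ?thesis .
qed

lemma odd_prime_factor_int:
  assumes "odd n" "p \<in># prime_factorization (n::int)"
  obtains q where "p = int q" "prime q" "odd q"
proof -
  have "prime p" "p dvd n" using assms by (auto simp: in_prime_factors_iff)
  hence "odd p" using assms(1) dvd_trans[of 2 p n] by blast
  moreover have "p \<ge> 0" "prime (nat p)" using \<open>prime p\<close> prime_int_nat_transfer[of p] by blast+
  moreover from this have "p = int (nat p)" by simp
  moreover have "even (nat p) \<longleftrightarrow> even p" using \<open>p \<ge> 0\<close> by (simp add: even_nat_iff)
  ultimately show ?thesis using that[of "nat p"] by blast
qed

lemma kronecker_mult_left:
  assumes "n > 0" "odd n"
  shows "kronecker (a * b) n = kronecker a n * kronecker b n"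
proof -
  have "kronecker_prime (a * b) p = kronecker_prime a p * kronecker_prime b p"
    if "p \<in># prime_factorization n" for p
    using assms(2) that
    by (rule odd_prime_factor_int) (auto simp: kronecker_prime_def Legendre_mult)
  hence "(\<Prod>p\<in>#prime_factorization n. kronecker_prime (a * b) p)
      = (\<Prod>p\<in>#prime_factorization n. kronecker_prime a p * kronecker_prime b p)"
    by (intro arg_cong[of _ _ prod_mset] image_mset_cong)
  thus ?thesis using assms by (simp add: kronecker_pos prod_mset.distrib)
qed

lemma kronecker_square_eq_1:
  assumes "n > 0" "odd n" "coprime a n"
  shows "(kronecker a n)\<^sup>2 = 1"
proof -
  have "(kronecker_prime a p)\<^sup>2 = 1" if p: "p \<in># prime_factorization n" for p
  proof -
    have "prime p" "p dvd n" using p by (auto simp: in_prime_factors_iff)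
    hence "\<not> p dvd a" using coprime_common_divisor[OF assms(3), of p] by auto
    thus ?thesis using \<open>prime p\<close> kronecker_prime_eq_0_iff[of p a]
      by (auto simp: kronecker_prime_def Legendre_def split: if_splits)
  qed
  hence "(\<Prod>p\<in>#prime_factorization n. (kronecker_prime a p)\<^sup>2) = (\<Prod>p\<in>#prime_factorization n. 1)"
    by (intro arg_cong[of _ _ prod_mset] image_mset_cong)
  thus ?thesis using assms(1) by (simp add: kronecker_pos power2_eq_square prod_mset.distrib)
qed

lemma kronecker_1_left:
  assumes "n > 0" "odd n"
  shows "kronecker 1 n = 1"
proof -
  have "kronecker 1 n = kronecker (1 * 1) n" by simp
  also have "\<dots> = (kronecker 1 n)\<^sup>2"
    unfolding power2_eq_square by (rule kronecker_mult_left[OF assms])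
  also have "\<dots> = 1"
    by (rule kronecker_square_eq_1[OF assms]) simp
  finally show ?thesis .
qed

lemma kronecker_odd_prime:
  assumes "prime p" "odd p"
  shows "kronecker a (int p) = Legendre a (int p)"
  using assms prime_gt_0_nat[of p] by (auto simp: kronecker_pos prime_factorization_prime kronecker_prime_def)

text \<open>Strong induction on d, splitting off a prime p. If p^2 divides d, the modulus drops by
  p^2 and the symbol is unchanged, (u/p)^2 being 1. Otherwise p and m = d/p are coprime.\<close>

lemma gauss_sum_kronecker:
  assumes "odd d" "coprime u (int d)"
  shows "gauss_sum u d = of_int (kronecker u (int d)) * gauss_sum 1 d"
  using assms
proof (induction d arbitrary: u rule: less_induct)
  case (less d u)
  have d0: "d > 0" using less.prems by (cases d) auto
  show ?case
  proof (cases "d = 1")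
    case True
    moreover have "{0..<1::int} = {0}" by auto
    ultimately show ?thesis by (simp add: gauss_sum_def)
  next
    case False
    then obtain p where p: "prime p" "p dvd d" using prime_factor_nat by blast
    from p(2) obtain m where m: "d = p * m" by blast
    have "odd p" "odd m" using less.prems(1) m by auto
    have p0: "p > 0" and p1: "p > 1" using prime_gt_0_nat[OF p(1)] prime_gt_1_nat[OF p(1)] by auto
    have m0: "m > 0" using d0 m by (cases m) auto
    have md: "m < d" using m p1 m0 by simp
    have cop: "coprime u (int p)" "coprime u (int m)" using less.prems(2) m by auto
    have pu: "\<not> int p dvd u"
      using coprime_common_divisor[OF cop(1), of "int p"] p1 by auto
    show ?thesis
    proof (cases "p dvd m")
      case True
      then obtain l where l: "m = p * l" by blast
      have l0: "l > 0" using m0 l by (cases l) auto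
      have "l < m" using l p1 l0 by simp
      hence "l < d" using md by simp
      have "odd l" using \<open>odd m\<close> l by simp
      have copl: "coprime u (int l)" using cop(2) l by simp
      have "gauss_sum u d = of_nat p * gauss_sum u l"
        unfolding m l by (rule gauss_sum_square_modulus[OF p(1) \<open>odd p\<close> pu l0])
      also have "gauss_sum u l = of_int (kronecker u (int l)) * gauss_sum 1 l"
        by (rule less.IH[OF \<open>l < d\<close> \<open>odd l\<close> copl])
      also have "of_nat p * (of_int (kronecker u (int l)) * gauss_sum 1 l)
          = of_int (kronecker u (int l)) * (of_nat p * gauss_sum 1 l)" by simp
      also have "of_nat p * gauss_sum 1 l = gauss_sum 1 d"
        unfolding m l using gauss_sum_square_modulus[OF p(1) \<open>odd p\<close> _ l0, of 1] p1 by simp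
      also have "kronecker u (int l) = kronecker u (int d)"
      proof -
        have "kronecker u (int d) = (kronecker u (int p))\<^sup>2 * kronecker u (int l)"
          using p0 l0 by (simp add: m l kronecker_mult_right_pos power2_eq_square)
        also have "(kronecker u (int p))\<^sup>2 = 1"
          using p0 \<open>odd p\<close> cop(1) by (intro kronecker_square_eq_1) auto
        finally show ?thesis by simp
      qed
      finally show ?thesis .
    next
      case False
      hence pm: "coprime p m" using p(1) by (simp add: prime_imp_coprime)
      \<comment> \<open>The bracket, with the symbols (m/p) and (p/m) in it, does not depend on v.
        At v = 1 the formula identifies it with \<open>gauss_sum 1 d\<close>, which gives the claim
        at v = u.\<close>
      have decomp: "gauss_sum v d = of_int (kronecker v (int d)) *
          (of_int (Legendre (int m) (int p)) * of_int (kronecker (int p) (int m)) * (gauss_sum 1 p * gauss_sum 1 m))"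
        if v: "coprime v (int d)" for v
      proof -
        have cop: "coprime v (int p)" "coprime v (int m)" using v m by auto
        have pv: "\<not> int p dvd v * int m"
        proof -
          have "coprime (v * int m) (int p)" using cop pm by (simp add: coprime_commute)
          thus ?thesis using coprime_common_divisor[of "v * int m" "int p" "int p"] p1 by auto
        qed
        have "gauss_sum v d = gauss_sum (v * int m) p * gauss_sum (v * int p) m"
          unfolding m by (rule gauss_sum_coprime_mult[OF pm p0 m0])
        also have "gauss_sum (v * int m) p = of_int (Legendre v (int p) * Legendre (int m) (int p)) * gauss_sum 1 p"
          using gauss_sum_prime[OF p(1) \<open>odd p\<close> pv] by (simp add: Legendre_mult[OF p(1) \<open>odd p\<close>])
        also have "gauss_sum (v * int p) m = of_int (kronecker (v * int p) (int m)) * gauss_sum 1 m"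
          using cop pm by (intro less.IH md \<open>odd m\<close>) simp
        also have "kronecker (v * int p) (int m) = kronecker v (int m) * kronecker (int p) (int m)"
          using m0 \<open>odd m\<close> by (intro kronecker_mult_left) auto
        finally have "gauss_sum v d = of_int (Legendre v (int p) * kronecker v (int m)) *
          (of_int (Legendre (int m) (int p)) * of_int (kronecker (int p) (int m)) * (gauss_sum 1 p * gauss_sum 1 m))"
          by (simp add: mult_ac)
        also have "Legendre v (int p) * kronecker v (int m) = kronecker v (int d)"
          using p0 m0 by (simp add: m kronecker_mult_right_pos kronecker_odd_prime[OF p(1) \<open>odd p\<close>])
        finally show ?thesis .
      qed
      have "kronecker 1 (int d) = 1"
        using d0 less.prems(1) by (intro kronecker_1_left) auto
      with decomp[of 1] decomp[OF less.prems(2)] show ?thesis by simp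
    qed
  qed
qed

text \<open>Insert G(-1) = (-1/d) G(1) into G(1) G(-1) = d.\<close>

lemma gauss_sum_1_square:
  assumes "odd d"
  shows "(gauss_sum 1 d)\<^sup>2 = of_int (kronecker (-1) (int d)) * of_nat d"
proof -
  have d0: "d > 0" using assms by (cases d) auto
  have "gauss_sum (-1) d = of_int (kronecker (-1) (int d)) * gauss_sum 1 d"
    using assms by (intro gauss_sum_kronecker) auto
  with gauss_sum_times_neg[OF assms]
  have eq: "of_int (kronecker (-1) (int d)) * (gauss_sum 1 d)\<^sup>2 = of_nat d"
    by (simp add: power2_eq_square mult_ac)
  have "(kronecker (-1) (int d))\<^sup>2 = 1"
    using assms d0 by (intro kronecker_square_eq_1) auto
  hence "of_int ((kronecker (-1) (int d))\<^sup>2) = (1::complex)"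
    by (simp only: of_int_1)
  hence *: "of_int (kronecker (-1) (int d)) * of_int (kronecker (-1) (int d)) = (1::complex)"
    by (simp only: power2_eq_square of_int_mult)
  have "(gauss_sum 1 d)\<^sup>2 = (of_int (kronecker (-1) (int d)) * of_int (kronecker (-1) (int d))) * (gauss_sum 1 d)\<^sup>2"
    by (simp only: * mult_1_left)
  also have "\<dots> = of_int (kronecker (-1) (int d)) * of_nat d"
    by (simp only: mult.assoc eq)
  finally show ?thesis .
qed

text \<open>Each factor is (b/d)(a_i/d) G(1). As the number of factors is even, (b/d) drops out and
  G(1) enters through G(1)^2 = (-1/d) d; this produces the sign (-1)^l of the discriminant.\<close>

lemma prod_gauss_sum:
  fixes a :: "'i \<Rightarrow> int"
  assumes d: "odd d" and I: "finite I" "card I = 2 * l"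
    and b: "coprime b (int d)" and a: "\<And>i. i \<in> I \<Longrightarrow> coprime (a i) (int d)"
  shows "(\<Prod>i\<in>I. gauss_sum (b * a i) d) = of_int (kronecker ((-1) ^ l * (\<Prod>i\<in>I. a i)) (int d)) * of_nat d ^ l"
proof -
  have d0: "d > 0" using d by (cases d) auto
  let ?K = "\<lambda>a. kronecker a (int d)"
  have K1: "?K 1 = 1"
    using d0 d by (intro kronecker_1_left) auto
  have Kmult: "?K (x * y) = ?K x * ?K y" for x y
    using d d0 by (intro kronecker_mult_left) auto
  have Kpow: "?K (x ^ n) = ?K x ^ n" for x n
    by (induction n) (simp_all add: K1 Kmult)
  have Kprod: "?K (\<Prod>i\<in>I. a i) = (\<Prod>i\<in>I. ?K (a i))"
    using I(1) by (induction I rule: finite_induct) (simp_all add: K1 Kmult)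
  have "(\<Prod>i\<in>I. gauss_sum (b * a i) d) = (\<Prod>i\<in>I. of_int (?K b * ?K (a i)) * gauss_sum 1 d)"
  proof (intro prod.cong refl)
    fix i assume "i \<in> I"
    hence "coprime (b * a i) (int d)" using a b by simp
    from gauss_sum_kronecker[OF d this] show "gauss_sum (b * a i) d = of_int (?K b * ?K (a i)) * gauss_sum 1 d"
      by (simp only: Kmult)
  qed
  also have "\<dots> = of_int (?K b ^ card I * ?K (\<Prod>i\<in>I. a i)) * gauss_sum 1 d ^ card I"
    by (simp only: prod.distrib Kprod prod_constant of_int_prod of_int_mult of_int_power)
  finally have eq: "(\<Prod>i\<in>I. gauss_sum (b * a i) d) = of_int (?K b ^ card I * ?K (\<Prod>i\<in>I. a i)) * gauss_sum 1 d ^ card I" .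
  have 1: "?K b ^ card I = 1"
    using kronecker_square_eq_1[of "int d" b] d d0 b by (simp add: I(2) power_mult)
  have 2: "gauss_sum 1 d ^ card I = of_int (?K ((-1) ^ l)) * of_nat d ^ l"
    unfolding I(2) power_mult gauss_sum_1_square[OF d] power_mult_distrib Kpow by simp
  show ?thesis unfolding eq 1 2 Kmult by simp
qed

section \<open>The transformation of the theta series\<close>

lemma Im_moebius_real:
  fixes a b c d :: real
  shows "Im ((of_real a * \<tau> + of_real b) / (of_real c * \<tau> + of_real d))
           = (a * d - b * c) * Im \<tau> / (norm (of_real c * \<tau> + of_real d))\<^sup>2"
  by (simp add: Im_divide cmod_power2 algebra_simps)

lemma linear_nonzero_upper_half_plane:
  fixes c d :: real
  assumes "Im \<tau> > 0" "c \<noteq> 0 \<or> d \<noteq> 0"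
  shows "of_real c * \<tau> + of_real d \<noteq> 0"
  using assms by (auto simp: complex_eq_iff)

text \<open>A positive factor keeps the principal branch. This extracts sqrt C from the roots below,
  so that one and the same root serves all scalings C.\<close>

lemma csqrt_of_real_mult:
  assumes "r \<ge> 0"
  shows "csqrt (of_real r * z) = of_real (sqrt r) * csqrt z"
proof (rule csqrt_unique)
  show "(of_real (sqrt r) * csqrt z)\<^sup>2 = of_real r * z"
    using assms by (simp add: power_mult_distrib flip: of_real_power)
  show "0 < Re (of_real (sqrt r) * csqrt z) \<or> Re (of_real (sqrt r) * csqrt z) = 0 \<and> 0 \<le> Im (of_real (sqrt r) * csqrt z)"
  proof (cases "r = 0")
    case False
    hence "sqrt r > 0" using assms by simp
    thus ?thesis using csqrt_principal[of z] by auto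
  qed auto
qed

section \<open>The theta constant of odd squares\<close>

definition odd_ind :: "int \<Rightarrow> complex" where
  "odd_ind n = (if odd n then 1 else 0)"

text \<open>The Jacobi theta constant, the sum of e^(pi i (n + 1/2)^2 \<tau>) over all integers n;
  the half-integers are encoded as odd numbers by means of \<tau>/4.\<close>

definition theta2 :: "complex \<Rightarrow> complex" where
  "theta2 \<tau> = Theta odd_ind (\<tau> / 4)"

lemma bounded_odd_ind: "bounded (range odd_ind)"
  by (rule boundedI[of _ 1]) (auto simp: odd_ind_def)

text \<open>Modulo 2 the Fourier transform of the odd indicator is (-1)^m, so the left-hand side is
  the theta constant with alternating signs. \<open>theta2_transform\<close> reads the formula from
  left to right to return to \<open>theta2\<close>.\<close>

lemma theta2_inversion:
  assumes "Im \<tau> > 0"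
  shows "Theta (\<lambda>m. ecis (of_int m / 2)) (- 1 / \<tau>) = 2 * csqrt (- \<i> * (\<tau> / 4)) * theta2 \<tau>"
proof -
  have "dft 2 odd_ind m = ecis (of_int m / 2)" for m
    by (simp add: dft_def odd_ind_def numeral_2_eq_2)
  hence dft: "dft 2 odd_ind = (\<lambda>m. ecis (of_int m / 2))" by blast
  have "of_nat 2 * csqrt (- \<i> * (\<tau> / 4)) * Theta odd_ind (\<tau> / 4) = Theta (dft 2 odd_ind) (- 1 / (of_nat 2 ^ 2 * (\<tau> / 4)))"
    using assms by (intro Theta_inversion) (auto simp: odd_ind_def)
  thus ?thesis by (simp add: dft theta2_def)
qed

text \<open>The phase has denominator 8D, yet 2D is a period: n -> n + 2Dk changes n^2 by 4D k(n +
  Dk), and k(n + Dk) is even for odd n and D.\<close>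

lemma odd_square_phase_periodic:
  assumes D: "odd D" and xy: "[x = y] (mod int (2 * D))"
  shows "odd_ind x * ecis (of_int (b * x\<^sup>2) / of_nat (8 * D)) = odd_ind y * ecis (of_int (b * y\<^sup>2) / of_nat (8 * D))"
proof -
  have D0: "D > 0" using D by (cases D) auto
  obtain k where "x - y = int (2 * D) * k"
    using xy by (auto simp: cong_iff_dvd_diff dvd_def)
  hence k: "x = y + 2 * int D * k" by simp
  show ?thesis
  proof (cases "odd y")
    case False
    thus ?thesis by (simp add: odd_ind_def k)
  next
    case True
    have "even (k * (y + int D * k))" using True D by auto
    then obtain j where j: "k * (y + int D * k) = 2 * j" by blast
    have "b * x\<^sup>2 - b * y\<^sup>2 = b * (4 * int D * (k * (y + int D * k)))"
      by (simp add: k power2_eq_square algebra_simps)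
    also have "\<dots> = int (8 * D) * (b * j)" by (simp add: j)
    finally have "[b * x\<^sup>2 = b * y\<^sup>2] (mod int (8 * D))" by (simp only: cong_iff_dvd_diff dvd_triv_left)
    from ecis_cong[OF this] have "ecis (of_int (b * x\<^sup>2) / of_nat (8 * D)) = ecis (of_int (b * y\<^sup>2) / of_nat (8 * D))" .
    moreover have "odd_ind x = odd_ind y" by (simp add: odd_ind_def k)
    ultimately show ?thesis by (simp only:)
  qed
qed

text \<open>The odd residues modulo 2D are represented by D + 4y, and b(D + 4y)^2/(8D) = bD/8 + b y
  + 2 b y^2/D. This is the origin of the phase e(bD/8) and of the factor 2b.\<close>

lemma odd_gauss_sum:
  assumes D: "odd D"
  shows "(\<Sum>r\<in>{0..<int (2 * D)}. odd_ind r * ecis (of_int (b * r\<^sup>2) / of_nat (8 * D)))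
           = ecis (of_int b * of_nat D / 8) * gauss_sum (2 * b) D"
proof -
  have D0: "D > 0" using D by (cases D) auto
  let ?A = "{0..<int D} \<times> {0, 1::int}"
  let ?F = "\<lambda>r. odd_ind r * ecis (of_int (b * r\<^sup>2) / of_nat (8 * D))"
  \<comment> \<open>The second coordinate fixes the parity: D + 4y is odd and 2D + 4y is even, so
    only the first half contributes.\<close>
  let ?g = "\<lambda>x. int D + 4 * fst x + int D * snd x"
  have "(\<Sum>r\<in>{0..<int (2 * D)}. ?F r) = (\<Sum>x\<in>?A. ?F (?g x))"
  proof (rule sum_complete_residues[symmetric])
    show "?F x = ?F y" if "[x = y] (mod int (2 * D))" for x y
      using that by (rule odd_square_phase_periodic[OF D])
    fix x y assume x: "x \<in> ?A" and y: "y \<in> ?A" and c: "[?g x = ?g y] (mod int (2 * D))"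
    obtain q where q: "?g x - ?g y = int (2 * D) * q"
      using c by (auto simp: cong_iff_dvd_diff dvd_def)
    have "even (int D * (snd x - snd y))"
    proof -
      have "int D * (snd x - snd y) = 2 * (int D * q - 2 * (fst x - fst y))"
        using q by (simp add: algebra_simps)
      thus ?thesis by simp
    qed
    hence "even (snd x - snd y)" using D by simp
    hence s: "snd x = snd y" using x y by auto
    have "int D dvd 2 * (fst x - fst y)"
    proof -
      have "2 * (fst x - fst y) = int D * q" using q s by (simp add: algebra_simps)
      thus ?thesis by simp
    qed
    moreover have "coprime (int D) 2" using D by simp
    ultimately have "int D dvd fst x - fst y" by (simp only: coprime_dvd_mult_right_iff)
    hence "[fst x = fst y] (mod int D)" by (simp add: cong_iff_dvd_diff)
    moreover have "fst x \<in> {0..<int D}" "fst y \<in> {0..<int D}" using x y by auto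
    ultimately have "fst x = fst y" using residue_cong_imp_eq by blast
    with s show "x = y" by (simp add: prod_eq_iff)
  qed (use D0 in \<open>auto simp: card_cartesian_product\<close>)
  also have "\<dots> = (\<Sum>y\<in>{0..<int D}. ?F (?g (y, 0)) + ?F (?g (y, 1)))"
    by (simp add: sum.cartesian_product' )
  also have "\<dots> = (\<Sum>y\<in>{0..<int D}. ecis (of_int b * of_nat D / 8) * ecis (of_int (2 * b * y\<^sup>2) / of_nat D))"
  proof (intro sum.cong refl)
    fix y
    have "real_of_int (b * (?g (y, 0))\<^sup>2) / of_nat (8 * D) = of_int b * of_nat D / 8 + of_int (2 * b * y\<^sup>2) / of_nat D + of_int (b * y)"
      using D0 by (simp add: power2_eq_square field_simps)
    hence "ecis (of_int (b * (?g (y, 0))\<^sup>2) / of_nat (8 * D)) = ecis (of_int b * of_nat D / 8) * ecis (of_int (2 * b * y\<^sup>2) / of_nat D)"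
      by (simp only: ecis_add ecis_of_int mult_1_right)
    moreover have "odd_ind (?g (y, 0)) = 1" "odd_ind (?g (y, 1)) = 0" using D by (auto simp: odd_ind_def)
    ultimately show "?F (?g (y, 0)) + ?F (?g (y, 1)) = ecis (of_int b * of_nat D / 8) * ecis (of_int (2 * b * y\<^sup>2) / of_nat D)"
      by (simp only: mult_zero_left mult_1_left add_0_right)
  qed
  also have "\<dots> = ecis (of_int b * of_nat D / 8) * gauss_sum (2 * b) D"
    by (simp only: gauss_sum_def sum_distrib_left)
  finally show ?thesis .
qed

text \<open>Completing the square: modulo \<open>8 D\<close> and for odd \<open>r\<close>, the number
  \<open>b r\<^sup>2 + 4 m r - 4 c m\<^sup>2\<close> differs from \<open>b (r - 2 c m)\<^sup>2\<close> by \<open>4 D m\<close>, because \<open>b c = a D - 1\<close>.\<close>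
lemma dft_odd_phase:
  fixes a b c :: int
  assumes D: "odd D" and c: "even c" and det: "a * int D - b * c = 1"
  shows "dft (2 * D) (\<lambda>n. odd_ind n * ecis (of_int (n\<^sup>2) * (of_int b / (4 * of_nat D)) / 2)) m
            * ecis (of_int (m\<^sup>2) * (- of_int c / of_nat D) / 2)
          = (ecis (of_int b * of_nat D / 8) * gauss_sum (2 * b) D) * ecis (of_int m / 2)"
proof -
  have D0: "D > 0" using D by (cases D) auto
  have a: "odd a"
  proof
    assume "even a"
    hence "even (a * int D - b * c)" using c by simp
    thus False using det by simp
  qed
  let ?F = "\<lambda>r. odd_ind r * ecis (of_int (b * r\<^sup>2) / of_nat (8 * D))"
  have term_eq: "odd_ind r * ecis (of_int (r\<^sup>2) * (of_int b / (4 * of_nat D)) / 2) * ecis (of_int m * of_int r / of_nat (2 * D))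
          * ecis (of_int (m\<^sup>2) * (- of_int c / of_nat D) / 2) = ?F (r - 2 * c * m) * ecis (of_int m / 2)" for r
  proof (cases "odd r")
    case False
    thus ?thesis by (simp add: odd_ind_def)
  next
    case True
    \<comment> \<open>\<open>a\<close> and \<open>r\<close> are odd, so a m r/2 is m/2 modulo 1;
      \<open>c\<close> is even, so a c m^2/2 is an integer.\<close>
    have "even (m * (a * r - 1))" using True a by simp
    then obtain j where j: "m * (a * r - 1) = 2 * j" by blast
    obtain l where l: "c = 2 * l" using c by blast
    have Z: "b * r\<^sup>2 + 4 * m * r - 4 * c * m\<^sup>2 = b * (r - 2 * c * m)\<^sup>2 + 4 * (a * int D) * m * r - 4 * (a * int D) * c * m\<^sup>2"
    proof -
      have "a * int D = b * c + 1" using det by simp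
      thus ?thesis by (simp only:) (simp add: power2_eq_square algebra_simps)
    qed
    have "real_of_int (b * r\<^sup>2 + 4 * m * r - 4 * c * m\<^sup>2) / of_nat (8 * D)
        = of_int (b * (r - 2 * c * m)\<^sup>2) / of_nat (8 * D) + of_int (m * (a * r)) / 2 - of_int (a * l * m\<^sup>2)"
      unfolding Z using D0 by (simp add: l field_simps)
    also have "real_of_int (m * (a * r)) / 2 = of_int m / 2 + of_int j"
    proof -
      have "m * (a * r) = m + 2 * j" using j by (simp add: algebra_simps)
      thus ?thesis by simp
    qed
    finally have "real_of_int (b * r\<^sup>2 + 4 * m * r - 4 * c * m\<^sup>2) / of_nat (8 * D)
        = of_int (b * (r - 2 * c * m)\<^sup>2) / of_nat (8 * D) + of_int m / 2 + of_int (j - a * l * m\<^sup>2)" by simp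
    hence "ecis (of_int (b * r\<^sup>2 + 4 * m * r - 4 * c * m\<^sup>2) / of_nat (8 * D))
        = ecis (of_int (b * (r - 2 * c * m)\<^sup>2) / of_nat (8 * D)) * ecis (of_int m / 2)"
      by (simp only: ecis_add ecis_of_int mult_1_right)
    moreover have "real_of_int (b * r\<^sup>2 + 4 * m * r - 4 * c * m\<^sup>2) / of_nat (8 * D)
       = of_int (r\<^sup>2) * (of_int b / (4 * of_nat D)) / 2 + of_int m * of_int r / of_nat (2 * D) + of_int (m\<^sup>2) * (- of_int c / of_nat D) / 2"
      using D0 by (simp add: field_simps)
    moreover have "odd_ind r = 1" "odd_ind (r - 2 * c * m) = 1" using True by (auto simp: odd_ind_def)
    ultimately show ?thesis by (simp only: ecis_add mult_1_left)
  qed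
  have "dft (2 * D) (\<lambda>n. odd_ind n * ecis (of_int (n\<^sup>2) * (of_int b / (4 * of_nat D)) / 2)) m
     = (\<Sum>r\<in>{0..<int (2 * D)}. odd_ind r * ecis (of_int (r\<^sup>2) * (of_int b / (4 * of_nat D)) / 2) * ecis (of_int m * of_int r / of_nat (2 * D)))"
    unfolding dft_def
    by (rule sum.reindex_bij_witness[of _ nat int]) (auto simp: nat_less_iff)
  hence "dft (2 * D) (\<lambda>n. odd_ind n * ecis (of_int (n\<^sup>2) * (of_int b / (4 * of_nat D)) / 2)) m
            * ecis (of_int (m\<^sup>2) * (- of_int c / of_nat D) / 2)
      = (\<Sum>r\<in>{0..<int (2 * D)}. ?F (r - 2 * c * m)) * ecis (of_int m / 2)"
    by (simp only: sum_distrib_right term_eq)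
  also have "(\<Sum>r\<in>{0..<int (2 * D)}. ?F (r - 2 * c * m)) = (\<Sum>r\<in>{0..<int (2 * D)}. ?F r)"
  proof (rule sum_complete_residues)
    show "?F x = ?F y" if "[x = y] (mod int (2 * D))" for x y
      using that by (rule odd_square_phase_periodic[OF D])
    fix x y assume xy: "x \<in> {0..<int (2 * D)}" "y \<in> {0..<int (2 * D)}" "[x - 2 * c * m = y - 2 * c * m] (mod int (2 * D))"
    hence "[x = y] (mod int (2 * D))" by (simp add: cong_iff_dvd_diff)
    thus "x = y" using xy(1,2) residue_cong_imp_eq by blast
  qed (use D0 in auto)
  finally show ?thesis by (simp only: odd_gauss_sum[OF D])
qed

text \<open>The inversion with modulus 2D sends w to -1/(4 D^2 w) = -1/\<tau> - c/D. The shift -c/D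
  supplies the phase that completes the square in the finite Fourier transform, leaving a constant
  times (-1)^m and hence a multiple of \<open>theta2 \<tau>\<close>. Both principal roots are left
  standing; only their even powers are evaluated later.\<close>

lemma theta2_transform:
  fixes a b c :: int
  assumes D: "odd D" and c: "even c" and det: "a * int D - b * c = 1" and \<tau>: "Im \<tau> > 0"
  defines "w \<equiv> \<tau> / (4 * of_nat D * (of_int c * \<tau> + of_nat D))"
  shows "of_nat (2 * D) * csqrt (- \<i> * w) * theta2 ((of_int a * \<tau> + of_int b) / (of_int c * \<tau> + of_nat D))
          = (ecis (of_int b * of_nat D / 8) * gauss_sum (2 * b) D) * (2 * csqrt (- \<i> * (\<tau> / 4)) * theta2 \<tau>)"
proof -
  have D0: "D > 0" using D by (cases D) auto
  have nz: "of_int c * \<tau> + of_nat D \<noteq> 0"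
    using linear_nonzero_upper_half_plane[OF \<tau>, of "of_int c" "of_nat D"] D0 by simp
  have \<tau>0: "\<tau> \<noteq> 0" using \<tau> by auto
  define G where "G = ecis (of_int b * of_nat D / 8) * gauss_sum (2 * b) D"
  define \<phi> where "\<phi> = (\<lambda>n. odd_ind n * ecis (of_int (n\<^sup>2) * (of_int b / (4 * of_nat D)) / 2))"
  have Imw: "Im w > 0"
  proof -
    have "w = (of_real 1 * \<tau> + of_real 0) / (of_real (4 * of_nat D * of_int c) * \<tau> + of_real (4 * of_nat D * of_nat D))"
      by (simp add: w_def algebra_simps)
    also have "Im \<dots> = (1 * (4 * real D * real D) - 0 * (4 * real D * of_int c)) * Im \<tau> /
        (norm (of_real (4 * of_nat D * of_int c) * \<tau> + of_real (4 * of_nat D * of_nat D)))\<^sup>2"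
      by (rule Im_moebius_real)
    also have "\<dots> > 0"
      using D0 \<tau> linear_nonzero_upper_half_plane[OF \<tau>, of "4 * of_nat D * of_int c" "4 * of_nat D * of_nat D"]
      by (intro divide_pos_pos) (auto simp del: of_real_mult)
    finally show ?thesis .
  qed
  have arg: "(of_int a * \<tau> + of_int b) / (of_int c * \<tau> + of_nat D) / 4 = w + of_real (of_int b / (4 * of_nat D))"
  proof -
    have "of_int (a * int D - b * c) = (1::complex)" by (simp only: det of_int_1)
    hence "of_int a * of_nat D = 1 + of_int b * (of_int c :: complex)" by (simp add: algebra_simps)
    hence "of_int a * of_nat D * \<tau> = \<tau> + of_int b * of_int c * \<tau>" by (simp add: algebra_simps)
    hence "(of_int a * \<tau> + of_int b) * of_nat D = \<tau> + of_int b * (of_int c * \<tau> + of_nat D)"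
      by (simp add: algebra_simps)
    hence "(of_int a * \<tau> + of_int b) = (\<tau> + of_int b * (of_int c * \<tau> + of_nat D)) / of_nat D"
      using D0 by (simp add: field_simps)
    thus ?thesis
      using nz D0 by (simp add: w_def add_divide_distrib mult_ac)
  qed
  have per: "\<phi> (n + int (2 * D)) = \<phi> n" for n
  proof -
    have "\<phi> x = odd_ind x * ecis (of_int (b * x\<^sup>2) / of_nat (8 * D))" for x
      by (simp add: \<phi>_def field_simps)
    thus ?thesis using odd_square_phase_periodic[OF D, of "n + int (2 * D)" n b]
      by (simp only: cong_iff_dvd_diff add_diff_cancel_left' dvd_refl)
  qed
  have "theta2 ((of_int a * \<tau> + of_int b) / (of_int c * \<tau> + of_nat D)) = Theta \<phi> w"
    unfolding theta2_def arg Theta_add_real \<phi>_def by (simp only:)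
  hence "of_nat (2 * D) * csqrt (- \<i> * w) * theta2 ((of_int a * \<tau> + of_int b) / (of_int c * \<tau> + of_nat D))
      = Theta (dft (2 * D) \<phi>) (- 1 / (of_nat (2 * D) ^ 2 * w))"
    using Theta_inversion[of "2 * D" \<phi> w, OF _ per Imw] D0 by simp
  also have "- 1 / (of_nat (2 * D) ^ 2 * w) = - 1 / \<tau> + of_real (- of_int c / of_nat D)"
    using nz D0 \<tau>0 by (simp add: w_def field_simps power2_eq_square)
  also have "Theta (dft (2 * D) \<phi>) (- 1 / \<tau> + of_real (- of_int c / of_nat D))
      = Theta (\<lambda>m. G * ecis (of_int m / 2)) (- 1 / \<tau>)"
    unfolding Theta_add_real \<phi>_def dft_odd_phase[OF D c det] G_def by (simp only:)
  also have "\<dots> = G * Theta (\<lambda>m. ecis (of_int m / 2)) (- 1 / \<tau>)"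
    by (rule Theta_cmult)
  also have "\<dots> = G * (2 * csqrt (- \<i> * (\<tau> / 4)) * theta2 \<tau>)"
    by (simp only: theta2_inversion[OF \<tau>])
  finally show ?thesis by (simp only: G_def)
qed

text \<open>C A(\<tau>) = A'(C \<tau>), where A' has the entries a, bC, c/C, D, and c/C is even
  because 2C divides c. Both sides acquire the same factor sqrt C, so the two roots do not depend on
  C.\<close>

lemma theta2_transform_scaled:
  fixes a b c :: int
  assumes D: "odd D" and c: "int (2 * C) dvd c" and C: "C > 0" and det: "a * int D - b * c = 1" and \<tau>: "Im \<tau> > 0"
  defines "w \<equiv> \<tau> / (4 * of_nat D * (of_int c * \<tau> + of_nat D))"
  shows "of_nat (2 * D) * csqrt (- \<i> * w) * theta2 (of_nat C * ((of_int a * \<tau> + of_int b) / (of_int c * \<tau> + of_nat D)))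
          = (ecis (of_int (b * int C) * of_nat D / 8) * gauss_sum (2 * (b * int C)) D) * (2 * csqrt (- \<i> * (\<tau> / 4)) * theta2 (of_nat C * \<tau>))"
proof -
  obtain l where "c = int (2 * C) * l" using c by blast
  hence l: "c = int C * (2 * l)" by simp
  let ?c = "2 * l" and ?t = "of_nat C * \<tau>"
  let ?w = "?t / (4 * of_nat D * (of_int ?c * ?t + of_nat D))"
  have cC: "of_int ?c * ?t = of_int c * \<tau>" by (simp add: l)
  have "a * int D - (b * int C) * ?c = 1" using det by (simp add: l mult_ac)
  moreover have "Im ?t > 0" using \<tau> C by simp
  ultimately have tr: "of_nat (2 * D) * csqrt (- \<i> * ?w) * theta2 ((of_int a * ?t + of_int (b * int C)) / (of_int ?c * ?t + of_nat D))
          = (ecis (of_int (b * int C) * of_nat D / 8) * gauss_sum (2 * (b * int C)) D) * (2 * csqrt (- \<i> * (?t / 4)) * theta2 ?t)"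
    by (intro theta2_transform D) simp_all
  have 1: "(of_int a * ?t + of_int (b * int C)) / (of_int ?c * ?t + of_nat D)
       = of_nat C * ((of_int a * \<tau> + of_int b) / (of_int c * \<tau> + of_nat D))"
    unfolding cC by (simp add: algebra_simps)
  have 2: "csqrt (- \<i> * ?w) = of_real (sqrt C) * csqrt (- \<i> * w)"
  proof -
    have "- \<i> * ?w = of_real (real C) * (- \<i> * w)" unfolding cC w_def by simp
    thus ?thesis by (simp only: csqrt_of_real_mult of_nat_0_le_iff)
  qed
  have 3: "csqrt (- \<i> * (?t / 4)) = of_real (sqrt C) * csqrt (- \<i> * (\<tau> / 4))"
  proof -
    have "- \<i> * (?t / 4) = of_real (real C) * (- \<i> * (\<tau> / 4))" by simp
    thus ?thesis by (simp only: csqrt_of_real_mult of_nat_0_le_iff)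
  qed
  have nz: "of_real (sqrt C) \<noteq> (0::complex)" using C by simp
  from tr have "of_real (sqrt C) * (of_nat (2 * D) * csqrt (- \<i> * w) * theta2 (of_nat C * ((of_int a * \<tau> + of_int b) / (of_int c * \<tau> + of_nat D))))
     = of_real (sqrt C) * ((ecis (of_int (b * int C) * of_nat D / 8) * gauss_sum (2 * (b * int C)) D) * (2 * csqrt (- \<i> * (\<tau> / 4)) * theta2 (of_nat C * \<tau>)))"
    unfolding 1 2 3 by (simp only: mult_ac)
  thus ?thesis using nz by (simp only: mult_cancel_left simp_thms)
qed

text \<open>Every odd number is 2n + 1 or -(2n + 1) with n \<ge> 0, and (2n + 1)^2/8 = n(n + 1)/2 +
  1/8; each exponent therefore occurs twice.\<close>

lemma theta2_eq_Psi:
  assumes \<tau>: "Im \<tau> > 0"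
  shows "theta2 \<tau> = 2 * (q_pow (1/8) \<tau> * Psi \<tau>)"
    and "summable (\<lambda>n. q_pow (real n * (real n + 1) / 2) \<tau>)"
proof -
  let ?f = "\<lambda>n. odd_ind n * exp (of_real pi * \<i> * of_int (n\<^sup>2) * (\<tau> / 4))"
  have Im4: "Im (\<tau> / 4) > 0" using \<tau> by simp
  have sum_f: "?f summable_on UNIV" by (rule Theta_summable(2)[OF bounded_odd_ind Im4])
  let ?g = "\<lambda>n. 2 * int n + 1" and ?g' = "\<lambda>n. - (2 * int n + 1)"
  have term_eq: "?f (?g n) = q_pow (1/8) \<tau> * q_pow (real n * (real n + 1) / 2) \<tau>"
    "?f (?g' n) = q_pow (1/8) \<tau> * q_pow (real n * (real n + 1) / 2) \<tau>" for n
  proof -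
    have "of_real pi * \<i> * of_int ((?g n)\<^sup>2) * (\<tau> / 4) =
        2 * of_real pi * \<i> * of_real (1/8) * \<tau> + 2 * of_real pi * \<i> * of_real (real n * (real n + 1) / 2) * \<tau>"
      by (simp add: power2_eq_square field_simps)
    hence *: "exp (of_real pi * \<i> * of_int ((?g n)\<^sup>2) * (\<tau> / 4)) = q_pow (1/8) \<tau> * q_pow (real n * (real n + 1) / 2) \<tau>"
      by (simp only: q_pow_def exp_add)
    have "odd_ind (?g n) = 1" "odd_ind (?g' n) = 1" by (simp_all add: odd_ind_def)
    thus "?f (?g n) = q_pow (1/8) \<tau> * q_pow (real n * (real n + 1) / 2) \<tau>"
      "?f (?g' n) = q_pow (1/8) \<tau> * q_pow (real n * (real n + 1) / 2) \<tau>"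
      by (simp_all only: power2_minus * mult_1_left)
  qed
  have inj: "inj ?g" "inj ?g'" by (auto simp: inj_def)
  have "?f summable_on range ?g" using sum_f by (rule summable_on_subset_banach) auto
  hence "(\<lambda>n. ?f (?g n)) summable_on UNIV" using inj by (simp add: summable_on_reindex o_def)
  then obtain S where S: "((\<lambda>n. q_pow (1/8) \<tau> * q_pow (real n * (real n + 1) / 2) \<tau>) has_sum S) UNIV"
    unfolding term_eq by (auto simp: summable_on_def)
  have "(?f has_sum S) (range ?g)"
    using has_sum_reindex[OF inj(1), of ?f S] S unfolding o_def term_eq by blast
  moreover have "(?f has_sum S) (range ?g')"
    using has_sum_reindex[OF inj(2), of ?f S] S unfolding o_def term_eq by blast
  moreover have "range ?g \<inter> range ?g' = {}"
  proof -
    have "?g m \<noteq> ?g' n" for m n by presburger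
    thus ?thesis by blast
  qed
  ultimately have "(?f has_sum (S + S)) (range ?g \<union> range ?g')"
    by (rule has_sum_Un_disjoint)
  also have "?this \<longleftrightarrow> (?f has_sum (S + S)) UNIV"
  proof (rule has_sum_cong_neutral)
    fix n :: int assume n: "n \<in> UNIV - (range ?g \<union> range ?g')"
    have "even n"
    proof (rule ccontr)
      assume "odd n"
      then obtain k where k: "n = 2 * k + 1" by (rule oddE)
      show False
      proof (cases "k \<ge> 0")
        case True
        hence "n = ?g (nat k)" by (simp add: k)
        thus False using n by blast
      next
        case False
        hence "n = ?g' (nat (- k - 1))" by (simp add: k)
        thus False using n by blast
      qed
    qed
    thus "?f n = 0" by (simp add: odd_ind_def)
  qed auto
  finally have "theta2 \<tau> = S + S"
    unfolding theta2_def Theta_def by (rule infsumI)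
  moreover have "(\<lambda>n. q_pow (1/8) \<tau> * q_pow (real n * (real n + 1) / 2) \<tau>) sums S"
    using S by (rule has_sum_imp_sums)
  hence "(\<lambda>n. (q_pow (1/8) \<tau> * q_pow (real n * (real n + 1) / 2) \<tau>) / q_pow (1/8) \<tau>) sums (S / q_pow (1/8) \<tau>)"
    by (rule sums_divide)
  hence sums: "(\<lambda>n. q_pow (real n * (real n + 1) / 2) \<tau>) sums (S / q_pow (1/8) \<tau>)"
    by (simp add: q_pow_def)
  hence "Psi \<tau> = S / q_pow (1/8) \<tau>"
    unfolding Psi_def by (rule sums_unique[symmetric])
  ultimately show "theta2 \<tau> = 2 * (q_pow (1/8) \<tau> * Psi \<tau>)"
    by (simp add: q_pow_def)
  show "summable (\<lambda>n. q_pow (real n * (real n + 1) / 2) \<tau>)"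
    using sums by (rule sums_summable)
qed

section \<open>Expansions at the cusps\<close>

lemma q_pow_power: "q_pow (real n / real w) \<tau> = q_pow (1 / real w) \<tau> ^ n"
  by (simp add: q_pow_def exp_of_nat_mult[symmetric] mult_ac)

lemma holomorphic_at_i_infinityI:
  assumes "w > 0" "\<And>\<tau>. Im \<tau> > 0 \<Longrightarrow> (\<lambda>n. a n * q_pow (real n / real w) \<tau>) sums g \<tau>"
  shows "holomorphic_at_i_infinity g"
  unfolding holomorphic_at_i_infinity_def
  by (rule exI[of _ w], rule conjI, rule assms(1), rule exI[of _ a], rule ballI, rule assms(2)) simp

lemma holomorphic_at_i_infinity_cong:
  assumes "\<And>\<tau>. Im \<tau> > 0 \<Longrightarrow> f \<tau> = g \<tau>"
  shows "holomorphic_at_i_infinity f \<longleftrightarrow> holomorphic_at_i_infinity g"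
  using assms unfolding holomorphic_at_i_infinity_def by simp

lemma holomorphic_at_i_infinity_cmult:
  assumes "holomorphic_at_i_infinity g"
  shows "holomorphic_at_i_infinity (\<lambda>\<tau>. C * g \<tau>)"
proof -
  obtain w a where w: "w > 0" and a: "\<And>\<tau>. Im \<tau> > 0 \<Longrightarrow> (\<lambda>n. a n * q_pow (real n / real w) \<tau>) sums g \<tau>"
    using assms unfolding holomorphic_at_i_infinity_def by blast
  have "(\<lambda>n. (C * a n) * q_pow (real n / real w) \<tau>) sums (C * g \<tau>)" if "Im \<tau> > 0" for \<tau>
    using sums_mult[OF a[OF that], of C] by (simp only: mult.assoc)
  thus ?thesis by (rule holomorphic_at_i_infinityI[OF w])
qed

text \<open>Inserting zero coefficients turns an expansion in q^(1/w) into one in q^(1/(e w)), so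
  that two widths can be made equal.\<close>

lemma sums_dilate:
  fixes a :: "nat \<Rightarrow> complex"
  assumes e: "e > 0" and s: "(\<lambda>n. a n * F (n * e)) sums S"
  shows "(\<lambda>n. (if e dvd n then a (n div e) else 0) * F n) sums S"
proof -
  have "strict_mono (\<lambda>n. n * e)" using e by (simp add: strict_mono_def)
  moreover have "(if e dvd n then a (n div e) else 0) * F n = 0" if "n \<notin> range (\<lambda>n. n * e)" for n
  proof -
    have "\<not> e dvd n"
    proof
      assume "e dvd n"
      hence "n = n div e * e" by simp
      thus False using that by (metis rangeI)
    qed
    thus ?thesis by simp
  qed
  ultimately have "(\<lambda>n. (if e dvd n * e then a (n * e div e) else 0) * F (n * e)) sums S
      \<longleftrightarrow> (\<lambda>n. (if e dvd n then a (n div e) else 0) * F n) sums S"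
    by (rule sums_mono_reindex)
  thus ?thesis using s e by simp
qed

lemma holomorphic_at_i_infinity_mult:
  assumes "holomorphic_at_i_infinity f" "holomorphic_at_i_infinity g"
  shows "holomorphic_at_i_infinity (\<lambda>\<tau>. f \<tau> * g \<tau>)"
proof -
  obtain v a where v: "v > 0" and a: "\<And>\<tau>. Im \<tau> > 0 \<Longrightarrow> (\<lambda>n. a n * q_pow (real n / real v) \<tau>) sums f \<tau>"
    using assms(1) unfolding holomorphic_at_i_infinity_def by blast
  obtain w b where w: "w > 0" and b: "\<And>\<tau>. Im \<tau> > 0 \<Longrightarrow> (\<lambda>n. b n * q_pow (real n / real w) \<tau>) sums g \<tau>"
    using assms(2) unfolding holomorphic_at_i_infinity_def by blast
  define a' where "a' = (\<lambda>n. if w dvd n then a (n div w) else 0)"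
  define b' where "b' = (\<lambda>n. if v dvd n then b (n div v) else 0)"
  let ?z = "\<lambda>\<tau>. q_pow (1 / real (v * w)) \<tau>"
  have a': "(\<lambda>n. a' n * ?z \<tau> ^ n) sums f \<tau>" if "Im \<tau> > 0" for \<tau>
    unfolding a'_def q_pow_power[symmetric]
  proof (rule sums_dilate[OF w])
    show "(\<lambda>n. a n * q_pow (real (n * w) / real (v * w)) \<tau>) sums f \<tau>"
      using a[OF that] w by simp
  qed
  have b': "(\<lambda>n. b' n * ?z \<tau> ^ n) sums g \<tau>" if "Im \<tau> > 0" for \<tau>
    unfolding b'_def q_pow_power[symmetric]
  proof (rule sums_dilate[OF v])
    show "(\<lambda>n. b n * q_pow (real (n * v) / real (v * w)) \<tau>) sums g \<tau>"
      using b[OF that] v by (simp add: mult.commute)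
  qed
  have abs_summable: "summable (\<lambda>n. norm (x n * ?z \<tau> ^ n))"
    if x: "\<And>\<tau>. Im \<tau> > 0 \<Longrightarrow> summable (\<lambda>n. x n * ?z \<tau> ^ n)" and \<tau>: "Im \<tau> > 0" for x \<tau>
  proof (rule powser_insidea)
    \<comment> \<open>At \<tau>/2 the variable has larger modulus, so convergence there gives
      absolute convergence at \<tau>, as the Cauchy product requires.\<close>
    show "summable (\<lambda>n. x n * ?z (\<tau> / 2) ^ n)" using \<tau> by (intro x) simp
    show "norm (?z \<tau>) < norm (?z (\<tau> / 2))"
      using \<tau> v w by (simp add: q_pow_def norm_exp_eq_Re field_simps)
  qed
  have "(\<lambda>n. (\<Sum>i\<le>n. a' i * b' (n - i)) * q_pow (real n / real (v * w)) \<tau>) sums (f \<tau> * g \<tau>)" if \<tau>: "Im \<tau> > 0" for \<tau>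
  proof -
    have "(\<lambda>n. \<Sum>i\<le>n. (a' i * ?z \<tau> ^ i) * (b' (n - i) * ?z \<tau> ^ (n - i))) sums
        ((\<Sum>n. a' n * ?z \<tau> ^ n) * (\<Sum>n. b' n * ?z \<tau> ^ n))"
      by (rule Cauchy_product_sums[OF abs_summable[OF _ \<tau>] abs_summable[OF _ \<tau>]])
         (rule sums_summable[OF a'] sums_summable[OF b'], assumption)+
    also have "(\<Sum>n. a' n * ?z \<tau> ^ n) = f \<tau>" using a'[OF \<tau>] by (rule sums_unique[symmetric])
    also have "(\<Sum>n. b' n * ?z \<tau> ^ n) = g \<tau>" using b'[OF \<tau>] by (rule sums_unique[symmetric])
    also have "(\<lambda>n. \<Sum>i\<le>n. (a' i * ?z \<tau> ^ i) * (b' (n - i) * ?z \<tau> ^ (n - i)))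
        = (\<lambda>n. (\<Sum>i\<le>n. a' i * b' (n - i)) * ?z \<tau> ^ n)"
    proof
      fix n
      show "(\<Sum>i\<le>n. (a' i * ?z \<tau> ^ i) * (b' (n - i) * ?z \<tau> ^ (n - i))) = (\<Sum>i\<le>n. a' i * b' (n - i)) * ?z \<tau> ^ n"
        unfolding sum_distrib_right
      proof (rule sum.cong[OF refl])
        fix i assume "i \<in> {..n}"
        hence "?z \<tau> ^ n = ?z \<tau> ^ i * ?z \<tau> ^ (n - i)" by (simp add: power_add[symmetric])
        thus "(a' i * ?z \<tau> ^ i) * (b' (n - i) * ?z \<tau> ^ (n - i)) = a' i * b' (n - i) * ?z \<tau> ^ n"
          by (simp only: mult_ac)
      qed
    qed
    finally show ?thesis by (simp only: q_pow_power)
  qed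
  thus ?thesis using v w by (intro holomorphic_at_i_infinityI[of "v * w"]) simp_all
qed

lemma holomorphic_at_i_infinity_1: "holomorphic_at_i_infinity (\<lambda>_. 1)"
proof -
  have *: "(\<lambda>n. (if n = 0 then 1 else 0) * q_pow (real n / real 1) \<tau>) sums 1" for \<tau>
  proof -
    have "(if n = 0 then 1 else 0) * q_pow (real n / real 1) \<tau> = (if n = 0 then 1 else 0)" for n
      by (simp add: q_pow_def)
    thus ?thesis using sums_single[of 0 "\<lambda>_. 1::complex"] by (simp only:)
  qed
  show ?thesis by (rule holomorphic_at_i_infinityI[OF _ *]) simp
qed

lemma holomorphic_at_i_infinity_prod:
  assumes "finite I" "\<And>i. i \<in> I \<Longrightarrow> holomorphic_at_i_infinity (f i)"
  shows "holomorphic_at_i_infinity (\<lambda>\<tau>. \<Prod>i\<in>I. f i \<tau>)"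
  using assms
  by (induction I rule: finite_induct) (simp_all add: holomorphic_at_i_infinity_1 holomorphic_at_i_infinity_mult)

lemma holomorphic_at_i_infinity_Theta:
  assumes \<psi>: "bounded (range \<psi>)" and m: "m > 0" and e: "e > 0"
  shows "holomorphic_at_i_infinity (\<lambda>\<tau>. Theta \<psi> (of_nat e * \<tau> / of_nat m))"
proof -
  define a where "a = (\<lambda>N. \<Sum>n | n\<^sup>2 = int N. \<psi> n)"
  have "(\<lambda>n. (if e dvd n then a (n div e) else 0) * q_pow (real n / real (2 * m)) \<tau>) sums Theta \<psi> (of_nat e * \<tau> / of_nat m)"
    if \<tau>: "Im \<tau> > 0" for \<tau>
  proof (rule sums_dilate[OF e])
    have "Im (of_nat e * \<tau> / of_nat m) = real e * Im \<tau> / real m"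
      using m by (simp add: Im_divide power2_eq_square)
    hence "Im (of_nat e * \<tau> / of_nat m) > 0" using \<tau> m e by simp
    from Theta_sums[OF \<psi> this]
    have "(\<lambda>N. a N * exp (of_real pi * \<i> * (of_nat e * \<tau> / of_nat m)) ^ N) sums Theta \<psi> (of_nat e * \<tau> / of_nat m)"
      by (simp only: a_def)
    moreover have "exp (of_real pi * \<i> * (of_nat e * \<tau> / of_nat m)) ^ N = q_pow (real (N * e) / real (2 * m)) \<tau>" for N
      by (simp add: q_pow_def exp_of_nat_mult[symmetric] mult_ac)
    ultimately show "(\<lambda>N. a N * q_pow (real (N * e) / real (2 * m)) \<tau>) sums Theta \<psi> (of_nat e * \<tau> / of_nat m)"
      by (simp only:)
  qed
  thus ?thesis using m by (intro holomorphic_at_i_infinityI[of "2 * m"]) simp_all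
qed

text \<open>Here the expansion is around a/c: C(a\<tau> + b)/(c\<tau> + d) = C a/c - C/(c(c\<tau> +
  d)), and inversion turns the second part into a positive multiple of \<tau> plus a real number.
  What remains is a theta series in \<tau> with bounded coefficients, hence with nonnegative
  exponents only.\<close>

lemma theta2_at_cusp:
  fixes a b c d :: int
  assumes c: "c > 0" and det: "a * d - b * c = 1" and C: "C > 0"
  shows "\<exists>\<kappa> \<psi>. \<kappa> \<noteq> 0 \<and> bounded (range \<psi>) \<and>
    (\<forall>\<tau>. Im \<tau> > 0 \<longrightarrow> \<kappa> * csqrt (\<i> / (of_int c * \<tau> + of_int d))
        * theta2 (of_nat C * ((of_int a * \<tau> + of_int b) / (of_int c * \<tau> + of_int d))) = Theta \<psi> (\<tau> / of_nat (16 * C)))"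
proof -
  \<comment> \<open>8c is a period of the phase e(C a n^2/(8c)), and being even it also preserves
    \<open>odd_ind\<close>.\<close>
  define M where "M = nat (8 * c)"
  have M: "int M = 8 * c" "M > 0" using c by (auto simp: M_def)
  have Mc: "of_nat M = 8 * complex_of_int c" 
  proof -
    have "complex_of_int (int M) = of_int (8 * c)" by (simp only: M(1))
    thus ?thesis by simp
  qed
  define \<phi> where "\<phi> = (\<lambda>n. odd_ind n * ecis (of_int (n\<^sup>2) * (of_nat C * of_int a / (4 * of_int c)) / 2))"
  define \<psi> where "\<psi> = (\<lambda>m. dft M \<phi> m * ecis (of_int (m\<^sup>2) * (of_int d / (16 * of_int c * of_nat C)) / 2))"
  define \<kappa> where "\<kappa> = of_nat M * complex_of_real (sqrt (of_nat C / (4 * of_int c)))"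
  have per: "\<phi> (n + int M) = \<phi> n" for n
  proof -
    have "real_of_int ((n + int M)\<^sup>2) * (of_nat C * of_int a / (4 * of_int c)) / 2 - of_int (n\<^sup>2) * (of_nat C * of_int a / (4 * of_int c)) / 2
       = of_int (int C * a * (2 * n + 8 * c))"
      using c by (simp add: M(1) power2_eq_square field_simps)
    hence "ecis (of_int ((n + int M)\<^sup>2) * (of_nat C * of_int a / (4 * of_int c)) / 2) = ecis (of_int (n\<^sup>2) * (of_nat C * of_int a / (4 * of_int c)) / 2)"
      by (intro ecis_eq_if_diff_Ints) (simp only: Ints_of_int)
    thus ?thesis by (simp add: \<phi>_def odd_ind_def M(1))
  qed
  have bounded_\<psi>: "bounded (range \<psi>)"
  proof -
    obtain B where B: "\<And>m. norm (dft M \<phi> m) \<le> B"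
      using bounded_dft[of M \<phi>] by (auto simp: bounded_iff)
    show ?thesis
      by (rule boundedI[of _ B]) (auto simp: \<psi>_def norm_mult B)
  qed
  have \<kappa>: "\<kappa> \<noteq> 0" using M(2) c C by (simp add: \<kappa>_def)
  have eq: "\<kappa> * csqrt (\<i> / (of_int c * \<tau> + of_int d))
        * theta2 (of_nat C * ((of_int a * \<tau> + of_int b) / (of_int c * \<tau> + of_int d))) = Theta \<psi> (\<tau> / of_nat (16 * C))"
    if \<tau>: "Im \<tau> > 0" for \<tau>
  proof -
    let ?j = "of_int c * \<tau> + of_int d"
    have nz: "?j \<noteq> 0"
      using linear_nonzero_upper_half_plane[OF \<tau>, of "of_int c" "of_int d"] c by simp
    define w where "w = - of_nat C / (4 * of_int c * ?j)"
    have Imw: "Im w > 0"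
    proof -
      have "w = (of_real 0 * \<tau> + of_real (- real C)) / (of_real (4 * of_int c * of_int c) * \<tau> + of_real (4 * of_int c * of_int d))"
        by (simp add: w_def algebra_simps)
      also have "Im \<dots> = (0 * (4 * of_int c * of_int d) - (- real C) * (4 * of_int c * of_int c)) * Im \<tau> /
          (norm (of_real (4 * of_int c * of_int c) * \<tau> + of_real (4 * of_int c * of_int d)))\<^sup>2"
        by (rule Im_moebius_real)
      also have "\<dots> > 0"
        using c C \<tau> linear_nonzero_upper_half_plane[OF \<tau>, of "4 * of_int c * of_int c" "4 * of_int c * of_int d"]
        by (intro divide_pos_pos) (auto simp del: of_real_mult)
      finally show ?thesis .
    qed
    have arg: "of_nat C * ((of_int a * \<tau> + of_int b) / ?j) / 4 = w + of_real (of_nat C * of_int a / (4 * of_int c))"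
    proof -
      have "of_int (a * d - b * c) = (1::complex)" by (simp only: det of_int_1)
      hence "of_int a * of_int d - of_int b * of_int c = (1::complex)" by simp
      hence "(of_int a * \<tau> + of_int b) * of_int c = of_int a * ?j - 1" by (simp add: algebra_simps)
      hence "of_int a * \<tau> + of_int b = (of_int a * ?j - 1) / of_int c" using c by (simp add: field_simps)
      hence "(of_int a * \<tau> + of_int b) / ?j = of_int a / of_int c - 1 / (of_int c * ?j)"
        using nz c by (simp add: diff_divide_distrib)
      moreover have "x * (y / z - 1 / (z * J)) / 4 = - x / (4 * z * J) + x * y / (4 * z)" for x y z J :: complex
        by (simp add: right_diff_distrib diff_divide_distrib mult_ac)
      ultimately show ?thesis by (simp only: w_def) simp
    qed
    have sq: "csqrt (- \<i> * w) = of_real (sqrt (of_nat C / (4 * of_int c))) * csqrt (\<i> / ?j)"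
    proof -
      have "- \<i> * w = of_real (of_nat C / (4 * of_int c)) * (\<i> / ?j)" by (simp add: w_def)
      moreover have "of_nat C / (4 * of_int c) \<ge> (0::real)" using c by simp
      ultimately show ?thesis by (simp only: csqrt_of_real_mult)
    qed
    have "\<kappa> * csqrt (\<i> / ?j) * theta2 (of_nat C * ((of_int a * \<tau> + of_int b) / ?j))
        = of_nat M * csqrt (- \<i> * w) * Theta \<phi> w"
      unfolding theta2_def arg Theta_add_real sq \<kappa>_def \<phi>_def by (simp only: mult.assoc)
    also have "\<dots> = Theta (dft M \<phi>) (- 1 / (of_nat M ^ 2 * w))"
      by (rule Theta_inversion[of M \<phi>, OF M(2) per Imw])
    also have "- 1 / (of_nat M ^ 2 * w) = \<tau> / of_nat (16 * C) + of_real (of_int d / (16 * of_int c * of_nat C))"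
      unfolding Mc using nz c C by (simp add: w_def field_simps power2_eq_square)
    also have "Theta (dft M \<phi>) (\<tau> / of_nat (16 * C) + of_real (of_int d / (16 * of_int c * of_nat C))) = Theta \<psi> (\<tau> / of_nat (16 * C))"
      unfolding Theta_add_real \<psi>_def by (simp only:)
    finally show ?thesis .
  qed
  show ?thesis
    by (rule exI[of _ \<kappa>], rule exI[of _ \<psi>]) (use \<kappa> bounded_\<psi> eq in blast)
qed

section \<open>The product of the theta series\<close>

lemma prod_q_pow: "finite I \<Longrightarrow> (\<Prod>i\<in>I. q_pow x (of_nat (c i) * \<tau>)) = q_pow (x * real (\<Sum>i\<in>I. c i)) \<tau>"
  unfolding q_pow_def by (subst exp_sum[symmetric]) (simp_all add: sum_distrib_left sum_distrib_right mult_ac)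

lemma Psi_C_eq_prod_theta2:
  assumes \<tau>: "Im \<tau> > 0" and c: "\<And>i. i \<in> {1..k} \<Longrightarrow> c i > 0"
  shows "q_pow (real (\<Sum>i=1..k. c i) / 8) \<tau> * Psi_C k c \<tau> = (1/2) ^ k * (\<Prod>i=1..k. theta2 (of_nat (c i) * \<tau>))"
proof -
  have "(\<Prod>i=1..k. theta2 (of_nat (c i) * \<tau>)) = (\<Prod>i=1..k. 2 * (q_pow (1/8) (of_nat (c i) * \<tau>) * Psi (of_nat (c i) * \<tau>)))"
  proof (rule prod.cong[OF refl])
    fix i assume "i \<in> {1..k}"
    hence "Im (of_nat (c i) * \<tau>) > 0" using c \<tau> by simp
    thus "theta2 (of_nat (c i) * \<tau>) = 2 * (q_pow (1/8) (of_nat (c i) * \<tau>) * Psi (of_nat (c i) * \<tau>))"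
      by (rule theta2_eq_Psi(1))
  qed
  also have "\<dots> = 2 ^ k * (q_pow (1 / 8 * real (\<Sum>i=1..k. c i)) \<tau> * Psi_C k c \<tau>)"
    by (simp only: prod.distrib prod_q_pow finite_atLeastAtMost prod_constant card_atLeastAtMost Psi_C_def) simp
  finally show ?thesis by (simp add: power_divide)
qed

lemma Psi_add_int:
  "Psi (of_nat c * (\<tau> + 1)) = Psi (of_nat c * \<tau>)"
proof -
  have "q_pow (real n * (real n + 1) / 2) (of_nat c * (\<tau> + 1)) = q_pow (real n * (real n + 1) / 2) (of_nat c * \<tau>)" for n
  proof -
    have "even (n * (n + 1))" by simp
    then obtain j where j: "n * (n + 1) = 2 * j" by blast
    have "real n * (real n + 1) = real (n * (n + 1))" by (simp add: algebra_simps)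
    hence r: "real n * (real n + 1) / 2 = real j" by (simp only: j)
    have "q_pow (real j) (of_nat c * (\<tau> + 1)) = q_pow (real j) (of_nat c * \<tau>) * ecis (real (j * c))"
      by (simp add: q_pow_def ecis_conv_exp exp_add[symmetric] algebra_simps)
    thus ?thesis unfolding r by (simp only: ecis_of_nat mult_1_right)
  qed
  thus ?thesis by (simp only: Psi_def)
qed

lemma Psi_C_add_1:
  "q_pow (real h / 8) (\<tau> + 1) * Psi_C k c (\<tau> + 1) = ecis (real h / 8) * (q_pow (real h / 8) \<tau> * Psi_C k c \<tau>)"
proof -
  have "q_pow (real h / 8) (\<tau> + 1) = ecis (real h / 8) * q_pow (real h / 8) \<tau>"
    by (simp add: q_pow_def ecis_conv_exp exp_add[symmetric] algebra_simps add_divide_distrib)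
  thus ?thesis by (simp add: Psi_C_def Psi_add_int)
qed

text \<open>On the imaginary axis all terms are positive. A point where the function does not vanish
  is what allows multipliers to be compared.\<close>

lemma Psi_imaginary_nonzero:
  assumes y: "y > 0"
  shows "Psi (\<i> * of_real y) \<noteq> 0"
proof -
  define f where "f = (\<lambda>n. exp (- 2 * pi * (real n * (real n + 1) / 2) * y))"
  have eq: "q_pow (real n * (real n + 1) / 2) (\<i> * of_real y) = of_real (f n)" for n
  proof -
    have "2 * of_real pi * \<i> * of_real (real n * (real n + 1) / 2) * (\<i> * of_real y) = of_real (- 2 * pi * (real n * (real n + 1) / 2) * y)"
      by (simp add: mult_ac)
    thus ?thesis by (simp only: q_pow_def f_def exp_of_real)
  qed
  have "summable (\<lambda>n. complex_of_real (f n))"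
    using theta2_eq_Psi(2)[of "\<i> * of_real y"] y by (simp only: eq) simp
  hence sf: "summable f" by (simp only: summable_of_real_iff)
  have "Psi (\<i> * of_real y) = of_real (\<Sum>n. f n)"
    unfolding Psi_def eq using sf by (rule suminf_of_real[symmetric])
  moreover have "(\<Sum>n. f n) > 0"
    using sf by (rule suminf_pos) (simp add: f_def)
  ultimately show ?thesis by simp
qed

text \<open>The roots enter with exponent 2l, hence only through X^2 = D(-i\<tau>)/j and Y^2 =
  -i\<tau>, where j = c\<tau> + D. The quotient (Y^2/X^2)^l is j^l/D^l, and D^l cancels against the
  Gauss sums.\<close>

lemma prod_theta2_transform:
  fixes a b c :: int and C :: "'i \<Rightarrow> nat"
  assumes D: "odd D" and I: "finite I" "card I = 2 * l" and C: "\<And>i. i \<in> I \<Longrightarrow> C i > 0"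
    and c: "\<And>i. i \<in> I \<Longrightarrow> int (2 * C i) dvd c" and det: "a * int D - b * c = 1" and \<tau>: "Im \<tau> > 0"
    and h: "8 dvd (\<Sum>i\<in>I. C i)"
  shows "(\<Prod>i\<in>I. theta2 (of_nat (C i) * ((of_int a * \<tau> + of_int b) / (of_int c * \<tau> + of_nat D))))
           = of_int (kronecker ((-1) ^ l * (\<Prod>i\<in>I. int (C i))) (int D)) * (of_int c * \<tau> + of_nat D) ^ l
              * (\<Prod>i\<in>I. theta2 (of_nat (C i) * \<tau>))"
proof -
  have D0: "D > 0" using D by (cases D) auto
  let ?j = "of_int c * \<tau> + of_nat D"
  have nz: "?j \<noteq> 0"
    using linear_nonzero_upper_half_plane[OF \<tau>, of "of_int c" "of_nat D"] D0 by simp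
  have \<tau>0: "\<tau> \<noteq> 0" using \<tau> by auto
  define w where "w = \<tau> / (4 * of_nat D * ?j)"
  define X where "X = of_nat (2 * D) * csqrt (- \<i> * w)"
  define Y where "Y = 2 * csqrt (- \<i> * (\<tau> / 4))"
  define P where "P = (\<Prod>i\<in>I. theta2 (of_nat (C i) * ((of_int a * \<tau> + of_int b) / ?j)))"
  define Q where "Q = (\<Prod>i\<in>I. theta2 (of_nat (C i) * \<tau>))"
  define K where "K = complex_of_int (kronecker ((-1) ^ l * (\<Prod>i\<in>I. int (C i))) (int D))"
  have cop_bD: "coprime (2 * b) (int D)"
  proof -
    have "coprime b (int D)"
    proof (rule coprimeI)
      fix x assume "x dvd b" "x dvd int D"
      hence "x dvd a * int D - b * c" by simp
      thus "is_unit x" by (simp add: det)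
    qed
    thus ?thesis using D by simp
  qed
  have cop_C: "coprime (int (C i)) (int D)" if "i \<in> I" for i
  proof (rule coprimeI)
    fix x assume x: "x dvd int (C i)" "x dvd int D"
    have "int (C i) dvd c" using c[OF that] by (metis dvd_mult_right of_nat_mult)
    hence "x dvd c" using x(1) by (rule dvd_trans[rotated])
    hence "x dvd a * int D - b * c" using x(2) by simp
    thus "is_unit x" by (simp add: det)
  qed
  have "X ^ card I * P = (\<Prod>i\<in>I. X * theta2 (of_nat (C i) * ((of_int a * \<tau> + of_int b) / ?j)))"
    by (simp only: prod.distrib prod_constant P_def)
  also have "\<dots> = (\<Prod>i\<in>I. (ecis (of_int (b * int (C i)) * of_nat D / 8) * gauss_sum (2 * (b * int (C i))) D) * (Y * theta2 (of_nat (C i) * \<tau>)))"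
    unfolding X_def Y_def w_def
    by (rule prod.cong[OF refl], rule theta2_transform_scaled[OF D c C det \<tau>])
  also have "\<dots> = (\<Prod>i\<in>I. ecis (of_int (b * int (C i)) * of_nat D / 8)) * (\<Prod>i\<in>I. gauss_sum ((2 * b) * int (C i)) D) * (Y ^ card I * Q)"
    by (simp only: prod.distrib prod_constant Q_def mult.assoc)
  \<comment> \<open>The phases multiply to e(b D h/8), where h is the sum of the \<open>C i\<close>;
    this is 1 since 8 divides h.\<close>
  also have "(\<Prod>i\<in>I. ecis (of_int (b * int (C i)) * of_nat D / 8)) = 1"
  proof -
    have "(\<Prod>i\<in>I. ecis (of_int (b * int (C i)) * of_nat D / 8)) = ecis (\<Sum>i\<in>I. of_int (b * int (C i)) * of_nat D / 8)"
      using I(1) by (induction I rule: finite_induct) (simp_all add: ecis_add)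
    also have "(\<Sum>i\<in>I. of_int (b * int (C i)) * of_nat D / 8) = of_int b * of_nat D * real (\<Sum>i\<in>I. C i) / 8"
      by (simp add: sum_distrib_left sum_distrib_right sum_divide_distrib mult_ac)
    also obtain j where j: "(\<Sum>i\<in>I. C i) = 8 * j" using h by blast
    have "of_int b * of_nat D * real (\<Sum>i\<in>I. C i) / 8 = of_int (b * int D * int j)"
      by (simp only: j) simp
    finally show ?thesis by (simp only: ecis_of_int)
  qed
  also have "(\<Prod>i\<in>I. gauss_sum ((2 * b) * int (C i)) D) = K * of_nat D ^ l"
    unfolding K_def using cop_C by (intro prod_gauss_sum D I cop_bD)
  finally have eq: "X ^ (2 * l) * P = K * of_nat D ^ l * (Y ^ (2 * l) * Q)"
    by (simp only: I(2) mult_1_left)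
  have X2: "X ^ (2 * l) = (of_nat D * (- \<i> * \<tau>) / ?j) ^ l"
  proof -
    have "X ^ 2 = of_nat D * (- \<i> * \<tau>) / ?j"
      unfolding X_def power_mult_distrib power2_csqrt w_def using D0 nz
      by (simp add: power2_eq_square)
    thus ?thesis by (simp only: power_mult)
  qed
  have Y2: "Y ^ (2 * l) = (- \<i> * \<tau>) ^ l"
  proof -
    have "Y ^ 2 = - \<i> * \<tau>" by (simp add: Y_def power_mult_distrib)
    thus ?thesis by (simp only: power_mult)
  qed
  have "(of_nat D ^ l * (- \<i> * \<tau>) ^ l) * P = (of_nat D ^ l * (- \<i> * \<tau>) ^ l) * (K * ?j ^ l * Q)"
  proof -
    have "(of_nat D ^ l * (- \<i> * \<tau>) ^ l) * P = ?j ^ l * (X ^ (2 * l) * P)"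
    proof -
      have "?j ^ l * (of_nat D * (- \<i> * \<tau>) / ?j) ^ l = (?j * (of_nat D * (- \<i> * \<tau>) / ?j)) ^ l"
        by (rule power_mult_distrib[symmetric])
      also have "?j * (of_nat D * (- \<i> * \<tau>) / ?j) = of_nat D * (- \<i> * \<tau>)" using nz by simp
      finally show ?thesis unfolding X2 by (simp only: power_mult_distrib mult.assoc[symmetric])
    qed
    also have "\<dots> = (of_nat D ^ l * (- \<i> * \<tau>) ^ l) * (K * ?j ^ l * Q)"
      unfolding eq Y2 by (simp only: mult_ac)
    finally show ?thesis .
  qed
  moreover have "of_nat D ^ l * (- \<i> * \<tau>) ^ l \<noteq> 0" using D0 \<tau>0 by simp
  ultimately have "P = K * ?j ^ l * Q" by (simp only: mult_cancel_left simp_thms)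
  thus ?thesis by (simp only: P_def K_def Q_def)
qed

abbreviation m11 :: "int^2^2 \<Rightarrow> int" where "m11 A \<equiv> A$1$1"
abbreviation m12 :: "int^2^2 \<Rightarrow> int" where "m12 A \<equiv> A$1$2"
abbreviation m21 :: "int^2^2 \<Rightarrow> int" where "m21 A \<equiv> A$2$1"
abbreviation m22 :: "int^2^2 \<Rightarrow> int" where "m22 A \<equiv> A$2$2"

section \<open>Modularity\<close>

definition mat2 :: "int \<Rightarrow> int \<Rightarrow> int \<Rightarrow> int \<Rightarrow> int^2^2" where
  "mat2 a b c d = vector [vector [a, b], vector [c, d]]"

lemma mat2_nth [simp]:
  "m11 (mat2 a b c d) = a" "m12 (mat2 a b c d) = b" "m21 (mat2 a b c d) = c" "m22 (mat2 a b c d) = d"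
  by (simp_all add: mat2_def)

lemma mat2_in_Gamma0: "mat2 a b c d \<in> Gamma0 N \<longleftrightarrow> a * d - b * c = 1 \<and> int N dvd c"
  by (simp add: Gamma0_def SL2Z_def det_2)

lemma automorphy_factor_nonzero:
  assumes "A \<in> SL2Z" "Im \<tau> > 0"
  shows "automorphy_factor A \<tau> \<noteq> 0"
proof -
  have "m21 A \<noteq> 0 \<or> m22 A \<noteq> 0" using assms(1) by (auto simp: SL2Z_def det_2)
  thus ?thesis
    using linear_nonzero_upper_half_plane[OF assms(2), of "of_int (m21 A)" "of_int (m22 A)"]
    by (simp add: automorphy_factor_def)
qed

lemma Im_moebius_pos:
  assumes "A \<in> SL2Z" "Im \<tau> > 0"
  shows "Im (moebius A \<tau>) > 0"
proof -
  have det: "m11 A * m22 A - m12 A * m21 A = 1" using assms(1) by (simp add: SL2Z_def det_2)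
  have "real_of_int (m11 A * m22 A - m12 A * m21 A) = 1" by (simp only: det of_int_1)
  hence det': "real_of_int (m11 A) * of_int (m22 A) - of_int (m12 A) * of_int (m21 A) = 1"
    by (simp only: of_int_diff of_int_mult)
  have "Im (moebius A \<tau>) = Im \<tau> / (norm (automorphy_factor A \<tau>))\<^sup>2"
    using Im_moebius_real[of "of_int (m11 A)" \<tau> "of_int (m12 A)" "of_int (m21 A)" "of_int (m22 A)"]
    unfolding moebius_def automorphy_factor_def det' by (simp only: of_real_of_int_eq mult_1_left)
  thus ?thesis using automorphy_factor_nonzero[OF assms] assms(2) by simp
qed

lemma uminus_SL2Z: "A \<in> SL2Z \<Longrightarrow> - A \<in> SL2Z"
  by (simp add: SL2Z_def det_2)

lemma slash_uminus: "slash (int l) f (- A) \<tau> = (-1) ^ l * slash (int l) f A \<tau>"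
proof -
  have 1: "automorphy_factor (- A) \<tau> = - automorphy_factor A \<tau>"
    by (simp add: automorphy_factor_def)
  have "moebius (- A) \<tau> = (- (of_int (m11 A) * \<tau> + of_int (m12 A))) / (- automorphy_factor A \<tau>)"
    unfolding moebius_def 1 by simp
  hence 2: "moebius (- A) \<tau> = moebius A \<tau>" by (simp only: minus_divide_divide moebius_def)
  have "(- x) powi (- int l) = (-1) ^ l * x powi (- int l)" for x :: complex
    by (simp add: power_int_minus power_minus[of x] inverse_mult_distrib) (cases "even l"; simp)
  thus ?thesis unfolding slash_def 1 2 by (simp only: mult.assoc)
qed

text \<open>The sign normalization makes the case c = 0 a pure translation, while c > 0 is what
  \<open>theta2_at_cusp\<close> assumes.\<close>

lemma holomorphic_at_i_infinity_prod_theta2_pos: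
  assumes I: "finite I" "card I = 2 * l" and C: "\<And>i. i \<in> I \<Longrightarrow> C i > 0"
    and A: "A \<in> SL2Z" and pos: "m21 A > 0 \<or> m21 A = 0 \<and> m22 A > 0"
  shows "holomorphic_at_i_infinity (slash (int l) (\<lambda>\<tau>. \<Prod>i\<in>I. theta2 (of_nat (C i) * \<tau>)) A)"
proof -
  define a b c d where "a = m11 A" "b = m12 A" "c = m21 A" "d = m22 A"
  note abcd = a_b_c_d_def
  have det: "a * d - b * c = 1" using A by (simp add: SL2Z_def det_2 abcd)
  have slash_eq: "slash (int l) (\<lambda>\<tau>. \<Prod>i\<in>I. theta2 (of_nat (C i) * \<tau>)) A \<tau>
     = inverse ((of_int c * \<tau> + of_int d) ^ l) * (\<Prod>i\<in>I. theta2 (of_nat (C i) * ((of_int a * \<tau> + of_int b) / (of_int c * \<tau> + of_int d))))" for \<tau>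
    by (simp add: slash_def moebius_def automorphy_factor_def power_int_minus abcd)
  show ?thesis
  proof (cases "c > 0")
    case True
    have "\<exists>\<kappa> \<psi>. \<kappa> \<noteq> 0 \<and> bounded (range \<psi>) \<and>
      (\<forall>\<tau>. Im \<tau> > 0 \<longrightarrow> \<kappa> * csqrt (\<i> / (of_int c * \<tau> + of_int d))
        * theta2 (of_nat (C i) * ((of_int a * \<tau> + of_int b) / (of_int c * \<tau> + of_int d))) = Theta \<psi> (\<tau> / of_nat (16 * C i)))"
      if iI: "i \<in> I" for i
      by (rule theta2_at_cusp[OF True det C[OF iI]])
    then obtain \<kappa> \<psi> where \<kappa>: "\<And>i. i \<in> I \<Longrightarrow> \<kappa> i \<noteq> 0" and \<psi>: "\<And>i. i \<in> I \<Longrightarrow> bounded (range (\<psi> i))"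
      and eq: "\<And>i \<tau>. i \<in> I \<Longrightarrow> Im \<tau> > 0 \<Longrightarrow> \<kappa> i * csqrt (\<i> / (of_int c * \<tau> + of_int d))
        * theta2 (of_nat (C i) * ((of_int a * \<tau> + of_int b) / (of_int c * \<tau> + of_int d))) = Theta (\<psi> i) (\<tau> / of_nat (16 * C i))"
      by metis
    \<comment> \<open>With j = c\<tau> + d, the 2l-th power of csqrt(i/j) is i^l j^(-l): the roots
      supply precisely the automorphy factor of weight l, and i^l joins the constant.\<close>
    define K where "K = \<i> ^ l * (\<Prod>i\<in>I. \<kappa> i)"
    have K: "K \<noteq> 0" using \<kappa> I(1) by (simp add: K_def)
    have "slash (int l) (\<lambda>\<tau>. \<Prod>i\<in>I. theta2 (of_nat (C i) * \<tau>)) A \<tau>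
       = inverse K * (\<Prod>i\<in>I. Theta (\<psi> i) (of_nat 1 * \<tau> / of_nat (16 * C i)))" if \<tau>: "Im \<tau> > 0" for \<tau>
    proof -
      let ?j = "of_int c * \<tau> + of_int d"
      let ?P = "\<Prod>i\<in>I. theta2 (of_nat (C i) * ((of_int a * \<tau> + of_int b) / ?j))"
      have "(\<Prod>i\<in>I. Theta (\<psi> i) (of_nat 1 * \<tau> / of_nat (16 * C i)))
          = (\<Prod>i\<in>I. \<kappa> i * csqrt (\<i> / ?j) * theta2 (of_nat (C i) * ((of_int a * \<tau> + of_int b) / ?j)))"
        by (rule prod.cong[OF refl]) (simp only: eq[OF _ \<tau>] of_nat_1 mult_1_left)
      also have "\<dots> = (\<Prod>i\<in>I. \<kappa> i) * csqrt (\<i> / ?j) ^ (2 * l) * ?P"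
        by (simp only: prod.distrib prod_constant I(2))
      also have "csqrt (\<i> / ?j) ^ (2 * l) = \<i> ^ l * inverse (?j ^ l)"
        by (simp only: power_mult power2_csqrt) (simp only: divide_inverse power_mult_distrib power_inverse)
      finally have "(\<Prod>i\<in>I. Theta (\<psi> i) (of_nat 1 * \<tau> / of_nat (16 * C i)))
          = K * (inverse (?j ^ l) * ?P)" by (simp only: K_def mult_ac)
      hence "inverse K * (\<Prod>i\<in>I. Theta (\<psi> i) (of_nat 1 * \<tau> / of_nat (16 * C i))) = inverse (?j ^ l) * ?P"
        by (simp only: mult.assoc[symmetric] left_inverse[OF K] mult_1_left)
      thus ?thesis unfolding slash_eq by (simp only:)
    qed
    moreover have "holomorphic_at_i_infinity (\<lambda>\<tau>. inverse K * (\<Prod>i\<in>I. Theta (\<psi> i) (of_nat 1 * \<tau> / of_nat (16 * C i))))"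
      using C by (intro holomorphic_at_i_infinity_cmult holomorphic_at_i_infinity_prod I holomorphic_at_i_infinity_Theta \<psi>) auto
    ultimately show ?thesis
      by (subst holomorphic_at_i_infinity_cong) auto
  next
    case False
    hence c0: "c = 0" and "d > 0" using pos by (auto simp: abcd)
    moreover have "a * d = 1" using det c0 by simp
    ultimately have d1: "d = 1" and a1: "a = 1" by (auto simp: zmult_eq_1_iff)
    define \<psi> where "\<psi> = (\<lambda>i n. odd_ind n * ecis (of_int (n\<^sup>2) * (of_nat (C i) * of_int b / 4) / 2))"
    have "bounded (range (\<psi> i))" for i
      by (rule boundedI[of _ 1]) (auto simp: \<psi>_def norm_mult odd_ind_def)
    hence "holomorphic_at_i_infinity (\<lambda>\<tau>. \<Prod>i\<in>I. Theta (\<psi> i) (of_nat (C i) * \<tau> / of_nat 4))"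
      using C by (intro holomorphic_at_i_infinity_prod I holomorphic_at_i_infinity_Theta) auto
    moreover have "slash (int l) (\<lambda>\<tau>. \<Prod>i\<in>I. theta2 (of_nat (C i) * \<tau>)) A \<tau>
       = (\<Prod>i\<in>I. Theta (\<psi> i) (of_nat (C i) * \<tau> / of_nat 4))" for \<tau>
    proof -
      have "theta2 (of_nat (C i) * (\<tau> + of_int b)) = Theta (\<psi> i) (of_nat (C i) * \<tau> / of_nat 4)" for i
      proof -
        have "of_nat (C i) * (\<tau> + of_int b) / 4 = of_nat (C i) * \<tau> / of_nat 4 + of_real (of_nat (C i) * of_int b / 4)"
          by (simp add: ring_distribs add_divide_distrib)
        thus ?thesis unfolding theta2_def \<psi>_def by (simp only: Theta_add_real)
      qed
      thus ?thesis unfolding slash_eq c0 d1 a1 by simp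
    qed
    ultimately show ?thesis
      by (subst holomorphic_at_i_infinity_cong) auto
  qed
qed

lemma holomorphic_at_i_infinity_prod_theta2:
  assumes I: "finite I" "card I = 2 * l" and C: "\<And>i. i \<in> I \<Longrightarrow> C i > 0" and A: "A \<in> SL2Z"
  shows "holomorphic_at_i_infinity (slash (int l) (\<lambda>\<tau>. \<Prod>i\<in>I. theta2 (of_nat (C i) * \<tau>)) A)"
proof (cases "m21 A > 0 \<or> m21 A = 0 \<and> m22 A > 0")
  case True
  show ?thesis by (rule holomorphic_at_i_infinity_prod_theta2_pos[OF I _ A True]) (rule C)
next
  case False
  let ?f = "\<lambda>\<tau>. \<Prod>i\<in>I. theta2 (of_nat (C i) * \<tau>)"
  have "m21 A \<noteq> 0 \<or> m22 A \<noteq> 0" using A by (auto simp: SL2Z_def det_2)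
  hence pos: "m21 (- A) > 0 \<or> m21 (- A) = 0 \<and> m22 (- A) > 0" using False by auto
  have "holomorphic_at_i_infinity (slash (int l) ?f (- A))"
    by (rule holomorphic_at_i_infinity_prod_theta2_pos[OF I _ uminus_SL2Z[OF A] pos]) (rule C)
  hence "holomorphic_at_i_infinity (\<lambda>\<tau>. (-1) ^ l * slash (int l) ?f (- A) \<tau>)"
    by (rule holomorphic_at_i_infinity_cmult)
  moreover have "(-1) ^ l * slash (int l) ?f (- A) \<tau> = slash (int l) ?f A \<tau>" for \<tau>
    unfolding slash_uminus by (simp add: mult.assoc[symmetric] power_add[symmetric] mult_2[symmetric])
  ultimately show ?thesis by simp
qed

theorem theorem1p1:
  fixes k :: nat and c :: "nat \<Rightarrow> nat" and h N cc :: nat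
  assumes "k \<ge> 2" and "even k"
    and "\<forall>i\<in>{1..k}. c i > 0" and "mono_on {1..k} c"
    and "h = (\<Sum>i=1..k. c i)"
    and "N = 2 * Lcm (c ` {1..k})"
    and "cc = (\<Prod>i=1..k. c i)"
  shows "(\<lambda>\<tau>. q_pow (real h / 8) \<tau> * Psi_C k c \<tau>)
           \<in> modular_forms (int (k div 2)) N
               (\<lambda>d. of_int (kronecker ((-1) ^ (k div 2) * 4 * int cc) d))
         \<longleftrightarrow> [h = 0] (mod 8)"
proof -
  define l where "l = k div 2"
  have k: "k = 2 * l" using assms(2) by (simp add: l_def)
  let ?I = "{1..k}"
  have I: "finite ?I" "card ?I = 2 * l" using k by auto
  have c_pos: "\<And>i. i \<in> ?I \<Longrightarrow> c i > 0" using assms(3) by blast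
  define F where "F = (\<lambda>\<tau>. q_pow (real h / 8) \<tau> * Psi_C k c \<tau>)"
  define Dis where "Dis = (-1) ^ l * 4 * int cc"
  define chi where "chi = (\<lambda>d. complex_of_int (kronecker Dis d))"
  define Th where "Th = (\<lambda>\<tau>. \<Prod>i\<in>?I. theta2 (of_nat (c i) * \<tau>))"
  have F_eq: "F \<tau> = (1/2) ^ k * Th \<tau>" if "Im \<tau> > 0" for \<tau>
    unfolding F_def Th_def assms(5) by (rule Psi_C_eq_prod_theta2[OF that c_pos])
  have F_shift: "F (\<tau> + 1) = ecis (real h / 8) * F \<tau>" for \<tau>
    unfolding F_def by (rule Psi_C_add_1)
  \<comment> \<open>Lets F be cancelled when multipliers are compared, both for the necessity of 8 |
    h and for the period of \<open>chi\<close>.\<close>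
  have F_i: "F \<i> \<noteq> 0"
  proof -
    have "Psi (of_nat (c i) * \<i>) \<noteq> 0" if "i \<in> ?I" for i
      using Psi_imaginary_nonzero[of "real (c i)"] c_pos[OF that] by (simp add: mult.commute)
    thus ?thesis by (simp add: F_def Psi_C_def q_pow_def)
  qed
  have cc_pos: "cc > 0" using c_pos unfolding assms(7) by (intro prod_pos) auto
  have evenN: "even N" by (simp add: assms(6))
  have c_dvd_N: "2 * c i dvd N" if "i \<in> ?I" for i
    unfolding assms(6) using that by (intro mult_dvd_mono dvd_Lcm) auto
  have Dis_abs: "\<bar>Dis\<bar> = 4 * int cc" by (simp add: Dis_def abs_mult)
  have Dis_neq1: "\<bar>Dis\<bar> \<noteq> 1" unfolding Dis_abs by presburger
  \<comment> \<open>N divides 4 cc, and conversely 2 and every \<open>c i\<close> divide N; so N and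
    the discriminant have the same prime divisors, which places the zeros of
    \<open>chi\<close>.\<close>
  have coprime_iff: "coprime n Dis \<longleftrightarrow> coprime n (int N)" for n
  proof
    assume *: "coprime n Dis"
    have "N dvd 4 * cc"
    proof -
      have "Lcm (c ` ?I) dvd cc" unfolding assms(7) by (intro Lcm_least) (auto intro: dvd_prodI)
      hence "2 * Lcm (c ` ?I) dvd 4 * cc" by (intro mult_dvd_mono) auto
      thus ?thesis by (simp only: assms(6))
    qed
    hence "int N dvd int (4 * cc)" by (simp only: int_dvd_int_iff)
    hence "int N dvd \<bar>Dis\<bar>" by (simp add: Dis_abs)
    hence "int N dvd Dis" by simp
    thus "coprime n (int N)" using * by (rule coprime_divisors[OF dvd_refl])
  next
    assume *: "coprime n (int N)"
    have "coprime n 2" using * evenN by (intro coprime_divisors[OF dvd_refl _ *]) simp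
    hence "coprime n (2 ^ 2)" by (rule coprime_power_right_iff[THEN iffD2, OF disjI1])
    hence 4: "coprime n 4" by simp
    have "coprime n (int (c i))" if "i \<in> ?I" for i
    proof (rule coprime_divisors[OF dvd_refl _ *])
      have "c i dvd N" using c_dvd_N[OF that] by (rule dvd_trans[rotated]) simp
      thus "int (c i) dvd int N" by simp
    qed
    hence "coprime n (int cc)" unfolding assms(7) of_nat_prod by (intro prod_coprime_right)
    hence "coprime n (4 * int cc)" using 4 by simp
    hence "coprime n \<bar>Dis\<bar>" by (simp only: Dis_abs)
    thus "coprime n Dis" by simp
  qed
  have Dis_sign: "Dis < 0 \<longleftrightarrow> odd l" using cc_pos by (cases "even l") (auto simp: Dis_def)
  \<comment> \<open>The same sign as in \<open>slash_uminus\<close>, so the transformation law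
    passes from A to -A.\<close>
  have chi_minus: "chi (- d) = (-1) ^ l * chi d" if "d \<noteq> 0" for d
    using kronecker_minus_right[OF that, of Dis] Dis_sign by (auto simp: chi_def)
  have chi_1: "chi 1 = 1" by (simp add: chi_def)
  have T: "mat2 1 1 0 1 \<in> Gamma0 N" by (simp add: mat2_in_Gamma0)
  have "F \<in> modular_forms (int l) N chi \<longleftrightarrow> [h = 0] (mod 8)"
  proof
    assume "F \<in> modular_forms (int l) N chi"
    \<comment> \<open>The translation by 1 lies in every \<open>Gamma0 N\<close> and has character
      value 1, which forces e(h/8) = 1.\<close>
    hence "slash (int l) F (mat2 1 1 0 1) \<i> = chi 1 * F \<i>"
      using T unfolding modular_forms_def by fastforce
    hence "F (\<i> + 1) = F \<i>"
      by (simp add: slash_def moebius_def automorphy_factor_def chi_1)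
    hence "ecis (real h / 8) = 1" using F_i by (simp add: F_shift)
    then obtain n where "real h / 8 = of_int n" by (auto simp: ecis_eq_1_iff elim: Ints_cases)
    hence "real_of_int (int h) = of_int (8 * n)" by simp
    hence "int h = 8 * n" by (simp only: of_int_eq_iff)
    hence "8 dvd h" by presburger
    thus "[h = 0] (mod 8)" by (simp add: cong_0_iff)
  next
    assume "[h = 0] (mod 8)"
    hence h8: "8 dvd h" by (simp add: cong_0_iff)
    have F_periodic: "F (\<tau> + 1) = F \<tau>" for \<tau>
    proof -
      obtain j where "h = 8 * j" using h8 by blast
      hence "real h / 8 = of_nat j" by simp
      thus ?thesis by (simp only: F_shift ecis_of_nat mult_1_left)
    qed
    have inv_pos: "slash (int l) F A \<tau> = chi (m22 A) * F \<tau>"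
      if A: "A \<in> Gamma0 N" and \<tau>: "Im \<tau> > 0" and d: "m22 A > 0" for A \<tau>
    proof -
      define a b c' D where "a = m11 A" "b = m12 A" "c' = m21 A" "D = nat (m22 A)"
      note defs = a_b_c'_D_def
      have D: "m22 A = int D" using d by (simp add: defs)
      have det: "a * int D - b * c' = 1"
        using A D by (simp add: Gamma0_def SL2Z_def det_2 defs(1-3))
      have Nc: "int N dvd c'" using A by (simp add: Gamma0_def defs)
      have c'_dvd: "int (2 * c i) dvd c'" if "i \<in> ?I" for i
        using c_dvd_N[OF that] Nc dvd_trans int_dvd_int_iff by blast
      have oddD: "odd D"
      proof
        assume "even D"
        moreover have "even c'" using Nc evenN dvd_trans[of 2 "int N" c'] by simp
        ultimately have "even (a * int D - b * c')" by simp
        thus False using det by simp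
      qed
      let ?j = "of_int c' * \<tau> + of_nat D"
      have j_eq: "automorphy_factor A \<tau> = ?j" by (simp add: automorphy_factor_def D defs(3))
      have nz: "?j \<noteq> 0"
        using automorphy_factor_nonzero[of A \<tau>] A \<tau> by (simp add: j_eq Gamma0_def)
      have Im: "Im (moebius A \<tau>) > 0" using A \<tau> by (intro Im_moebius_pos) (simp_all add: Gamma0_def)
      have m_eq: "moebius A \<tau> = (of_int a * \<tau> + of_int b) / ?j" by (simp add: moebius_def j_eq defs(1,2))
      have "Th (moebius A \<tau>) = of_int (kronecker ((-1) ^ l * (\<Prod>i\<in>?I. int (c i))) (int D)) * ?j ^ l * Th \<tau>"
        unfolding Th_def m_eq
        using h8 unfolding assms(5)
        by (intro prod_theta2_transform[OF oddD I c_pos c'_dvd det \<tau>])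
      also have "kronecker ((-1) ^ l * (\<Prod>i\<in>?I. int (c i))) (int D) = kronecker Dis (int D)"
      proof -
        have D0: "int D > 0" "odd (int D)" using d D oddD by auto
        \<comment> \<open>For odd D the factor 4 contributes (2/D)^2 = 1.\<close>
        have "Dis = ((-1) ^ l * int cc) * (2 * 2)" by (simp add: Dis_def)
        hence "kronecker Dis (int D) = kronecker ((-1) ^ l * int cc) (int D) * (kronecker 2 (int D))\<^sup>2"
          by (simp only: kronecker_mult_left[OF D0] power2_eq_square)
        also have "(kronecker 2 (int D))\<^sup>2 = 1" using D0 by (intro kronecker_square_eq_1) auto
        finally show ?thesis by (simp add: assms(7))
      qed
      finally have "Th (moebius A \<tau>) = chi (int D) * ?j ^ l * Th \<tau>" by (simp only: chi_def)
      hence "F (moebius A \<tau>) = chi (int D) * ?j ^ l * F \<tau>"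
        using F_eq[OF Im] F_eq[OF \<tau>] by (simp only: mult_ac)
      thus ?thesis unfolding slash_def j_eq D using nz by (simp add: power_int_minus)
    qed
    have inv: "slash (int l) F A \<tau> = chi (m22 A) * F \<tau>"
      if A: "A \<in> Gamma0 N" and \<tau>: "Im \<tau> > 0" for A \<tau>
    proof (cases "m22 A > 0")
      case True
      thus ?thesis by (rule inv_pos[OF A \<tau>])
    next
      case False
      have "m22 A \<noteq> 0"
      proof
        assume "m22 A = 0"
        hence "- (m12 A * m21 A) = 1" using A by (simp add: Gamma0_def SL2Z_def det_2)
        moreover have "even (m21 A)" using A evenN dvd_trans[of 2 "int N" "m21 A"] by (simp add: Gamma0_def)
        ultimately show False by (metis even_minus even_mult_iff odd_one)
      qed
      hence d: "m22 A < 0" using False by simp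
      have "- A \<in> Gamma0 N" using A by (simp add: Gamma0_def uminus_SL2Z)
      from inv_pos[OF this \<tau>] have "slash (int l) F (- A) \<tau> = chi (- (m22 A)) * F \<tau>" using d by simp
      hence "(-1) ^ l * slash (int l) F A \<tau> = (-1) ^ l * (chi (m22 A) * F \<tau>)"
        using d by (simp add: slash_uminus chi_minus)
      thus ?thesis by simp
    qed
    have chi_zero: "chi n = 0 \<longleftrightarrow> \<not> coprime n (int N)" for n
      using kronecker_eq_0_iff[OF Dis_neq1, of n] coprime_iff by (simp add: chi_def)
    have chi_per: "chi (d + int N) = chi d" for d
    proof (cases "coprime d (int N)")
      case False
      hence "\<not> coprime (d + int N) (int N)" by (simp add: coprime_iff_gcd_eq_1)
      thus ?thesis using False chi_zero[of d] chi_zero[of "d + int N"] by simp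
    next
      case True
      obtain a where "[d * a = 1] (mod int N)" using True cong_solve_coprime_int by blast
      then obtain b where "d * a - 1 = int N * b" by (auto simp: cong_iff_dvd_diff dvd_def)
      hence det: "a * d - b * int N = 1" by (simp add: algebra_simps)
      \<comment> \<open>The inverse a of d modulo N completes the row (N, d) to determinant 1, and
        \<open>?B\<close> is \<open>?A\<close> times the translation by 1. As F has period 1 and is
        nonzero at i, the laws for both matrices force equal character values.\<close>
      let ?A = "mat2 a b (int N) d" and ?B = "mat2 a (a + b) (int N) (d + int N)"
      have AB: "?A \<in> Gamma0 N" "?B \<in> Gamma0 N"
        using det by (auto simp: mat2_in_Gamma0 algebra_simps)
      have "slash (int l) F ?B \<i> = slash (int l) F ?A (\<i> + 1)"
        by (simp add: slash_def moebius_def automorphy_factor_def algebra_simps)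
      moreover have "slash (int l) F ?B \<i> = chi (d + int N) * F \<i>" using inv[OF AB(2), of \<i>] by simp
      moreover have "slash (int l) F ?A (\<i> + 1) = chi d * F (\<i> + 1)" using inv[OF AB(1), of "\<i> + 1"] by simp
      ultimately have "chi (d + int N) * F \<i> = chi d * F \<i>" by (simp only: F_periodic)
      thus ?thesis using F_i by simp
    qed
    have "dirichlet_character N chi"
      unfolding dirichlet_character_def
    proof (intro conjI allI impI)
      show "chi (m * n) = chi m * chi n" for m n
        by (simp add: chi_def kronecker_mult_right[OF Dis_neq1])
      show "chi m = chi n" if mn: "[m = n] (mod int N)" for m n
      proof -
        obtain j where "m - n = int N * j" using mn by (auto simp: cong_iff_dvd_diff dvd_def)
        hence "m = n + int N * j" by simp
        thus ?thesis using periodic_add_mult[of chi N n j, OF chi_per] by simp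
      qed
    qed (use chi_1 chi_zero in auto)
    moreover have "F holomorphic_on upper_half_plane"
    proof -
      have "(\<lambda>\<tau>. theta2 (of_nat (c i) * \<tau>)) holomorphic_on {\<tau>. Im \<tau> > 0}" if "i \<in> ?I" for i
      proof -
        have "(Theta odd_ind \<circ> (\<lambda>\<tau>. of_nat (c i) * \<tau> / 4)) holomorphic_on {\<tau>. Im \<tau> > 0}"
          using c_pos[OF that]
          by (intro holomorphic_on_compose_gen[OF _ Theta_holomorphic[OF bounded_odd_ind]] holomorphic_intros) auto
        thus ?thesis by (simp add: theta2_def o_def)
      qed
      hence "(\<lambda>\<tau>. (1/2) ^ k * Th \<tau>) holomorphic_on {\<tau>. Im \<tau> > 0}"
        unfolding Th_def by (intro holomorphic_on_mult holomorphic_on_const holomorphic_on_prod)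
      thus ?thesis by (rule holomorphic_transform) (simp add: F_eq)
    qed
    moreover have "holomorphic_at_i_infinity (slash (int l) F A)" if A: "A \<in> SL2Z" for A
    proof -
      have "holomorphic_at_i_infinity (\<lambda>\<tau>. (1/2) ^ k * slash (int l) Th A \<tau>)"
        unfolding Th_def
        by (intro holomorphic_at_i_infinity_cmult holomorphic_at_i_infinity_prod_theta2 I c_pos A)
      moreover have "slash (int l) F A \<tau> = (1/2) ^ k * slash (int l) Th A \<tau>" if "Im \<tau> > 0" for \<tau>
        using F_eq[OF Im_moebius_pos[OF A that]] by (simp add: slash_def)
      ultimately show ?thesis by (subst holomorphic_at_i_infinity_cong) auto
    qed
    ultimately show "F \<in> modular_forms (int l) N chi"
      unfolding modular_forms_def using inv by auto
  qed
  thus ?thesis by (simp only: F_def chi_def Dis_def l_def)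
qed

end
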